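(* Let $\Psi \in \mathbf{H}^3(\Omega)\cap\mathbf{X}$ be a regular solution to the continuous problem. Fix $\Gamma\ge0$ and assume $C_{\mathcal D}\le \Gamma$, $\Gamma(E_{\mathcal D})\le \Gamma$, $\omega(E_{\mathcal D})\le\rho$, $\alpha_{\mathcal D}\le\rho$, $\gamma_{\mathcal D}\le\rho$, and $\rho \|\Psi\|_{3}\le \frac{\hat{\beta}}{2\|\mathcal{B}\| C_{\mathcal D}(1+C_{\mathcal D})}$, with $\rho>0$ chosen sufficiently small. Then there exists $\mathcal K>0$ not depending on $\rho$ or $\mathcal D$ such that, setting $R=\mathcal{K}\rho$, $\mu$ maps $B_R(P_{\mathcal D}\Psi)=\{\Phi_{\mathcal D} \in \mathbf{X}_{\mathcal D,0}: \| \Phi_{\mathcal D}-P_{\mathcal D} \Psi\|_{\mathcal D}\le R\}$ into itself.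
   Context: Setting: $\Omega \subsetneq \mathbb{R}^d$, $d \le 3$, is a bounded convex domain; $k\ge1$, $\mathbf{E}=E^k$; $X=H^2_0(\Omega)$, $\mathbf X = X^k$. $\mathcal{A}(\Phi,\Theta)=\int_{\Omega}\Phi:\Theta \,dx$ and $\mathcal{B}(\Phi,\Theta,\Xi)=\int_{\Omega}\Phi:h(\Theta, \Xi)\,dx$ with $h$ bilinear on $\mathbb{R}^{dk}\times\mathbb{R}^{dk}$; $\mathcal B$ is continuous trilinear on $\mathbf{L}^2(\Omega;\mathbb{R}^{d\times d}) \times \mathbf{L}^4(\Omega;\mathbb{R}^d) \times \mathbf{L}^4(\Omega;\mathbb{R}^d)$ with norm $\|\mathcal B\|$ and $\mathcal{B}(\Xi,\Theta,\Theta)=0$; $\mathcal L\in\mathbf H^{-1}(\Omega)$. The continuous problem seeks $\Psi\in\mathbf X$ with $\mathcal{A}(\mathcal H \Psi,\mathcal H \Phi)+\mathcal{B}(\mathcal H \Psi, \nabla \Psi, \nabla \Phi)=\mathcal{L}(\Phi)$ for all $\Phi \in \mathbf{X}$. A Hessian discretisation $\mathcal D=(X_{\mathcal D,0},\Pi_{\mathcal D},\nabla_{\mathcal D},\mathcal H_{\mathcal D})$: finite-dimensional $X_{\mathcal D,0}$ and linear maps $\Pi_{\mathcal D}$ into $L^2(\Omega)$, $\nabla_{\mathcal D}$ into $L^4(\Omega;\mathbb R^d)$, $\mathcal H_{\mathcal D}$ into $L^2(\Omega;\mathbb R^{d\times d})$ with $\|\cdot\|_{\mathcal D}:=\|\mathcal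 H_{\mathcal D}\cdot\|$ a norm; $\mathbf X_{\mathcal D,0}=X_{\mathcal D,0}^k$. $E_{\mathcal D}:X_{\mathcal D,0}\to X$ is a linear companion operator with $\omega(E_{\mathcal D})=\sup\|\nabla_{\mathcal D}\psi_{\mathcal D}-\nabla E_{\mathcal D}\psi_{\mathcal D}\|/\|\psi_{\mathcal D}\|_{\mathcal D}$ and $\Gamma(E_{\mathcal D})=\sup\|\mathcal H E_{\mathcal D}\psi_{\mathcal D}\|/\|\psi_{\mathcal D}\|_{\mathcal D}$. $C_{\mathcal D}=\max_{w}\max\{\|\Pi_{\mathcal D}w\|,\|\nabla_{\mathcal D}w\|_{0,4}\}/\|w\|_{\mathcal D}$; $S_{\mathcal D}(\varphi)=\min_{w}(\|\Pi_{\mathcal D}w-\varphi\|+\|\nabla_{\mathcal D}w-\nabla\varphi\|_{0,4}+\|\mathcal H_{\mathcal D}w-\mathcal H\varphi\|)$, with $P_{\mathcal D}\Phi$ the corresponding argmin; $\widetilde W_{\mathcal D}(\xi)=\max_{w}\frac{1}{\|w\|_{\mathcal D}}|\int_\Omega(\xi:\mathcal H_{\mathcal D}w+(\mathrm{div}\,\xi)\cdot\nabla_{\mathcal D}w)\,dx|$; $\alpha_{\mathcal D}=\sup_{\phi\in H^3(\Omega)\cap X}S_{\mathcal D}(\phi)/\|\phi\|_3$, $\gamma_{\mathcal D}=\sup_{\xi\in H^1(\Omega;\mathbb R^{d\times d})}\widetilde W_{\mathcal D}(\xi)/\|\xi\|_1$. $\Psi$ is regular: the linearized form $\mathbb{A}_\Psi(\Theta,\Phi)=\mathcal{A}(\mathcal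 H \Theta,\mathcal H \Phi)+\mathcal{B}(\mathcal H \Psi, \nabla \Theta, \nabla \Phi)+\mathcal{B}(\mathcal H \Theta, \nabla \Psi, \nabla \Phi)$ satisfies an inf-sup condition on $\mathbf X$ with constant $\beta>0$; then (for $\rho$ small) the discrete linearized form $\mathbb{A}_{\mathcal D,\Psi}(\Theta_{\mathcal D}, \Phi_{\mathcal D})=\mathcal{A}(\mathcal H_{\mathcal D} \Theta_{\mathcal D},\mathcal H_{\mathcal D} \Phi_{\mathcal D})+\mathcal{B}(\mathcal H \Psi, \nabla_{\mathcal D} \Theta_{\mathcal D}, \nabla_{\mathcal D} \Phi_{\mathcal D})+\mathcal{B}(\mathcal H_{\mathcal D} \Theta_{\mathcal D}, \nabla \Psi, \nabla_{\mathcal D} \Phi_{\mathcal D})$ has discrete inf-sup constant $\hat\beta>0$ (depending on $\Gamma$ and $\beta$), and the perturbed form $\mathfrak{A}_{\mathcal D,\Psi}(\Theta_{\mathcal D}, \Phi_{\mathcal D})=\mathcal{A}(\mathcal H_{\mathcal D} \Theta_{\mathcal D},\mathcal H_{\mathcal D} \Phi_{\mathcal D})+\mathcal{B}(\mathcal H_{\mathcal D} P_{\mathcal D} \Psi, \nabla_{\mathcal D} \Theta_{\mathcal D}, \nabla_{\mathcal D} \Phi_{\mathcal D})+\mathcal{B}(\mathcal H_{\mathcal D} \Theta_{\mathcal D}, \nabla_{\mathcal D} P_{\mathcal D} \Psi, \nabla_{\mathcal D} \Phi_{\mathcal D})$ satisfies a discrete inf-sup condition with constant $\hat\beta/2$ on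 $\mathbf X_{\mathcal D,0}$. The map $\mu:\mathbf{X}_{\mathcal D,0} \to \mathbf{X}_{\mathcal D,0}$ is defined by: $\mu(\Theta_{\mathcal D})$ is the unique solution of $\mathfrak{A}_{\mathcal D,\Psi}(\mu(\Theta_{\mathcal D}),\Phi_{\mathcal D})=\mathcal{L}(E_{\mathcal D} \Phi_{\mathcal D})+\mathcal{B}(\mathcal H_{\mathcal D} P_{\mathcal D} \Psi, \nabla_{\mathcal D} \Theta_{\mathcal D}, \nabla_{\mathcal D} \Phi_{\mathcal D})+\mathcal{B}(\mathcal H_{\mathcal D} \Theta_{\mathcal D}, \nabla_{\mathcal D} P_{\mathcal D} \Psi, \nabla_{\mathcal D} \Phi_{\mathcal D})-\mathcal{B}(\mathcal H_{\mathcal D} \Theta_{\mathcal D}, \nabla_{\mathcal D} \Theta_{\mathcal D}, \nabla_{\mathcal D} \Phi_{\mathcal D})$ for all $\Phi_{\mathcal D} \in \mathbf{X}_{\mathcal D,0}$; its fixed points are exactly the solutions of the Hessian scheme $\mathcal{A}(\mathcal H_{\mathcal D} \Psi_{\mathcal D},\mathcal H_{\mathcal D} \Phi_{\mathcal D})+\mathcal{B}(\mathcal H_{\mathcal D} \Psi_{\mathcal D}, \nabla_{\mathcal D} \Psi_{\mathcal D}, \nabla_{\mathcal D} \Phi_{\mathcal D})=\mathcal{L}(E_{\mathcal D}\Phi_{\mathcal D})$. *)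

theory Defs
  imports "HOL-Analysis.Analysis"
begin

definition dint :: "(real^'d) set \<Rightarrow> (real^'d \<Rightarrow> real) \<Rightarrow> real" where
  "dint \<Omega> f = integral\<^sup>L (lebesgue_on \<Omega>) f"

definition Lp :: "(real^'d) set \<Rightarrow> real \<Rightarrow> (real^'d \<Rightarrow> 'a::euclidean_space) \<Rightarrow> bool" where
  "Lp \<Omega> p u \<longleftrightarrow> u \<in> borel_measurable (lebesgue_on \<Omega>)
      \<and> integrable (lebesgue_on \<Omega>) (\<lambda>x. norm (u x) powr p)"

definition Lpnorm :: "(real^'d) set \<Rightarrow> real \<Rightarrow> (real^'d \<Rightarrow> 'a::euclidean_space) \<Rightarrow> real" where
  "Lpnorm \<Omega> p u = (dint \<Omega> (\<lambda>x. norm (u x) powr p)) powr (1 / p)"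

definition cpartial :: "'d::finite \<Rightarrow> (real^'d \<Rightarrow> real) \<Rightarrow> real^'d \<Rightarrow> real" where
  "cpartial i f x = (THE D. ((\<lambda>t. f (x + t *\<^sub>R axis i 1)) has_real_derivative D) (at 0))"

fun cpartials :: "'d::finite list \<Rightarrow> (real^'d \<Rightarrow> real) \<Rightarrow> real^'d \<Rightarrow> real" where
  "cpartials [] f = f"
| "cpartials (i # is) f = cpartial i (cpartials is f)"

definition smooth_fun :: "(real^'d::finite \<Rightarrow> real) \<Rightarrow> bool" where
  "smooth_fun f \<longleftrightarrow> (\<forall>is x. cpartials is f differentiable (at x))"

definition test_fun :: "(real^'d::finite) set \<Rightarrow> (real^'d \<Rightarrow> real) \<Rightarrow> bool" where
  "test_fun \<Omega> f \<longleftrightarrow> smooth_fun f \<and> compact (closure {x. f x \<noteq> 0})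
      \<and> closure {x. f x \<noteq> 0} \<subseteq> \<Omega>"

definition mi_ord :: "('d::finite \<Rightarrow> nat) \<Rightarrow> nat" where
  "mi_ord \<alpha> = (\<Sum>i\<in>UNIV. \<alpha> i)"

definition mi_unit :: "'d \<Rightarrow> 'd \<Rightarrow> nat" where
  "mi_unit i = (\<lambda>j. if j = i then 1 else 0)"

text \<open>Classical derivative D^alpha of a smooth function (order irrelevant by Schwarz).\<close>
definition cderiv :: "('d::finite \<Rightarrow> nat) \<Rightarrow> (real^'d \<Rightarrow> real) \<Rightarrow> real^'d \<Rightarrow> real" where
  "cderiv \<alpha> f = cpartials (SOME is. \<forall>i. count_list is i = \<alpha> i) f"

definition is_weak_deriv :: "(real^'d::finite) set \<Rightarrow> ('d \<Rightarrow> nat) \<Rightarrow> (real^'d \<Rightarrow> real) \<Rightarrow> (real^'d \<Rightarrow> real) \<Rightarrow> bool" where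
  "is_weak_deriv \<Omega> \<alpha> u g \<longleftrightarrow> (\<forall>\<phi>. test_fun \<Omega> \<phi> \<longrightarrow>
      dint \<Omega> (\<lambda>x. u x * cderiv \<alpha> \<phi> x) = (-1) ^ mi_ord \<alpha> * dint \<Omega> (\<lambda>x. g x * \<phi> x))"

text \<open>The (a.e. unique) weak derivative in L^2.\<close>
definition wd :: "(real^'d::finite) set \<Rightarrow> ('d \<Rightarrow> nat) \<Rightarrow> (real^'d \<Rightarrow> real) \<Rightarrow> real^'d \<Rightarrow> real" where
  "wd \<Omega> \<alpha> u = (SOME g. Lp \<Omega> 2 g \<and> is_weak_deriv \<Omega> \<alpha> u g)"

definition Hs :: "(real^'d::finite) set \<Rightarrow> nat \<Rightarrow> (real^'d \<Rightarrow> real) \<Rightarrow> bool" where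
  "Hs \<Omega> m u \<longleftrightarrow> Lp \<Omega> 2 u \<and>
     (\<forall>\<alpha>. mi_ord \<alpha> \<le> m \<longrightarrow> (\<exists>g. Lp \<Omega> 2 g \<and> is_weak_deriv \<Omega> \<alpha> u g))"

definition Hnorm :: "(real^'d::finite) set \<Rightarrow> nat \<Rightarrow> (real^'d \<Rightarrow> real) \<Rightarrow> real" where
  "Hnorm \<Omega> m u = sqrt (\<Sum>\<alpha>\<in>{\<alpha>. mi_ord \<alpha> \<le> m}. (Lpnorm \<Omega> 2 (wd \<Omega> \<alpha> u)) ^ 2)"

definition Hs0 :: "(real^'d::finite) set \<Rightarrow> nat \<Rightarrow> (real^'d \<Rightarrow> real) \<Rightarrow> bool" where
  "Hs0 \<Omega> m u \<longleftrightarrow> Hs \<Omega> m u \<and> (\<exists>f. (\<forall>j. test_fun \<Omega> (f j)) \<and>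
      (\<lambda>j. Hnorm \<Omega> m (\<lambda>x. f j x - u x)) \<longlonglongrightarrow> 0)"

definition wgrad :: "(real^'d::finite) set \<Rightarrow> (real^'d \<Rightarrow> real) \<Rightarrow> real^'d \<Rightarrow> real^'d" where
  "wgrad \<Omega> u = (\<lambda>x. \<chi> i. wd \<Omega> (mi_unit i) u x)"

definition whess :: "(real^'d::finite) set \<Rightarrow> (real^'d \<Rightarrow> real) \<Rightarrow> real^'d \<Rightarrow> real^'d^'d" where
  "whess \<Omega> u = (\<lambda>x. \<chi> i j. wd \<Omega> (\<lambda>l. mi_unit i l + mi_unit j l) u x)"

definition wdiv :: "(real^'d::finite) set \<Rightarrow> (real^'d \<Rightarrow> real^'d^'d) \<Rightarrow> real^'d \<Rightarrow> real^'d" where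
  "wdiv \<Omega> \<xi> = (\<lambda>x. \<chi> i. \<Sum>j\<in>UNIV. wd \<Omega> (mi_unit j) (\<lambda>y. \<xi> y $ i $ j) x)"

definition vhess :: "(real^'d::finite) set \<Rightarrow> ('k::finite \<Rightarrow> real^'d \<Rightarrow> real) \<Rightarrow> real^'d \<Rightarrow> real^'d^'d^'k" where
  "vhess \<Omega> \<Psi> = (\<lambda>x. \<chi> \<kappa>. whess \<Omega> (\<Psi> \<kappa>) x)"

definition vgrad :: "(real^'d::finite) set \<Rightarrow> ('k::finite \<Rightarrow> real^'d \<Rightarrow> real) \<Rightarrow> real^'d \<Rightarrow> real^'d^'k" where
  "vgrad \<Omega> \<Psi> = (\<lambda>x. \<chi> \<kappa>. wgrad \<Omega> (\<Psi> \<kappa>) x)"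

definition vX :: "(real^'d::finite) set \<Rightarrow> ('k::finite \<Rightarrow> real^'d \<Rightarrow> real) \<Rightarrow> bool" where
  "vX \<Omega> \<Psi> \<longleftrightarrow> (\<forall>\<kappa>. Hs0 \<Omega> 2 (\<Psi> \<kappa>))"

definition vHnorm :: "(real^'d::finite) set \<Rightarrow> nat \<Rightarrow> ('k::finite \<Rightarrow> real^'d \<Rightarrow> real) \<Rightarrow> real" where
  "vHnorm \<Omega> m \<Psi> = sqrt (\<Sum>\<kappa>\<in>UNIV. (Hnorm \<Omega> m (\<Psi> \<kappa>)) ^ 2)"

definition mHnorm1 :: "(real^'d::finite) set \<Rightarrow> (real^'d \<Rightarrow> real^'d^'d) \<Rightarrow> real" where
  "mHnorm1 \<Omega> \<xi> = sqrt (\<Sum>i\<in>UNIV. \<Sum>j\<in>UNIV. (Hnorm \<Omega> 1 (\<lambda>x. \<xi> x $ i $ j)) ^ 2)"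

definition formA :: "(real^'d::finite) set \<Rightarrow> (real^'d \<Rightarrow> real^'d^'d^'k::finite) \<Rightarrow> (real^'d \<Rightarrow> real^'d^'d^'k) \<Rightarrow> real" where
  "formA \<Omega> \<Phi> \<Theta> = dint \<Omega> (\<lambda>x. \<Phi> x \<bullet> \<Theta> x)"

definition formB :: "(real^'d::finite) set \<Rightarrow> (real^'d^'k \<Rightarrow> real^'d^'k \<Rightarrow> real^'d^'d^'k::finite)
     \<Rightarrow> (real^'d \<Rightarrow> real^'d^'d^'k) \<Rightarrow> (real^'d \<Rightarrow> real^'d^'k) \<Rightarrow> (real^'d \<Rightarrow> real^'d^'k) \<Rightarrow> real" where
  "formB \<Omega> h \<Phi> \<Theta> \<Xi> = dint \<Omega> (\<lambda>x. \<Phi> x \<bullet> h (\<Theta> x) (\<Xi> x))"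

definition Bnorm :: "(real^'d::finite) set \<Rightarrow> (real^'d^'k \<Rightarrow> real^'d^'k \<Rightarrow> real^'d^'d^'k::finite) \<Rightarrow> real" where
  "Bnorm \<Omega> h = Inf {c. 0 \<le> c \<and> (\<forall>\<Phi> \<Theta> \<Xi>. Lp \<Omega> 2 \<Phi> \<longrightarrow> Lp \<Omega> 4 \<Theta> \<longrightarrow> Lp \<Omega> 4 \<Xi> \<longrightarrow>
      \<bar>formB \<Omega> h \<Phi> \<Theta> \<Xi>\<bar> \<le> c * Lpnorm \<Omega> 2 \<Phi> * Lpnorm \<Omega> 4 \<Theta> * Lpnorm \<Omega> 4 \<Xi>)}"

definition formAA :: "(real^'d::finite) set \<Rightarrow> (real^'d^'k \<Rightarrow> real^'d^'k \<Rightarrow> real^'d^'d^'k::finite)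
    \<Rightarrow> ('k \<Rightarrow> real^'d \<Rightarrow> real) \<Rightarrow> ('k \<Rightarrow> real^'d \<Rightarrow> real) \<Rightarrow> ('k \<Rightarrow> real^'d \<Rightarrow> real) \<Rightarrow> real" where
  "formAA \<Omega> h \<Psi> \<Theta> \<Phi> = formA \<Omega> (vhess \<Omega> \<Theta>) (vhess \<Omega> \<Phi>)
     + formB \<Omega> h (vhess \<Omega> \<Psi>) (vgrad \<Omega> \<Theta>) (vgrad \<Omega> \<Phi>)
     + formB \<Omega> h (vhess \<Omega> \<Theta>) (vgrad \<Omega> \<Psi>) (vgrad \<Omega> \<Phi>)"

definition is_Hminus1 :: "(real^'d::finite) set \<Rightarrow> (('k::finite \<Rightarrow> real^'d \<Rightarrow> real) \<Rightarrow> real) \<Rightarrow> bool" where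
  "is_Hminus1 \<Omega> L \<longleftrightarrow>
     (\<forall>a b \<Phi> \<Theta>. (\<forall>\<kappa>. Hs0 \<Omega> 1 (\<Phi> \<kappa>)) \<longrightarrow> (\<forall>\<kappa>. Hs0 \<Omega> 1 (\<Theta> \<kappa>)) \<longrightarrow>
        L (\<lambda>\<kappa> x. a * \<Phi> \<kappa> x + b * \<Theta> \<kappa> x) = a * L \<Phi> + b * L \<Theta>)
   \<and> (\<exists>c. \<forall>\<Phi>. (\<forall>\<kappa>. Hs0 \<Omega> 1 (\<Phi> \<kappa>)) \<longrightarrow> \<bar>L \<Phi>\<bar> \<le> c * vHnorm \<Omega> 1 \<Phi>)"

text \<open>The discrete space X_{D,0} is represented (up to linear isomorphism) as R^n,
  i.e. the vectors nat => real vanishing from index n on.\<close>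
definition XD :: "nat \<Rightarrow> (nat \<Rightarrow> real) set" where
  "XD n = {v. \<forall>i\<ge>n. v i = 0}"

definition lin_on :: "nat \<Rightarrow> ((nat \<Rightarrow> real) \<Rightarrow> real^'d \<Rightarrow> 'a::real_vector) \<Rightarrow> bool" where
  "lin_on n F \<longleftrightarrow> (\<forall>a b v w. v \<in> XD n \<longrightarrow> w \<in> XD n \<longrightarrow>
      F (\<lambda>i. a * v i + b * w i) = (\<lambda>x. a *\<^sub>R F v x + b *\<^sub>R F w x))"

definition hessian_disc :: "(real^'d::finite) set \<Rightarrow> nat \<Rightarrow> ((nat \<Rightarrow> real) \<Rightarrow> real^'d \<Rightarrow> real)
   \<Rightarrow> ((nat \<Rightarrow> real) \<Rightarrow> real^'d \<Rightarrow> real^'d) \<Rightarrow> ((nat \<Rightarrow> real) \<Rightarrow> real^'d \<Rightarrow> real^'d^'d) \<Rightarrow> bool" where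
  "hessian_disc \<Omega> n PiD gD HD \<longleftrightarrow> lin_on n PiD \<and> lin_on n gD \<and> lin_on n HD
     \<and> (\<forall>w\<in>XD n. Lp \<Omega> 2 (PiD w) \<and> Lp \<Omega> 4 (gD w) \<and> Lp \<Omega> 2 (HD w))
     \<and> (\<forall>w\<in>XD n. Lpnorm \<Omega> 2 (HD w) = 0 \<longrightarrow> w = (\<lambda>_. 0))"

definition Dnorm :: "(real^'d::finite) set \<Rightarrow> ((nat \<Rightarrow> real) \<Rightarrow> real^'d \<Rightarrow> real^'d^'d) \<Rightarrow> (nat \<Rightarrow> real) \<Rightarrow> real" where
  "Dnorm \<Omega> HD w = Lpnorm \<Omega> 2 (HD w)"

definition vHD :: "((nat \<Rightarrow> real) \<Rightarrow> real^'d \<Rightarrow> real^'d^'d) \<Rightarrow> ('k::finite \<Rightarrow> nat \<Rightarrow> real) \<Rightarrow> real^'d \<Rightarrow> real^'d^'d^'k" where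
  "vHD HD \<Theta> = (\<lambda>x. \<chi> \<kappa>. HD (\<Theta> \<kappa>) x)"

definition vgD :: "((nat \<Rightarrow> real) \<Rightarrow> real^'d \<Rightarrow> real^'d) \<Rightarrow> ('k::finite \<Rightarrow> nat \<Rightarrow> real) \<Rightarrow> real^'d \<Rightarrow> real^'d^'k" where
  "vgD gD \<Theta> = (\<lambda>x. \<chi> \<kappa>. gD (\<Theta> \<kappa>) x)"

definition vDnorm :: "(real^'d::finite) set \<Rightarrow> ((nat \<Rightarrow> real) \<Rightarrow> real^'d \<Rightarrow> real^'d^'d) \<Rightarrow> ('k::finite \<Rightarrow> nat \<Rightarrow> real) \<Rightarrow> real" where
  "vDnorm \<Omega> HD \<Theta> = Lpnorm \<Omega> 2 (vHD HD \<Theta>)"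

definition vXD :: "nat \<Rightarrow> ('k::finite \<Rightarrow> nat \<Rightarrow> real) set" where
  "vXD n = {\<Theta>. \<forall>\<kappa>. \<Theta> \<kappa> \<in> XD n}"

definition vsub :: "('k \<Rightarrow> nat \<Rightarrow> real) \<Rightarrow> ('k \<Rightarrow> nat \<Rightarrow> real) \<Rightarrow> 'k \<Rightarrow> nat \<Rightarrow> real" where
  "vsub \<Theta> \<Phi> = (\<lambda>\<kappa> i. \<Theta> \<kappa> i - \<Phi> \<kappa> i)"

definition companion :: "(real^'d::finite) set \<Rightarrow> nat \<Rightarrow> ((nat \<Rightarrow> real) \<Rightarrow> real^'d \<Rightarrow> real) \<Rightarrow> bool" where
  "companion \<Omega> n E \<longleftrightarrow> lin_on n E \<and> (\<forall>w\<in>XD n. Hs0 \<Omega> 2 (E w))"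

definition omegaE :: "(real^'d::finite) set \<Rightarrow> nat \<Rightarrow> ((nat \<Rightarrow> real) \<Rightarrow> real^'d \<Rightarrow> real^'d)
   \<Rightarrow> ((nat \<Rightarrow> real) \<Rightarrow> real^'d \<Rightarrow> real^'d^'d) \<Rightarrow> ((nat \<Rightarrow> real) \<Rightarrow> real^'d \<Rightarrow> real) \<Rightarrow> real" where
  "omegaE \<Omega> n gD HD E = Sup {Lpnorm \<Omega> 2 (\<lambda>x. gD w x - wgrad \<Omega> (E w) x) / Dnorm \<Omega> HD w
      | w. w \<in> XD n \<and> w \<noteq> (\<lambda>_. 0)}"

definition GammaE :: "(real^'d::finite) set \<Rightarrow> nat
   \<Rightarrow> ((nat \<Rightarrow> real) \<Rightarrow> real^'d \<Rightarrow> real^'d^'d) \<Rightarrow> ((nat \<Rightarrow> real) \<Rightarrow> real^'d \<Rightarrow> real) \<Rightarrow> real" where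
  "GammaE \<Omega> n HD E = Sup {Lpnorm \<Omega> 2 (whess \<Omega> (E w)) / Dnorm \<Omega> HD w
      | w. w \<in> XD n \<and> w \<noteq> (\<lambda>_. 0)}"

definition CD :: "(real^'d::finite) set \<Rightarrow> nat \<Rightarrow> ((nat \<Rightarrow> real) \<Rightarrow> real^'d \<Rightarrow> real)
   \<Rightarrow> ((nat \<Rightarrow> real) \<Rightarrow> real^'d \<Rightarrow> real^'d) \<Rightarrow> ((nat \<Rightarrow> real) \<Rightarrow> real^'d \<Rightarrow> real^'d^'d) \<Rightarrow> real" where
  "CD \<Omega> n PiD gD HD = Sup {max (Lpnorm \<Omega> 2 (PiD w)) (Lpnorm \<Omega> 4 (gD w)) / Dnorm \<Omega> HD w
      | w. w \<in> XD n \<and> w \<noteq> (\<lambda>_. 0)}"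

definition SD_err :: "(real^'d::finite) set \<Rightarrow> ((nat \<Rightarrow> real) \<Rightarrow> real^'d \<Rightarrow> real)
   \<Rightarrow> ((nat \<Rightarrow> real) \<Rightarrow> real^'d \<Rightarrow> real^'d) \<Rightarrow> ((nat \<Rightarrow> real) \<Rightarrow> real^'d \<Rightarrow> real^'d^'d)
   \<Rightarrow> (real^'d \<Rightarrow> real) \<Rightarrow> (nat \<Rightarrow> real) \<Rightarrow> real" where
  "SD_err \<Omega> PiD gD HD \<phi> w = Lpnorm \<Omega> 2 (\<lambda>x. PiD w x - \<phi> x)
      + Lpnorm \<Omega> 4 (\<lambda>x. gD w x - wgrad \<Omega> \<phi> x) + Lpnorm \<Omega> 2 (\<lambda>x. HD w x - whess \<Omega> \<phi> x)"

definition SD :: "(real^'d::finite) set \<Rightarrow> nat \<Rightarrow> ((nat \<Rightarrow> real) \<Rightarrow> real^'d \<Rightarrow> real)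
   \<Rightarrow> ((nat \<Rightarrow> real) \<Rightarrow> real^'d \<Rightarrow> real^'d) \<Rightarrow> ((nat \<Rightarrow> real) \<Rightarrow> real^'d \<Rightarrow> real^'d^'d)
   \<Rightarrow> (real^'d \<Rightarrow> real) \<Rightarrow> real" where
  "SD \<Omega> n PiD gD HD \<phi> = Inf {SD_err \<Omega> PiD gD HD \<phi> w | w. w \<in> XD n}"

definition WD :: "(real^'d::finite) set \<Rightarrow> nat
   \<Rightarrow> ((nat \<Rightarrow> real) \<Rightarrow> real^'d \<Rightarrow> real^'d) \<Rightarrow> ((nat \<Rightarrow> real) \<Rightarrow> real^'d \<Rightarrow> real^'d^'d)
   \<Rightarrow> (real^'d \<Rightarrow> real^'d^'d) \<Rightarrow> real" where
  "WD \<Omega> n gD HD \<xi> = Sup {\<bar>dint \<Omega> (\<lambda>x. \<xi> x \<bullet> HD w x + wdiv \<Omega> \<xi> x \<bullet> gD w x)\<bar> / Dnorm \<Omega> HD w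
      | w. w \<in> XD n \<and> w \<noteq> (\<lambda>_. 0)}"

definition alphaD :: "(real^'d::finite) set \<Rightarrow> nat \<Rightarrow> ((nat \<Rightarrow> real) \<Rightarrow> real^'d \<Rightarrow> real)
   \<Rightarrow> ((nat \<Rightarrow> real) \<Rightarrow> real^'d \<Rightarrow> real^'d) \<Rightarrow> ((nat \<Rightarrow> real) \<Rightarrow> real^'d \<Rightarrow> real^'d^'d) \<Rightarrow> real" where
  "alphaD \<Omega> n PiD gD HD = Sup {SD \<Omega> n PiD gD HD \<phi> / Hnorm \<Omega> 3 \<phi>
      | \<phi>. Hs \<Omega> 3 \<phi> \<and> Hs0 \<Omega> 2 \<phi> \<and> Hnorm \<Omega> 3 \<phi> \<noteq> 0}"

definition gammaD :: "(real^'d::finite) set \<Rightarrow> nat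
   \<Rightarrow> ((nat \<Rightarrow> real) \<Rightarrow> real^'d \<Rightarrow> real^'d) \<Rightarrow> ((nat \<Rightarrow> real) \<Rightarrow> real^'d \<Rightarrow> real^'d^'d) \<Rightarrow> real" where
  "gammaD \<Omega> n gD HD = Sup {WD \<Omega> n gD HD \<xi> / mHnorm1 \<Omega> \<xi>
      | \<xi>. (\<forall>i j. Hs \<Omega> 1 (\<lambda>x. \<xi> x $ i $ j)) \<and> mHnorm1 \<Omega> \<xi> \<noteq> 0}"

definition frakA :: "(real^'d::finite) set \<Rightarrow> (real^'d^'k \<Rightarrow> real^'d^'k \<Rightarrow> real^'d^'d^'k::finite)
   \<Rightarrow> ((nat \<Rightarrow> real) \<Rightarrow> real^'d \<Rightarrow> real^'d) \<Rightarrow> ((nat \<Rightarrow> real) \<Rightarrow> real^'d \<Rightarrow> real^'d^'d)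
   \<Rightarrow> ('k \<Rightarrow> nat \<Rightarrow> real) \<Rightarrow> ('k \<Rightarrow> nat \<Rightarrow> real) \<Rightarrow> ('k \<Rightarrow> nat \<Rightarrow> real) \<Rightarrow> real" where
  "frakA \<Omega> h gD HD PPsi \<Theta> \<Phi> = formA \<Omega> (vHD HD \<Theta>) (vHD HD \<Phi>)
     + formB \<Omega> h (vHD HD PPsi) (vgD gD \<Theta>) (vgD gD \<Phi>)
     + formB \<Omega> h (vHD HD \<Theta>) (vgD gD PPsi) (vgD gD \<Phi>)"

end

theory Submission
  imports Defs
begin

text \<open>The discrete inf-sup condition is applied to \<open>\<mu>(\<Theta>) - P\<close>, where \<open>P\<close> is the interpolant of \<open>\<Psi>\<close>. By the equation
  defining \<open>\<mu>(\<Theta>)\<close> what remains is the consistency error of \<open>P\<close>, of size \<open>C \<rho>\<close>, and a term quadratic in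
  \<open>\<Theta> - P\<close>, of size \<open>C K\<^sup>2 \<rho>\<^sup>2\<close>; so \<open>K\<close> is chosen large first and then \<open>\<rho>\<close> small.

  For the consistency error one tests the continuous problem with the companion \<open>E \<Phi>\<close> and integrates by parts
  against \<open>H \<Psi> \<in> H\<^sup>1\<close>, which produces the quantities \<open>\<gamma>\<close>, \<open>\<omega>\<close> and \<open>\<alpha>\<close>. Since \<open>\<omega>\<close> controls
  \<open>\<nabla>(E \<Phi>) - \<nabla>\<^sub>D \<Phi>\<close> only in \<open>L\<^sup>2\<close>, the linear rate in \<open>\<rho>\<close> needs \<open>|H \<Psi>| |\<nabla> \<Psi>| \<in> L\<^sup>2\<close>. This is obtained from
  the Sobolev inequality \<open>H\<^sup>1\<^sub>0 \<subseteq> L\<^sup>6\<close> by testing the third derivatives of \<open>\<Psi>\<close> with truncations of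
  \<open>|\<nabla> \<Psi>|\<^sup>2 \<nabla> \<Psi>\<close>, so that no extension operator is required.\<close>

section \<open>Smooth functions\<close>

text \<open>The cubic test function is dictated by what has to come out. With v the gradient of
  \<Psi>, pairing the derivative of |v|^2 v with that of v produces |v|^2 |dv|^2, the square of the
  wanted product, while the other side of the pairing contains a third derivative in L^2 and a cube
  whose L^2 norm is the cube of the L^6 norm of v. The gradient belongs componentwise to H^1_0, the
  Hessian in general does not, so a Sobolev inequality for functions vanishing on the boundary
  reaches only the former. Truncation is forced by the passage from test functions to \<Psi>:
  quadratic coefficients need not converge against merely L^2 convergent derivatives, bounded ones
  do. A second obstacle is formal. Discrete quantities are suprema of real sets, and weak
  derivatives are arbitrary choices, so a hypothesis such as \<omega> \<le> \<rho> yields an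
  inequality only once the set is known to be bounded above. This is where equivalence of norms in
  finite dimension and bounds by the H^3 norm enter. Constants are crude throughout: only
  independence of \<rho> and of the discretisation matters.\<close>

lemma cpartial_frechet:
  assumes "f differentiable (at x)"
  shows "cpartial i f x = frechet_derivative f (at x) (axis i 1)"
    and "((\<lambda>t. f (x + t *\<^sub>R axis i 1)) has_real_derivative cpartial i f x) (at 0)"
proof -
  let ?D = "frechet_derivative f (at x)"
  have D: "(f has_derivative ?D) (at x)"
    using assms by (simp add: frechet_derivative_works)
  have lin: "linear ?D" using D by (rule has_derivative_linear)
  have "((\<lambda>t. x + t *\<^sub>R axis i (1::real)) has_derivative (\<lambda>t. t *\<^sub>R axis i 1)) (at 0)"
    by (auto intro!: derivative_eq_intros)
  from has_derivative_compose[OF this, of f ?D]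
  have "((\<lambda>t. f (x + t *\<^sub>R axis i 1)) has_derivative (\<lambda>t. ?D (t *\<^sub>R axis i 1))) (at 0)"
    using D by simp
  also have "(\<lambda>t. ?D (t *\<^sub>R axis i 1)) = (*) (?D (axis i 1))"
    by (auto simp: linear_cmul[OF lin])
  finally have *: "((\<lambda>t. f (x + t *\<^sub>R axis i 1)) has_real_derivative ?D (axis i 1)) (at 0)"
    by (simp add: has_field_derivative_def)
  show 1: "cpartial i f x = ?D (axis i 1)"
    unfolding cpartial_def using * by (intro the_equality) (auto intro: DERIV_unique)
  show "((\<lambda>t. f (x + t *\<^sub>R axis i 1)) has_real_derivative cpartial i f x) (at 0)"
    unfolding 1 by fact
qed

lemma cpartial_eqI:
  assumes "(f has_derivative f') (at x)"
  shows "cpartial i f x = f' (axis i 1)"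
proof -
  have "f differentiable (at x)" using assms differentiable_def by blast
  then show ?thesis using cpartial_frechet(1) frechet_derivative_at[OF assms] by metis
qed

lemma cpartial_line:
  assumes "\<And>x. f differentiable (at x)"
  shows "((\<lambda>t. f (x + t *\<^sub>R axis i 1)) has_real_derivative cpartial i f (x + t *\<^sub>R axis i 1)) (at t)"
proof -
  have "((\<lambda>s. f ((x + t *\<^sub>R axis i 1) + s *\<^sub>R axis i 1)) has_real_derivative cpartial i f (x + t *\<^sub>R axis i 1)) (at 0)"
    by (rule cpartial_frechet(2)[OF assms])
  then have "((\<lambda>s. f (x + (s + t) *\<^sub>R axis i 1)) has_real_derivative cpartial i f (x + t *\<^sub>R axis i 1)) (at 0)"
    by (simp add: algebra_simps)
  then show ?thesis
    using DERIV_shift[of "\<lambda>t. f (x + t *\<^sub>R axis i 1)" _ 0 t] by simp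
qed

lemma smooth_fun_differentiable: "smooth_fun f \<Longrightarrow> f differentiable (at x)"
  unfolding smooth_fun_def by (metis cpartials.simps(1))

lemma cpartials_append: "cpartials (xs @ ys) f = cpartials xs (cpartials ys f)"
  by (induction xs) auto

lemma smooth_fun_cpartials: "smooth_fun f \<Longrightarrow> smooth_fun (cpartials is f)"
  unfolding smooth_fun_def by (metis cpartials_append)

lemma smooth_fun_cpartial: "smooth_fun f \<Longrightarrow> smooth_fun (cpartial i f)"
  using smooth_fun_cpartials[of f "[i]"] by simp

lemma smooth_fun_continuous: "smooth_fun f \<Longrightarrow> continuous_on S f"
  by (intro continuous_at_imp_continuous_on ballI differentiable_imp_continuous_within
      smooth_fun_differentiable)

section \<open>Flat functions and an algebra of smooth functions\<close>

definition flat_exp :: "nat \<Rightarrow> real \<Rightarrow> real" where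
  "flat_exp n t = (if t > 0 then (1 / t) ^ n * exp (- (1 / t)) else 0)"

text \<open>With s = 1/t this says that one term of the exponential series, s^(n+2)/(n+2)!, is at
  most exp s. Vanishing of order two at 0 is what makes the difference quotient there tend to
  zero.\<close>

lemma flat_exp_bound: "\<bar>flat_exp n t\<bar> \<le> fact (n + 2) * t\<^sup>2"
proof (cases "t > 0")
  case True
  define s where "s = 1 / t"
  have s: "s > 0" "t = 1 / s" using True by (auto simp: s_def)
  have "s ^ (n + 2) / fact (n + 2) \<le> exp s"
  proof -
    have "s ^ (n + 2) / fact (n + 2) = (\<Sum>k\<in>{n+2}. s ^ k / fact k)" by simp
    also have "\<dots> \<le> (\<Sum>k. s ^ k / fact k)"
      using s summable_exp[of s]
      by (intro sum_le_suminf) (auto simp: divide_inverse mult.commute)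
    also have "\<dots> = exp s" by (simp add: exp_def scaleR_conv_of_real divide_inverse mult.commute)
    finally show ?thesis .
  qed
  then have "s ^ n * exp (- s) \<le> fact (n + 2) * (1 / s)\<^sup>2"
    using s(1) by (simp add: exp_minus field_simps power_add power2_eq_square del: fact_Suc)
  moreover have "\<bar>flat_exp n t\<bar> = s ^ n * exp (- s)"
    using True s(1) by (simp add: flat_exp_def s_def)
  ultimately show ?thesis unfolding s(2) by simp
qed (simp add: flat_exp_def)

text \<open>The power of 1/t is carried as an index so that the family is closed under
  differentiation up to linear combinations; smoothness then follows by induction, without a formula
  for higher derivatives.\<close>

lemma flat_exp_deriv:
  "(flat_exp n has_real_derivative (flat_exp (n + 2) t - real n * flat_exp (n + 1) t)) (at t)"
proof -
  consider "t > 0" | "t < 0" | "t = 0" by linarith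
  then show ?thesis
  proof cases
    case 1
    have "((\<lambda>t. (1 / t) ^ n * exp (- (1 / t))) has_real_derivative
        (flat_exp (n + 2) t - real n * flat_exp (n + 1) t)) (at t)"
      using 1
      apply (auto intro!: derivative_eq_intros simp: flat_exp_def)
      apply (cases n)
      apply (auto simp: field_simps power2_eq_square)
      done
    then show ?thesis
      by (rule has_field_derivative_transform_within_open[of _ _ _ "{0<..}"])
        (use 1 in \<open>auto simp: flat_exp_def\<close>)
  next
    case 2
    have "((\<lambda>t. 0) has_real_derivative (flat_exp (n + 2) t - real n * flat_exp (n + 1) t)) (at t)"
      using 2 by (auto intro!: derivative_eq_intros simp: flat_exp_def)
    then show ?thesis
      by (rule has_field_derivative_transform_within_open[of _ _ _ "{..<0}"])
        (use 2 in \<open>auto simp: flat_exp_def\<close>)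
  next
    case 3
    have "((\<lambda>h. flat_exp n h / h) \<longlongrightarrow> 0) (at 0)"
    proof (rule Lim_null_comparison)
      have "norm (flat_exp n h / h) \<le> fact (n + 2) * \<bar>h\<bar>" if "h \<noteq> 0" for h
      proof -
        have "norm (flat_exp n h / h) = \<bar>flat_exp n h\<bar> / \<bar>h\<bar>" by (simp add: abs_divide)
        also have "\<dots> \<le> (fact (n + 2) * h\<^sup>2) / \<bar>h\<bar>"
          by (intro divide_right_mono flat_exp_bound) auto
        also have "\<dots> = fact (n + 2) * (\<bar>h\<bar> * \<bar>h\<bar> / \<bar>h\<bar>)" by (simp add: power2_eq_square)
        also have "\<bar>h\<bar> * \<bar>h\<bar> / \<bar>h\<bar> = \<bar>h\<bar>" using that by (simp del: abs_mult_self_eq)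
        finally show ?thesis .
      qed
      then show "\<forall>\<^sub>F h in at 0. norm (flat_exp n h / h) \<le> fact (n + 2) * \<bar>h\<bar>"
        by (auto simp: eventually_at_filter)
      show "((\<lambda>h::real. fact (n + 2) * \<bar>h\<bar>) \<longlongrightarrow> 0) (at 0)"
        by (auto intro!: tendsto_eq_intros)
    qed
    then show ?thesis using 3 by (simp add: DERIV_def flat_exp_def)
  qed
qed

text \<open>A hull on which smoothness is proved by a single induction: every member is
  differentiable and its partial derivatives are members again. Since \<open>smooth_fun\<close>
  quantifies over all lists of directions, closing it directly under products or inverses would need
  a Leibniz rule for iterated derivatives.\<close>

inductive_set salg :: "(real^'d::finite \<Rightarrow> real) set" where
  smooth: "smooth_fun f \<Longrightarrow> f \<in> salg"
| const: "(\<lambda>x. c) \<in> salg"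
| flat: "(\<lambda>x. flat_exp n (c * x $ i + a)) \<in> salg"
| add: "f \<in> salg \<Longrightarrow> g \<in> salg \<Longrightarrow> (\<lambda>x. f x + g x) \<in> salg"
| mult: "f \<in> salg \<Longrightarrow> g \<in> salg \<Longrightarrow> (\<lambda>x. f x * g x) \<in> salg"
| inv: "f \<in> salg \<Longrightarrow> (\<And>x. f x \<noteq> 0) \<Longrightarrow> (\<lambda>x. inverse (f x)) \<in> salg"

lemma cpartial_const: "cpartial i (\<lambda>x. c) = (\<lambda>x. 0)"
  by (rule ext, subst cpartial_eqI[where f'="\<lambda>_. 0"]) auto

lemma cpartial_add:
  assumes "\<And>x. f differentiable (at x)" "\<And>x. g differentiable (at x)"
  shows "cpartial i (\<lambda>x. f x + g x) = (\<lambda>x. cpartial i f x + cpartial i g x)"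
  by (rule ext, subst cpartial_eqI[OF has_derivative_add[OF assms[unfolded frechet_derivative_works]]])
    (simp add: assms cpartial_frechet)

lemma cpartial_mult:
  assumes "\<And>x. f differentiable (at x)" "\<And>x. g differentiable (at x)"
  shows "cpartial i (\<lambda>x. f x * g x) = (\<lambda>x. f x * cpartial i g x + cpartial i f x * g x)"
  by (rule ext, subst cpartial_eqI[OF has_derivative_mult[OF assms[unfolded frechet_derivative_works]]])
    (simp add: assms cpartial_frechet)

lemma cpartial_inverse:
  assumes "\<And>x. f differentiable (at x)" "\<And>x. f x \<noteq> 0"
  shows "cpartial i (\<lambda>x. inverse (f x)) = (\<lambda>x. (-1) * (inverse (f x) * cpartial i f x * inverse (f x)))"
  by (rule ext, subst cpartial_eqI[OF Deriv.has_derivative_inverse[OF assms(2) assms(1)[unfolded frechet_derivative_works]]])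
    (simp add: assms cpartial_frechet)

lemma flat_comp_deriv:
  "((\<lambda>x::real^'d. flat_exp n (c * x $ i + a)) has_derivative
     (\<lambda>v. (flat_exp (n + 2) (c * x $ i + a) - real n * flat_exp (n + 1) (c * x $ i + a)) * (c * v $ i))) (at x)"
proof -
  have "((\<lambda>x::real^'d. c * x $ i + a) has_derivative (\<lambda>v. c * v $ i)) (at x)"
    by (auto intro!: derivative_eq_intros bounded_linear_imp_has_derivative bounded_linear_vec_nth)
  from has_derivative_compose[OF this flat_exp_deriv[unfolded has_field_derivative_def]]
  show ?thesis by simp
qed

lemma salg_step:
  "f \<in> salg \<Longrightarrow> (\<forall>x. f differentiable (at x)) \<and> (\<forall>i. cpartial i f \<in> salg)"
proof (induction rule: salg.induct)
  case (smooth f)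
  then show ?case by (simp add: salg.smooth smooth_fun_cpartial smooth_fun_differentiable)
next
  case (const c)
  then show ?case by (simp add: salg.const cpartial_const)
next
  case (flat n c j a)
  have "cpartial i (\<lambda>x. flat_exp n (c * x $ j + a)) \<in> salg" for i
  proof -
    have "cpartial i (\<lambda>x. flat_exp n (c * x $ j + a)) =
       (\<lambda>x. (flat_exp (n + 2) (c * x $ j + a) + (- real n) * flat_exp (n + 1) (c * x $ j + a)) * (c * axis i 1 $ j))"
      by (rule ext, subst cpartial_eqI[OF flat_comp_deriv]) simp
    also have "\<dots> \<in> salg" by (intro salg.intros)
    finally show ?thesis .
  qed
  moreover have "(\<lambda>x. flat_exp n (c * x $ j + a)) differentiable (at x)" for x
    using flat_comp_deriv differentiable_def by blast
  ultimately show ?case by blast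
next
  case (add f g)
  then show ?case by (auto simp: cpartial_add intro!: salg.add)
next
  case (mult f g)
  then show ?case by (auto simp: cpartial_mult intro!: salg.add salg.mult)
next
  case (inv f)
  have "cpartial i (\<lambda>x. inverse (f x)) \<in> salg" for i
  proof (subst cpartial_inverse)
    show "(\<lambda>x. (-1) * (inverse (f x) * cpartial i f x * inverse (f x))) \<in> salg"
      by (intro salg.mult salg.const salg.inv) (use inv in auto)
  qed (use inv in auto)
  then show ?case using inv by auto
qed

lemma salg_smooth: "f \<in> salg \<Longrightarrow> smooth_fun f"
proof -
  have "f \<in> salg \<Longrightarrow> cpartials is f \<in> salg" for "is"
    by (induction "is") (auto simp: salg_step)
  then show "f \<in> salg \<Longrightarrow> smooth_fun f" unfolding smooth_fun_def by (simp add: salg_step)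
qed

lemma smooth_fun_const: "smooth_fun (\<lambda>x. c)"
  and smooth_fun_flat: "smooth_fun (\<lambda>x. flat_exp n (c * x $ i + a))"
  by (auto intro!: salg_smooth salg.intros)

lemma smooth_fun_add: "smooth_fun f \<Longrightarrow> smooth_fun g \<Longrightarrow> smooth_fun (\<lambda>x. f x + g x)"
  and smooth_fun_mult: "smooth_fun f \<Longrightarrow> smooth_fun g \<Longrightarrow> smooth_fun (\<lambda>x. f x * g x)"
  and smooth_fun_inverse: "smooth_fun f \<Longrightarrow> (\<And>x. f x \<noteq> 0) \<Longrightarrow> smooth_fun (\<lambda>x. inverse (f x))"
  by (auto intro!: salg_smooth intro: salg.intros)

lemma smooth_fun_prod:
  assumes "finite S" "\<And>s. s \<in> S \<Longrightarrow> smooth_fun (f s)"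
  shows "smooth_fun (\<lambda>x. \<Prod>s\<in>S. f s x)"
  using assms by (induction S) (auto intro: smooth_fun_const smooth_fun_mult)

lemma smooth_fun_sum:
  assumes "finite S" "\<And>s. s \<in> S \<Longrightarrow> smooth_fun (f s)"
  shows "smooth_fun (\<lambda>x. \<Sum>s\<in>S. f s x)"
  using assms by (induction S) (auto intro: smooth_fun_const smooth_fun_add)

section \<open>Symmetry of mixed partial derivatives\<close>

lemma second_difference_mvt:
  fixes f :: "real^'d::finite \<Rightarrow> real"
  assumes f: "smooth_fun f" and h: "h > 0"
  shows "\<exists>s t. 0 < s \<and> s < h \<and> 0 < t \<and> t < h \<and>
    f (x + h *\<^sub>R axis i 1 + h *\<^sub>R axis j 1) - f (x + h *\<^sub>R axis i 1) - f (x + h *\<^sub>R axis j 1) + f x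
     = h * h * cpartial j (cpartial i f) (x + s *\<^sub>R axis i 1 + t *\<^sub>R axis j 1)"
proof -
  \<comment> \<open>The increment in direction j is formed first, so that the mean value theorem in
    direction i and then in direction j leaves a single mixed derivative.\<close>
  define \<phi> where "\<phi> s = f ((x + h *\<^sub>R axis j 1) + s *\<^sub>R axis i 1) - f (x + s *\<^sub>R axis i 1)" for s
  define \<phi>' where "\<phi>' s = cpartial i f ((x + h *\<^sub>R axis j 1) + s *\<^sub>R axis i 1) - cpartial i f (x + s *\<^sub>R axis i 1)" for s
  have "(\<phi> has_real_derivative \<phi>' s) (at s)" for s
    unfolding \<phi>_def \<phi>'_def
    by (intro DERIV_diff cpartial_line smooth_fun_differentiable f)
  from MVT2[OF h this] obtain s where s: "0 < s" "s < h" "\<phi> h - \<phi> 0 = h * \<phi>' s" by auto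
  have "((\<lambda>t. cpartial i f ((x + s *\<^sub>R axis i 1) + t *\<^sub>R axis j 1)) has_real_derivative
      cpartial j (cpartial i f) ((x + s *\<^sub>R axis i 1) + t *\<^sub>R axis j 1)) (at t)" for t
    by (intro cpartial_line smooth_fun_differentiable smooth_fun_cpartial f)
  from MVT2[OF h this] obtain t where t: "0 < t" "t < h"
    "cpartial i f ((x + s *\<^sub>R axis i 1) + h *\<^sub>R axis j 1) - cpartial i f (x + s *\<^sub>R axis i 1)
      = h * cpartial j (cpartial i f) ((x + s *\<^sub>R axis i 1) + t *\<^sub>R axis j 1)" by auto
  have "\<phi>' s = h * cpartial j (cpartial i f) ((x + s *\<^sub>R axis i 1) + t *\<^sub>R axis j 1)"
    using t(3) by (simp add: \<phi>'_def algebra_simps)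
  with s(3) have "\<phi> h - \<phi> 0 = h * h * cpartial j (cpartial i f) ((x + s *\<^sub>R axis i 1) + t *\<^sub>R axis j 1)"
    by simp
  then show ?thesis using s t by (intro exI[of _ s] exI[of _ t]) (auto simp: \<phi>_def algebra_simps)
qed

text \<open>The second difference is symmetric in i and j, and the mean value theorem writes it as
  h^2 times either mixed derivative at some point that tends to x with h. Continuity of both mixed
  derivatives then identifies them at x.\<close>

lemma cpartial_commute:
  fixes f :: "real^'d::finite \<Rightarrow> real"
  assumes f: "smooth_fun f"
  shows "cpartial j (cpartial i f) = cpartial i (cpartial j f)"
proof
  fix x
  define h where "h n = 1 / real (Suc n)" for n
  have h: "h n > 0" for n by (simp add: h_def)
  have h0: "h \<longlonglongrightarrow> 0"
    using LIMSEQ_inverse_real_of_nat unfolding h_def by (simp add: inverse_eq_divide)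
  have lim: "\<exists>y. y \<longlonglongrightarrow> x \<and> (\<forall>n. (f (x + h n *\<^sub>R axis i 1 + h n *\<^sub>R axis j 1)
      - f (x + h n *\<^sub>R axis i 1) - f (x + h n *\<^sub>R axis j 1) + f x)
        = h n * h n * cpartial j (cpartial i f) (y n))" for i j
  proof -
    obtain s t where st: "\<And>n. 0 < s n \<and> s n < h n \<and> 0 < t n \<and> t n < h n \<and>
      f (x + h n *\<^sub>R axis i 1 + h n *\<^sub>R axis j 1) - f (x + h n *\<^sub>R axis i 1) - f (x + h n *\<^sub>R axis j 1) + f x
       = h n * h n * cpartial j (cpartial i f) (x + s n *\<^sub>R axis i 1 + t n *\<^sub>R axis j 1)"
      using second_difference_mvt[OF f h, of _ x i j] by metis
    have "s \<longlonglongrightarrow> 0" "t \<longlonglongrightarrow> 0"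
      by (rule real_tendsto_sandwich[OF _ _ tendsto_const h0]; simp add: st less_imp_le)+
    then have "(\<lambda>n. x + s n *\<^sub>R axis i 1 + t n *\<^sub>R axis j 1) \<longlonglongrightarrow> x"
      by (auto intro!: tendsto_eq_intros)
    then show ?thesis using st by blast
  qed
  obtain y where y: "y \<longlonglongrightarrow> x" "\<And>n. f (x + h n *\<^sub>R axis i 1 + h n *\<^sub>R axis j 1)
      - f (x + h n *\<^sub>R axis i 1) - f (x + h n *\<^sub>R axis j 1) + f x
        = h n * h n * cpartial j (cpartial i f) (y n)" using lim[of i j] by blast
  obtain z where z: "z \<longlonglongrightarrow> x" "\<And>n. f (x + h n *\<^sub>R axis j 1 + h n *\<^sub>R axis i 1)
      - f (x + h n *\<^sub>R axis j 1) - f (x + h n *\<^sub>R axis i 1) + f x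
        = h n * h n * cpartial i (cpartial j f) (z n)" using lim[of j i] by blast
  have eq: "cpartial j (cpartial i f) (y n) = cpartial i (cpartial j f) (z n)" for n
  proof -
    have "h n * h n * cpartial j (cpartial i f) (y n) = h n * h n * cpartial i (cpartial j f) (z n)"
      unfolding y(2)[symmetric] z(2)[symmetric] by (simp add: algebra_simps)
    then show ?thesis using h[of n] by simp
  qed
  have cont: "isCont (cpartial a (cpartial b f)) x" for a b
    by (intro differentiable_imp_continuous_within smooth_fun_differentiable smooth_fun_cpartial f)
  have "(\<lambda>n. cpartial j (cpartial i f) (y n)) \<longlonglongrightarrow> cpartial j (cpartial i f) x"
    "(\<lambda>n. cpartial i (cpartial j f) (z n)) \<longlonglongrightarrow> cpartial i (cpartial j f) x"
    using isCont_tendsto_compose[OF cont y(1)] isCont_tendsto_compose[OF cont z(1)] by auto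
  then show "cpartial j (cpartial i f) x = cpartial i (cpartial j f) x"
    unfolding eq by (rule LIMSEQ_unique)
qed

section \<open>Derivatives indexed by multi-indices\<close>

lemma cpartials_snoc:
  assumes "smooth_fun f"
  shows "cpartials (xs @ i # ys) f = cpartial i (cpartials (xs @ ys) f)"
proof (induction xs)
  case (Cons a xs)
  then show ?case
    by (simp add: cpartial_commute[OF smooth_fun_cpartials[OF assms], of a i])
qed simp

lemma cpartials_perm:
  assumes f: "smooth_fun f"
  shows "mset xs = mset ys \<Longrightarrow> cpartials xs f = cpartials ys f"
proof (induction xs arbitrary: ys)
  case (Cons i xs)
  then have "i \<in> set ys" by (metis list.set_intros(1) set_mset_mset)
  then obtain as bs where ys: "ys = as @ i # bs" by (meson split_list)
  have "mset xs = mset (as @ bs)" using Cons.prems ys by simp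
  then show ?case using Cons.IH[of "as @ bs"] by (simp add: ys cpartials_snoc[OF f])
qed simp

text \<open>\<open>cderiv\<close> picks an unspecified list with the prescribed multiplicities. Any
  other such list has the same multiset, and iterated derivatives of a smooth function depend on
  nothing else.\<close>

lemma cderiv_eq:
  assumes f: "smooth_fun f" and "\<And>i. count_list is i = \<alpha> i"
  shows "cderiv \<alpha> f = cpartials is f"
proof -
  let ?P = "\<lambda>is. \<forall>i. count_list is i = \<alpha> i"
  have "?P (SOME is. ?P is)" using assms(2) by (intro someI[of ?P]) auto
  then have "mset (SOME is. ?P is) = mset is"
    using assms(2) by (intro multiset_eqI) (simp add: count_mset)
  then show ?thesis unfolding cderiv_def by (rule cpartials_perm[OF f])
qed

lemma ex_list_multi_index: "\<exists>is. \<forall>i. count_list is i = (\<alpha> :: 'd::finite \<Rightarrow> nat) i"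
proof -
  obtain "is" where "mset is = Abs_multiset \<alpha>" by (metis ex_mset)
  then show ?thesis by (metis count_mset count_Abs_multiset finite)
qed

lemma length_multi_index:
  assumes "\<And>i. count_list is i = (\<alpha> :: 'd::finite \<Rightarrow> nat) i"
  shows "length is = mi_ord \<alpha>"
proof -
  have "length is = (\<Sum>i\<in>set is. count_list is i)" by (simp add: sum_count_set)
  also have "\<dots> = (\<Sum>i\<in>UNIV. count_list is i)"
    by (rule sum.mono_neutral_left) (auto simp: count_list_0_iff)
  finally show ?thesis using assms by (simp add: mi_ord_def)
qed

lemma cderiv_zero: "smooth_fun f \<Longrightarrow> cderiv (\<lambda>_. 0) f = f"
  using cderiv_eq[of f "[]"] by simp

lemma cderiv_unit: "smooth_fun f \<Longrightarrow> cderiv (mi_unit i) f = cpartial i f"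
  using cderiv_eq[of f "[i]" "mi_unit i"] by (simp add: mi_unit_def)

lemma cderiv_unit2: "smooth_fun f \<Longrightarrow> cderiv (\<lambda>l. mi_unit i l + mi_unit j l) f = cpartial i (cpartial j f)"
  using cderiv_eq[of f "[i, j]" "\<lambda>l. mi_unit i l + mi_unit j l"] by (simp add: mi_unit_def)

lemma smooth_fun_cderiv: "smooth_fun f \<Longrightarrow> smooth_fun (cderiv \<alpha> f)"
  by (simp add: cderiv_def smooth_fun_cpartials)

lemma cderiv_cderiv:
  assumes "smooth_fun f"
  shows "cderiv \<alpha> (cderiv \<beta> f) = cderiv (\<lambda>l. \<alpha> l + \<beta> l) f"
proof -
  obtain as bs where ab: "\<And>i. count_list as i = \<alpha> i" "\<And>i. count_list bs i = \<beta> i"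
    using ex_list_multi_index by metis
  have "cderiv \<alpha> (cderiv \<beta> f) = cpartials as (cpartials bs f)"
    using cderiv_eq[OF smooth_fun_cderiv[OF assms] ab(1), of \<beta>] cderiv_eq[OF assms ab(2)] by metis
  also have "\<dots> = cderiv (\<lambda>l. \<alpha> l + \<beta> l) f"
    using cderiv_eq[OF assms, of "as @ bs" "\<lambda>l. \<alpha> l + \<beta> l"] ab
    by (simp add: cpartials_append)
  finally show ?thesis .
qed

section \<open>Lebesgue norms\<close>

text \<open>Every summand is at most the largest one, whose power is among the summands on the
  right. The argument needs no convexity and works for all p > 0.\<close>

lemma power_sum_bound:
  fixes a :: "'s \<Rightarrow> real"
  assumes S: "finite S" and a: "\<And>s. s \<in> S \<Longrightarrow> 0 \<le> a s" and p: "p > 0"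
  shows "(\<Sum>s\<in>S. a s) powr p \<le> real (card S) powr p * (\<Sum>s\<in>S. a s powr p)"
proof (cases "S = {}")
  case False
  define m where "m = Max (a ` S)"
  have "m \<in> a ` S" using S False by (simp add: m_def)
  then obtain t where t: "t \<in> S" "m = a t" by auto
  have le: "a s \<le> a t" if "s \<in> S" for s
    using that S unfolding t(2)[symmetric] m_def by simp
  have "(\<Sum>s\<in>S. a s) \<le> real (card S) * a t"
    using sum_bounded_above[of S a "a t"] le by simp
  then have "(\<Sum>s\<in>S. a s) powr p \<le> (real (card S) * a t) powr p"
    by (intro powr_mono2) (use p a in \<open>auto intro: sum_nonneg\<close>)
  also have "\<dots> = real (card S) powr p * a t powr p"
    by (rule powr_mult) 
  also have "a t powr p \<le> (\<Sum>s\<in>S. a s powr p)"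
    by (rule member_le_sum) (use t S in auto)
  finally show ?thesis by (simp add: mult_left_mono)
qed (use p in auto)

lemma Lpnorm_nonneg: "0 \<le> Lpnorm \<Omega> p u"
  by (simp add: Lpnorm_def)

lemma dint_powr_eq_Lpnorm:
  assumes "p > 0"
  shows "dint \<Omega> (\<lambda>x. norm (u x) powr p) = Lpnorm \<Omega> p u powr p"
proof -
  have "0 \<le> dint \<Omega> (\<lambda>x. norm (u x) powr p)" unfolding dint_def by (intro integral_nonneg_AE) auto
  then show ?thesis using assms by (simp add: Lpnorm_def powr_powr)
qed

lemma Lpnorm_cong_AE:
  assumes "AE x in lebesgue_on \<Omega>. u x = v x"
    and "u \<in> borel_measurable (lebesgue_on \<Omega>)" "v \<in> borel_measurable (lebesgue_on \<Omega>)"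
  shows "Lpnorm \<Omega> p u = Lpnorm \<Omega> p v"
  unfolding Lpnorm_def dint_def
  by (rule arg_cong[where f="\<lambda>z. z powr (1/p)"], rule integral_cong_AE)
    (use assms in auto)

text \<open>A substitute for Minkowski's inequality. One factor card S comes from
  \<open>power_sum_bound\<close> applied pointwise, the other from bounding each norm by the sum of
  all of them; p \<ge> 1 allows card S to be absorbed into its p-th power. Sums, differences,
  vectors and components in L^p are all treated as instances.\<close>

lemma Lp_dominated:
  fixes u :: "real^'d \<Rightarrow> 'a::euclidean_space" and v :: "'s \<Rightarrow> real^'d \<Rightarrow> 'b::euclidean_space"
  assumes S: "finite S" and v: "\<And>s. s \<in> S \<Longrightarrow> Lp \<Omega> p (v s)"
    and u[measurable]: "u \<in> borel_measurable (lebesgue_on \<Omega>)"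
    and le: "AE x in lebesgue_on \<Omega>. norm (u x) \<le> C * (\<Sum>s\<in>S. norm (v s x))"
    and C: "C \<ge> 0" and p: "p \<ge> 1"
  shows "Lp \<Omega> p u" "Lpnorm \<Omega> p u \<le> C * (real (card S))\<^sup>2 * (\<Sum>s\<in>S. Lpnorm \<Omega> p (v s))"
proof -
  let ?M = "lebesgue_on \<Omega>" and ?n = "real (card S)"
  let ?b = "\<lambda>x. C powr p * ?n powr p * (\<Sum>s\<in>S. norm (v s x) powr p)"
  have int: "integrable ?M ?b"
    using v by (intro integrable_mult_right integrable_sum) (auto simp: Lp_def)
  have bound: "AE x in ?M. norm (u x) powr p \<le> ?b x"
    using le
  proof eventually_elim
    case (elim x)
    have "norm (u x) powr p \<le> (C * (\<Sum>s\<in>S. norm (v s x))) powr p"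
      by (rule powr_mono2) (use elim p in auto)
    also have "\<dots> = C powr p * (\<Sum>s\<in>S. norm (v s x)) powr p" by (rule powr_mult)
    also have "\<dots> \<le> C powr p * (?n powr p * (\<Sum>s\<in>S. norm (v s x) powr p))"
      by (intro mult_left_mono power_sum_bound S) (use p in auto)
    finally show ?case by (simp add: mult.assoc)
  qed
  have int_u: "integrable ?M (\<lambda>x. norm (u x) powr p)"
    by (rule Bochner_Integration.integrable_bound[OF int]) (use bound in auto)
  then show "Lp \<Omega> p u" by (simp add: Lp_def)
  let ?N = "\<Sum>s\<in>S. Lpnorm \<Omega> p (v s)"
  have N0: "?N \<ge> 0" by (intro sum_nonneg Lpnorm_nonneg)
  have "dint \<Omega> (\<lambda>x. norm (u x) powr p) \<le> (\<integral>x. ?b x \<partial>?M)"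
    unfolding dint_def by (rule integral_mono_AE[OF int_u int bound])
  also have "\<dots> = C powr p * ?n powr p * (\<Sum>s\<in>S. \<integral>x. norm (v s x) powr p \<partial>?M)"
    using v by (subst integral_mult_right_zero, subst Bochner_Integration.integral_sum) (auto simp: Lp_def)
  also have "(\<Sum>s\<in>S. \<integral>x. norm (v s x) powr p \<partial>?M) = (\<Sum>s\<in>S. Lpnorm \<Omega> p (v s) powr p)"
    using p by (simp add: dint_powr_eq_Lpnorm[unfolded dint_def])
  also have "\<dots> \<le> (\<Sum>s\<in>S. ?N powr p)"
    using p by (intro sum_mono powr_mono2 member_le_sum) (auto simp: S Lpnorm_nonneg)
  also have "\<dots> = ?n * ?N powr p" by simp
  also have "\<dots> \<le> ?n powr p * ?N powr p"
  proof (cases "card S = 0")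
    case False
    then have "?n powr 1 \<le> ?n powr p" using p by (intro powr_mono) auto
    then show ?thesis by (intro mult_right_mono) auto
  qed simp
  finally have "dint \<Omega> (\<lambda>x. norm (u x) powr p) \<le> C powr p * ?n powr p * (?n powr p * ?N powr p)"
    by (simp add: mult_left_mono)
  also have "\<dots> = (C * ?n * (?n * ?N)) powr p"
    by (simp add: powr_mult mult.assoc)
  finally have "Lpnorm \<Omega> p u \<le> ((C * ?n * (?n * ?N)) powr p) powr (1 / p)"
    unfolding Lpnorm_def by (rule powr_mono2[rotated 2]) (use p in \<open>auto simp: dint_def intro!: integral_nonneg_AE\<close>)
  also have "\<dots> = C * ?n * (?n * ?N)" using p C N0 by (simp add: powr_powr)
  finally show "Lpnorm \<Omega> p u \<le> C * ?n\<^sup>2 * ?N" by (simp add: power2_eq_square mult.assoc)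
qed

lemma Lp_measurable: "Lp \<Omega> p u \<Longrightarrow> u \<in> borel_measurable (lebesgue_on \<Omega>)"
  by (simp add: Lp_def)

lemma Lp_le:
  fixes u :: "real^'d \<Rightarrow> 'a::euclidean_space" and v :: "real^'d \<Rightarrow> 'b::euclidean_space"
  assumes "Lp \<Omega> p v" "u \<in> borel_measurable (lebesgue_on \<Omega>)"
    and "AE x in lebesgue_on \<Omega>. norm (u x) \<le> C * norm (v x)" "C \<ge> 0" "p \<ge> 1"
  shows "Lp \<Omega> p u" "Lpnorm \<Omega> p u \<le> C * Lpnorm \<Omega> p v"
  using Lp_dominated[of "{()}" \<Omega> p "\<lambda>_. v" u C] assms by auto

text \<open>The two summands are indexed by \<open>bool\<close>; the factor 4 is the squared
  cardinality from \<open>Lp_dominated\<close>.\<close>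

lemma Lp_lin:
  fixes u v :: "real^'d \<Rightarrow> 'a::euclidean_space"
  assumes "Lp \<Omega> p u" "Lp \<Omega> p v" "p \<ge> 1"
  shows "Lp \<Omega> p (\<lambda>x. a *\<^sub>R u x + b *\<^sub>R v x)"
    and "Lpnorm \<Omega> p (\<lambda>x. a *\<^sub>R u x + b *\<^sub>R v x) \<le> 4 * max \<bar>a\<bar> \<bar>b\<bar> * (Lpnorm \<Omega> p u + Lpnorm \<Omega> p v)"
proof -
  have m: "(\<lambda>x. a *\<^sub>R u x + b *\<^sub>R v x) \<in> borel_measurable (lebesgue_on \<Omega>)"
    using assms by (auto simp: Lp_def)
  have "norm (a *\<^sub>R u x + b *\<^sub>R v x) \<le> max \<bar>a\<bar> \<bar>b\<bar> * (\<Sum>s\<in>UNIV. norm ((if s then u else v) x))" for x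
  proof -
    have "norm (a *\<^sub>R u x + b *\<^sub>R v x) \<le> \<bar>a\<bar> * norm (u x) + \<bar>b\<bar> * norm (v x)"
      using norm_triangle_ineq[of "a *\<^sub>R u x" "b *\<^sub>R v x"] by simp
    also have "\<dots> \<le> max \<bar>a\<bar> \<bar>b\<bar> * norm (u x) + max \<bar>a\<bar> \<bar>b\<bar> * norm (v x)"
      by (intro add_mono mult_right_mono) auto
    finally show ?thesis by (simp add: UNIV_bool algebra_simps)
  qed
  then have le: "AE x in lebesgue_on \<Omega>. norm (a *\<^sub>R u x + b *\<^sub>R v x) \<le> max \<bar>a\<bar> \<bar>b\<bar> * (\<Sum>s\<in>UNIV. norm ((if s then u else v) x))"
    by (rule AE_I2)
  show "Lp \<Omega> p (\<lambda>x. a *\<^sub>R u x + b *\<^sub>R v x)"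
    by (rule Lp_dominated(1)[OF _ _ m le]) (use assms in auto)
  have "Lpnorm \<Omega> p (\<lambda>x. a *\<^sub>R u x + b *\<^sub>R v x) \<le> max \<bar>a\<bar> \<bar>b\<bar> * (real (card (UNIV::bool set)))\<^sup>2 * (\<Sum>s\<in>UNIV. Lpnorm \<Omega> p (if s then u else v))"
    by (rule Lp_dominated(2)[OF _ _ m le]) (use assms in auto)
  then show "Lpnorm \<Omega> p (\<lambda>x. a *\<^sub>R u x + b *\<^sub>R v x) \<le> 4 * max \<bar>a\<bar> \<bar>b\<bar> * (Lpnorm \<Omega> p u + Lpnorm \<Omega> p v)"
    by (simp add: UNIV_bool algebra_simps)
qed

lemma Lp_add:
  fixes u v :: "real^'d \<Rightarrow> 'a::euclidean_space"
  assumes "Lp \<Omega> p u" "Lp \<Omega> p v" "p \<ge> 1"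
  shows "Lp \<Omega> p (\<lambda>x. u x + v x)" "Lpnorm \<Omega> p (\<lambda>x. u x + v x) \<le> 4 * (Lpnorm \<Omega> p u + Lpnorm \<Omega> p v)"
  using Lp_lin[OF assms, of 1 1] by auto

lemma Lp_diff:
  fixes u v :: "real^'d \<Rightarrow> 'a::euclidean_space"
  assumes "Lp \<Omega> p u" "Lp \<Omega> p v" "p \<ge> 1"
  shows "Lp \<Omega> p (\<lambda>x. u x - v x)" "Lpnorm \<Omega> p (\<lambda>x. u x - v x) \<le> 4 * (Lpnorm \<Omega> p u + Lpnorm \<Omega> p v)"
  using Lp_lin[OF assms, of 1 "-1"] by auto

lemma Lp_zero: "Lp \<Omega> p (\<lambda>x. 0)" "Lpnorm \<Omega> p (\<lambda>x. 0) = 0"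
  by (simp_all add: Lp_def Lpnorm_def dint_def)

lemma Lp_sum:
  fixes v :: "'s \<Rightarrow> real^'d \<Rightarrow> 'a::euclidean_space"
  assumes "finite S" "\<And>s. s \<in> S \<Longrightarrow> Lp \<Omega> p (v s)" "p \<ge> 1"
  shows "Lp \<Omega> p (\<lambda>x. \<Sum>s\<in>S. v s x)"
    and "Lpnorm \<Omega> p (\<lambda>x. \<Sum>s\<in>S. v s x) \<le> (real (card S))\<^sup>2 * (\<Sum>s\<in>S. Lpnorm \<Omega> p (v s))"
proof -
  have m: "(\<lambda>x. \<Sum>s\<in>S. v s x) \<in> borel_measurable (lebesgue_on \<Omega>)"
    using assms by (intro borel_measurable_sum) (auto simp: Lp_def)
  have le: "AE x in lebesgue_on \<Omega>. norm (\<Sum>s\<in>S. v s x) \<le> 1 * (\<Sum>s\<in>S. norm (v s x))"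
    by (auto intro!: AE_I2 norm_sum)
  show "Lp \<Omega> p (\<lambda>x. \<Sum>s\<in>S. v s x)"
    by (rule Lp_dominated(1)[OF _ _ m le]) (use assms in auto)
  show "Lpnorm \<Omega> p (\<lambda>x. \<Sum>s\<in>S. v s x) \<le> (real (card S))\<^sup>2 * (\<Sum>s\<in>S. Lpnorm \<Omega> p (v s))"
    using Lp_dominated(2)[OF _ _ m le, of p] assms by auto
qed

lemma norm_vec_le_sum: "norm (x :: 'a::real_normed_vector ^ 'k) \<le> (\<Sum>k\<in>UNIV. norm (x $ k))"
  unfolding norm_vec_def by (rule L2_set_le_sum) auto

lemma Lp_vec:
  fixes u :: "'k::finite \<Rightarrow> real^'d \<Rightarrow> 'a::euclidean_space"
  assumes "\<And>k. Lp \<Omega> p (u k)" "p \<ge> 1"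
  shows "Lp \<Omega> p (\<lambda>x. \<chi> k. u k x)"
    and "Lpnorm \<Omega> p (\<lambda>x. \<chi> k. u k x) \<le> (real CARD('k))\<^sup>2 * (\<Sum>k\<in>UNIV. Lpnorm \<Omega> p (u k))"
proof -
  have [measurable]: "u k \<in> borel_measurable (lebesgue_on \<Omega>)" for k using assms by (simp add: Lp_def)
  have m: "(\<lambda>x. \<chi> k. u k x) \<in> borel_measurable (lebesgue_on \<Omega>)"
  proof (subst borel_measurable_euclidean_space, safe)
    fix b :: "'a ^ 'k" assume "b \<in> Basis"
    then obtain k c where b: "b = axis k c" by (auto simp: Basis_vec_def)
    show "(\<lambda>x. (\<chi> k. u k x) \<bullet> b) \<in> borel_measurable (lebesgue_on \<Omega>)"
      unfolding b inner_axis by simp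
  qed
  have le: "AE x in lebesgue_on \<Omega>. norm (\<chi> k. u k x) \<le> 1 * (\<Sum>k\<in>UNIV. norm (u k x))"
    using norm_vec_le_sum[of "\<chi> k. u k x" for x] by (auto intro!: AE_I2)
  show "Lp \<Omega> p (\<lambda>x. \<chi> k. u k x)"
    by (rule Lp_dominated(1)[OF _ _ m le]) (use assms in auto)
  show "Lpnorm \<Omega> p (\<lambda>x. \<chi> k. u k x) \<le> (real CARD('k))\<^sup>2 * (\<Sum>k\<in>UNIV. Lpnorm \<Omega> p (u k))"
    using Lp_dominated(2)[OF _ _ m le, of p] assms by auto
qed

lemma Lp_nth:
  fixes u :: "real^'d \<Rightarrow> 'a::euclidean_space ^ 'k"
  assumes "Lp \<Omega> p u" "p \<ge> 1"
  shows "Lp \<Omega> p (\<lambda>x. u x $ k)" "Lpnorm \<Omega> p (\<lambda>x. u x $ k) \<le> Lpnorm \<Omega> p u"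
proof -
  have [measurable]: "u \<in> borel_measurable (lebesgue_on \<Omega>)" using assms by (simp add: Lp_def)
  have m: "(\<lambda>x. u x $ k) \<in> borel_measurable (lebesgue_on \<Omega>)"
    by (rule measurable_compose[of u]) (auto intro!: borel_measurable_continuous_onI continuous_intros)
  have le: "AE x in lebesgue_on \<Omega>. norm (u x $ k) \<le> 1 * norm (u x)"
    by (auto intro!: AE_I2 Finite_Cartesian_Product.norm_nth_le)
  show "Lp \<Omega> p (\<lambda>x. u x $ k)" "Lpnorm \<Omega> p (\<lambda>x. u x $ k) \<le> Lpnorm \<Omega> p u"
    using Lp_le[OF assms(1) m le] assms(2) by auto
qed

section \<open>Square integrable functions and products\<close>

lemma Lp2_iff: "Lp \<Omega> 2 u \<longleftrightarrow> u \<in> borel_measurable (lebesgue_on \<Omega>) \<and> integrable (lebesgue_on \<Omega>) (\<lambda>x. (norm (u x))\<^sup>2)"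
  by (simp add: Lp_def)

lemma Lpnorm2_sq: "(Lpnorm \<Omega> 2 u)\<^sup>2 = dint \<Omega> (\<lambda>x. (norm (u x))\<^sup>2)"
  using dint_powr_eq_Lpnorm[of 2 \<Omega> u] by (simp add: Lpnorm_nonneg)

lemma Lpnorm2_eq_0_AE:
  assumes "Lp \<Omega> 2 u" "Lpnorm \<Omega> 2 u = 0"
  shows "AE x in lebesgue_on \<Omega>. u x = 0"
proof -
  have "integral\<^sup>L (lebesgue_on \<Omega>) (\<lambda>x. (norm (u x))\<^sup>2) = 0"
    using Lpnorm2_sq[of \<Omega> u] assms(2) by (simp add: dint_def)
  then show ?thesis
    using assms(1) by (subst (asm) integral_nonneg_eq_0_iff_AE) (auto simp: Lp2_iff)
qed

lemma L2_mult_integrable: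
  fixes u v :: "real^'d \<Rightarrow> real"
  assumes "Lp \<Omega> 2 u" "Lp \<Omega> 2 v"
  shows "integrable (lebesgue_on \<Omega>) (\<lambda>x. u x * v x)"
proof (rule Bochner_Integration.integrable_bound)
  show "integrable (lebesgue_on \<Omega>) (\<lambda>x. (norm (u x))\<^sup>2 + (norm (v x))\<^sup>2)"
    using assms by (auto simp: Lp2_iff)
  show "(\<lambda>x. u x * v x) \<in> borel_measurable (lebesgue_on \<Omega>)" using assms by (auto simp: Lp2_iff)
  have "\<bar>a * b\<bar> \<le> a\<^sup>2 + b\<^sup>2" for a b :: real
  proof -
    have "0 \<le> \<bar>a * b\<bar>" "2 * \<bar>a * b\<bar> \<le> a\<^sup>2 + b\<^sup>2"
      using sum_squares_bound[of "\<bar>a\<bar>" "\<bar>b\<bar>"] by (simp_all add: abs_mult)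
    then show ?thesis by linarith
  qed
  then show "AE x in lebesgue_on \<Omega>. norm (u x * v x) \<le> norm ((norm (u x))\<^sup>2 + (norm (v x))\<^sup>2)"
    by (auto intro!: AE_I2)
qed

lemma L2_inner_integrable:
  fixes u v :: "real^'d \<Rightarrow> 'a::euclidean_space"
  assumes u: "Lp \<Omega> 2 u" and v: "Lp \<Omega> 2 v"
  shows "integrable (lebesgue_on \<Omega>) (\<lambda>x. u x \<bullet> v x)"
proof (rule Bochner_Integration.integrable_bound)
  show "integrable (lebesgue_on \<Omega>) (\<lambda>x. norm (u x) * norm (v x))"
    using u v by (intro L2_mult_integrable) (auto simp: Lp2_iff)
  show "(\<lambda>x. u x \<bullet> v x) \<in> borel_measurable (lebesgue_on \<Omega>)" using u v by (auto simp: Lp2_iff)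
  show "AE x in lebesgue_on \<Omega>. norm (u x \<bullet> v x) \<le> norm (norm (u x) * norm (v x))"
    using Cauchy_Schwarz_ineq2 by (auto intro!: AE_I2)
qed

text \<open>Young's inequality with weights b/(2a) and a/(2b), where a and b are the two norms, so
  that both halves integrate to ab/2. If a norm vanishes, the function is zero almost everywhere and
  so is the product.\<close>

lemma L2_Cauchy_Schwarz:
  fixes u v :: "real^'d \<Rightarrow> 'a::euclidean_space"
  assumes u: "Lp \<Omega> 2 u" and v: "Lp \<Omega> 2 v"
  shows "dint \<Omega> (\<lambda>x. norm (u x) * norm (v x)) \<le> Lpnorm \<Omega> 2 u * Lpnorm \<Omega> 2 v"
    and "\<bar>dint \<Omega> (\<lambda>x. u x \<bullet> v x)\<bar> \<le> Lpnorm \<Omega> 2 u * Lpnorm \<Omega> 2 v"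
proof -
  let ?M = "lebesgue_on \<Omega>" and ?a = "Lpnorm \<Omega> 2 u" and ?b = "Lpnorm \<Omega> 2 v"
  have i: "integrable ?M (\<lambda>x. norm (u x) * norm (v x))"
    using u v by (intro L2_mult_integrable) (auto simp: Lp2_iff)
  show 1: "dint \<Omega> (\<lambda>x. norm (u x) * norm (v x)) \<le> ?a * ?b"
  proof (cases "?a = 0 \<or> ?b = 0")
    case True
    then have "AE x in ?M. norm (u x) * norm (v x) = 0"
      using Lpnorm2_eq_0_AE[OF u] Lpnorm2_eq_0_AE[OF v] by (auto elim: AE_mp)
    then have "dint \<Omega> (\<lambda>x. norm (u x) * norm (v x)) = 0"
      unfolding dint_def by (rule integral_eq_zero_AE)
    then show ?thesis by (simp add: Lpnorm_nonneg)
  next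
    case False
    then have pos: "?a > 0" "?b > 0" using Lpnorm_nonneg[of \<Omega> 2 u] Lpnorm_nonneg[of \<Omega> 2 v] by linarith+
    let ?f = "\<lambda>x. (?b / (2 * ?a)) * (norm (u x))\<^sup>2 + (?a / (2 * ?b)) * (norm (v x))\<^sup>2"
    have le: "norm (u x) * norm (v x) \<le> ?f x" for x
    proof -
      have "0 \<le> (?b * norm (u x) - ?a * norm (v x))\<^sup>2" by simp
      then show ?thesis using pos by (simp add: field_simps power2_eq_square)
    qed
    have "dint \<Omega> (\<lambda>x. norm (u x) * norm (v x)) \<le> integral\<^sup>L ?M ?f"
      unfolding dint_def using u v
      by (intro integral_mono i le Bochner_Integration.integrable_add integrable_mult_right) (auto simp: Lp2_iff)
    also have "\<dots> = (?b / (2 * ?a)) * ?a\<^sup>2 + (?a / (2 * ?b)) * ?b\<^sup>2"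
      using u v unfolding Lpnorm2_sq dint_def
      by (subst Bochner_Integration.integral_add) (auto simp: Lp2_iff)
    also have "\<dots> = ?a * ?b" using pos by (simp add: field_simps power2_eq_square)
    finally show ?thesis .
  qed
  have "\<bar>dint \<Omega> (\<lambda>x. u x \<bullet> v x)\<bar> \<le> integral\<^sup>L ?M (\<lambda>x. \<bar>u x \<bullet> v x\<bar>)"
    unfolding dint_def by (rule integral_abs_bound)
  also have "\<dots> \<le> dint \<Omega> (\<lambda>x. norm (u x) * norm (v x))"
    unfolding dint_def using L2_inner_integrable[OF u v]
    by (intro integral_mono i Cauchy_Schwarz_ineq2) auto
  finally show "\<bar>dint \<Omega> (\<lambda>x. u x \<bullet> v x)\<bar> \<le> ?a * ?b" using 1 by linarith
qed

lemma L2_Cauchy_Schwarz_real: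
  fixes u v :: "real^'d \<Rightarrow> real"
  assumes u: "Lp \<Omega> 2 u" and v: "Lp \<Omega> 2 v"
  shows "\<bar>dint \<Omega> (\<lambda>x. u x * v x)\<bar> \<le> Lpnorm \<Omega> 2 u * Lpnorm \<Omega> 2 v"
  using L2_Cauchy_Schwarz(2)[OF u v] by simp

lemma L4_mult_L2:
  fixes u :: "real^'d \<Rightarrow> 'a::euclidean_space" and v :: "real^'d \<Rightarrow> 'b::euclidean_space"
  assumes u: "Lp \<Omega> 4 u" and v: "Lp \<Omega> 4 v"
  shows "Lp \<Omega> 2 (\<lambda>x. norm (u x) * norm (v x))"
proof -
  have int: "integrable (lebesgue_on \<Omega>) (\<lambda>x. norm (u x) ^ 4 + norm (v x) ^ 4)"
    using assms by (auto simp: Lp_def)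
  have m: "(\<lambda>x. norm (u x) * norm (v x)) \<in> borel_measurable (lebesgue_on \<Omega>)" using assms by (auto simp: Lp_def)
  have "(a * b)\<^sup>2 \<le> a ^ 4 + b ^ 4" for a b :: real
  proof -
    have "2 * a\<^sup>2 * b\<^sup>2 \<le> (a\<^sup>2)\<^sup>2 + (b\<^sup>2)\<^sup>2" by (rule sum_squares_bound)
    moreover have "(0::real) \<le> a\<^sup>2 * b\<^sup>2" by simp
    moreover have "(a\<^sup>2)\<^sup>2 = a ^ 4" "(b\<^sup>2)\<^sup>2 = b ^ 4" by (simp_all flip: power_mult)
    ultimately show ?thesis unfolding power_mult_distrib by linarith
  qed
  then have "AE x in lebesgue_on \<Omega>. norm ((norm (norm (u x) * norm (v x)))\<^sup>2) \<le> norm (norm (u x) ^ 4 + norm (v x) ^ 4)"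
    by (auto intro!: AE_I2)
  then have "integrable (lebesgue_on \<Omega>) (\<lambda>x. (norm (norm (u x) * norm (v x)))\<^sup>2)"
    by (rule Bochner_Integration.integrable_bound[OF int, rotated]) (use m in measurable)
  then show ?thesis using m by (simp add: Lp2_iff)
qed

lemma Lp4_imp_Lp2:
  fixes u :: "real^'d \<Rightarrow> 'a::euclidean_space"
  assumes "\<Omega> \<in> lmeasurable" and u: "Lp \<Omega> 4 u"
  shows "Lp \<Omega> 2 u"
proof -
  interpret finite_measure "lebesgue_on \<Omega>" by (rule finite_measure_lebesgue_on[OF assms(1)])
  have "Lp \<Omega> 4 (\<lambda>x. 1::real)" by (simp add: Lp_def)
  from L4_mult_L2[OF u this] show ?thesis using u by (simp add: Lp_def)
qed

section \<open>Test functions\<close>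

lemma test_fun_smooth: "test_fun \<Omega> f \<Longrightarrow> smooth_fun f"
  by (simp add: test_fun_def)

lemma test_fun_zero_outside: "test_fun \<Omega> f \<Longrightarrow> x \<notin> \<Omega> \<Longrightarrow> f x = 0"
  unfolding test_fun_def using closure_subset[of "{x. f x \<noteq> 0}"] by blast

lemma test_funI:
  assumes "smooth_fun f" "compact K" "K \<subseteq> \<Omega>" "\<And>x. x \<notin> K \<Longrightarrow> f x = 0"
  shows "test_fun \<Omega> f"
proof -
  have "closure {x. f x \<noteq> 0} \<subseteq> K"
    by (rule closure_minimal) (use assms(4) compact_imp_closed[OF assms(2)] in blast)+
  moreover have "bounded {x. f x \<noteq> 0}"
    by (rule bounded_subset[OF compact_imp_bounded[OF assms(2)]]) (use assms(4) in auto)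
  ultimately show ?thesis using assms(1,3) unfolding test_fun_def compact_closure by blast
qed

lemma test_funE:
  assumes "test_fun \<Omega> f"
  obtains K where "compact K" "K \<subseteq> \<Omega>" "\<And>x. x \<notin> K \<Longrightarrow> f x = 0"
proof (rule that)
  show "compact (closure {x. f x \<noteq> 0})" "closure {x. f x \<noteq> 0} \<subseteq> \<Omega>"
    using assms by (simp_all add: test_fun_def)
  show "f x = 0" if "x \<notin> closure {x. f x \<noteq> 0}" for x
    using that closure_subset[of "{x. f x \<noteq> 0}"] by blast
qed

lemma test_fun_cpartial:
  assumes f: "test_fun \<Omega> f"
  shows "test_fun \<Omega> (cpartial i f)"
proof -
  obtain K where K: "compact K" "K \<subseteq> \<Omega>" "\<And>x. x \<notin> K \<Longrightarrow> f x = 0" using test_funE[OF f] by blast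
  have "cpartial i f x = 0" if "x \<notin> K" for x
  proof -
    have "((\<lambda>_. 0) has_derivative (\<lambda>_. 0)) (at x)" by simp
    then have "(f has_derivative (\<lambda>_. 0)) (at x)"
      by (rule has_derivative_transform_within_open[of _ _ _ _ "- K"])
        (use that K compact_imp_closed in \<open>auto simp: closed_def\<close>)
    then show ?thesis by (simp add: cpartial_eqI)
  qed
  then show ?thesis
    using test_funI[OF smooth_fun_cpartial[OF test_fun_smooth[OF f]] K(1,2)] by blast
qed

lemma test_fun_cpartials: "test_fun \<Omega> f \<Longrightarrow> test_fun \<Omega> (cpartials is f)"
  by (induction "is") (auto intro: test_fun_cpartial)

lemma test_fun_cderiv: "test_fun \<Omega> f \<Longrightarrow> test_fun \<Omega> (cderiv \<alpha> f)"
  by (simp add: cderiv_def test_fun_cpartials)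

lemma test_fun_mult:
  assumes "test_fun \<Omega> f" "smooth_fun g"
  shows "test_fun \<Omega> (\<lambda>x. f x * g x)"
proof -
  obtain K where K: "compact K" "K \<subseteq> \<Omega>" "\<And>x. x \<notin> K \<Longrightarrow> f x = 0" using test_funE[OF assms(1)] by blast
  show ?thesis
    by (rule test_funI[OF _ K(1,2)]) (use assms K in \<open>auto simp: test_fun_def intro: smooth_fun_mult\<close>)
qed

lemma test_fun_bounded:
  assumes "test_fun \<Omega> f"
  obtains B where "\<And>x. \<bar>f x\<bar> \<le> B" "B \<ge> 0"
proof -
  obtain K where K: "compact K" "K \<subseteq> \<Omega>" "\<And>x. x \<notin> K \<Longrightarrow> f x = 0" using test_funE[OF assms] by blast
  have "compact (f ` K)"
    by (intro compact_continuous_image smooth_fun_continuous K test_fun_smooth[OF assms])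
  then obtain B where B: "\<And>y. y \<in> f ` K \<Longrightarrow> norm y \<le> B" using compact_imp_bounded bounded_iff by metis
  have "\<bar>f x\<bar> \<le> max B 0" for x using B[of "f x"] K(3)[of x] by (cases "x \<in> K") auto
  then show ?thesis using that[of "max B 0"] by auto
qed

lemma smooth_fun_measurable: "smooth_fun f \<Longrightarrow> f \<in> borel_measurable borel"
  using smooth_fun_continuous[of f UNIV] by (rule borel_measurable_continuous_onI)

lemma test_fun_integrable:
  assumes "test_fun \<Omega> f"
  shows "integrable lborel f"
proof -
  obtain K where K: "compact K" "K \<subseteq> \<Omega>" "\<And>x. x \<notin> K \<Longrightarrow> f x = 0" using test_funE[OF assms] by blast
  have "integrable lborel (\<lambda>x. indicator K x *\<^sub>R f x)"
    by (intro borel_integrable_compact K smooth_fun_continuous test_fun_smooth[OF assms])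
  also have "(\<lambda>x. indicator K x *\<^sub>R f x) = f" using K(3) by (intro ext) (auto simp: indicator_def)
  finally show ?thesis .
qed

text \<open>The integral of a difference quotient of \<open>f\<close> vanishes by translation invariance; pass to the limit.\<close>
lemma integral_cpartial_eq_0:
  assumes f: "test_fun \<Omega> f"
  shows "integral\<^sup>L lborel (cpartial i f) = 0"
proof -
  define h where "h n = 1 / real (Suc n)" for n
  have h: "0 < h n" "h n \<le> 1" for n by (auto simp: h_def)
  have h0: "h \<longlonglongrightarrow> 0"
    using LIMSEQ_inverse_real_of_nat unfolding h_def by (simp add: inverse_eq_divide)
  define q where "q n x = (f (x + h n *\<^sub>R axis i 1) - f x) / h n" for n x
  note sm = test_fun_smooth[OF f]
  note [measurable] = smooth_fun_measurable[OF sm] smooth_fun_measurable[OF smooth_fun_cpartial[OF sm]]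
  obtain K where K: "compact K" "K \<subseteq> \<Omega>" "\<And>x. x \<notin> K \<Longrightarrow> f x = 0" using test_funE[OF f] by blast
  obtain R where R: "\<And>x. x \<in> K \<Longrightarrow> norm x \<le> R" using K(1) compact_imp_bounded bounded_iff by metis
  obtain B where B: "\<And>x. \<bar>cpartial i f x\<bar> \<le> B" "B \<ge> 0" using test_fun_bounded[OF test_fun_cpartial[OF f]] by blast
  have mv: "\<exists>z. q n x = cpartial i f z" for n x
  proof -
    have "((\<lambda>t. f (x + t *\<^sub>R axis i 1)) has_real_derivative cpartial i f (x + t *\<^sub>R axis i 1)) (at t)" for t
      by (rule cpartial_line[OF smooth_fun_differentiable[OF sm]])
    from MVT2[OF h(1)[of n] this] obtain z where
      "f (x + h n *\<^sub>R axis i 1) - f (x + 0 *\<^sub>R axis i 1) = (h n - 0) * cpartial i f (x + z *\<^sub>R axis i 1)"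
      by blast
    then show ?thesis using h(1)[of n] by (auto simp: q_def field_simps)
  qed
  \<comment> \<open>Shifts are at most 1, so outside the ball of radius R + 1 both points of the
    quotient avoid K; inside, the mean value theorem bounds the quotient by B.\<close>
  have bound: "norm (q n x) \<le> B * indicator (cball 0 (R + 1)) x" for n x
  proof (cases "x \<in> cball 0 (R + 1)")
    case False
    have "norm x \<le> norm (x + h n *\<^sub>R axis i 1) + norm (h n *\<^sub>R axis i (1::real))"
      using norm_triangle_ineq4[of "x + h n *\<^sub>R axis i 1" "h n *\<^sub>R axis i (1::real)"] by simp
    also have "norm (h n *\<^sub>R axis i (1::real)) \<le> 1" using h[of n] by (simp add: norm_axis_1)
    finally have "norm (x + h n *\<^sub>R axis i 1) > R" "norm x > R" using False by (auto simp: dist_norm)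
    then have "x \<notin> K" "x + h n *\<^sub>R axis i 1 \<notin> K" using R by (auto simp: not_le[symmetric])
    then show ?thesis using False by (simp add: q_def K(3))
  qed (use mv[of n x] B in auto)
  have "(\<lambda>n. integral\<^sup>L lborel (q n)) \<longlonglongrightarrow> integral\<^sup>L lborel (cpartial i f)"
  proof (rule integral_dominated_convergence[where w="\<lambda>x. B * indicator (cball 0 (R + 1)) x"])
    show "integrable lborel (\<lambda>x::real^'a. B * indicator (cball 0 (R + 1)) x)"
      using emeasure_bounded_finite[OF bounded_cball, of "0::real^'a" "R + 1"]
      by (intro integrable_mult_right integrable_real_indicator) (auto simp: less_top)
    show "AE x in lborel. (\<lambda>n. q n x) \<longlonglongrightarrow> cpartial i f x"
    proof (rule AE_I2)
      fix x
      have "((\<lambda>t. f (x + t *\<^sub>R axis i 1)) has_real_derivative cpartial i f x) (at 0)"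
        by (rule cpartial_frechet(2)[OF smooth_fun_differentiable[OF sm]])
      then have *: "((\<lambda>t. (f (x + t *\<^sub>R axis i 1) - f x) / t) \<longlongrightarrow> cpartial i f x) (at 0)"
        by (simp add: DERIV_def)
      show "(\<lambda>n. q n x) \<longlonglongrightarrow> cpartial i f x"
        unfolding q_def
        by (rule filterlim_compose[OF *]) (use h h0 in \<open>auto simp: filterlim_at intro!: always_eventually less_imp_neq[symmetric]\<close>)
    qed
      show "q n \<in> borel_measurable lborel" for n unfolding q_def by measurable
    show "AE x in lborel. norm (q n x) \<le> B * indicator (cball 0 (R + 1)) x" for n
      using bound by (rule AE_I2)
  qed auto
  moreover have "integral\<^sup>L lborel (q n) = 0" for n
  proof -
    have int: "integrable lborel f" by (rule test_fun_integrable[OF f])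
    have eq: "integral\<^sup>L lborel f = integral\<^sup>L lborel (\<lambda>x. f (h n *\<^sub>R axis i 1 + x))"
      by (subst lborel_distr_plus[of "h n *\<^sub>R axis i 1", symmetric], subst integral_distr) auto
    have "integrable (distr lborel borel ((+) (h n *\<^sub>R axis i 1))) f" using int by (simp add: lborel_distr_plus)
    then have int2: "integrable lborel (\<lambda>x. f (h n *\<^sub>R axis i 1 + x))"
      by (subst (asm) integrable_distr_eq) auto
    have "q n = (\<lambda>x. (f (h n *\<^sub>R axis i 1 + x) - f x) / h n)" by (intro ext) (simp add: q_def add.commute)
    then show ?thesis using eq int int2 by simp
  qed
  ultimately show ?thesis by (simp add: LIMSEQ_const_iff)
qed

section \<open>Smooth bumps on boxes and the fundamental lemma\<close>

definition box_bump :: "real^'d::finite \<Rightarrow> real^'d \<Rightarrow> nat \<Rightarrow> real^'d \<Rightarrow> real" where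
  "box_bump a b n x = (\<Prod>i\<in>UNIV. flat_exp 0 (real n * x $ i + (- (real n * a $ i))) *
     flat_exp 0 ((- real n) * x $ i + real n * b $ i))"

lemma flat_exp_0_bounds: "0 \<le> flat_exp 0 t" "flat_exp 0 t \<le> 1"
  by (auto simp: flat_exp_def)

lemma box_bump_test:
  assumes "cbox a b \<subseteq> \<Omega>"
  shows "test_fun \<Omega> (box_bump a b n)"
proof (rule test_funI[of _ "cbox a b"])
  show "smooth_fun (box_bump a b n)"
    unfolding box_bump_def by (rule smooth_fun_prod[OF finite], rule smooth_fun_mult[OF smooth_fun_flat smooth_fun_flat])
  show "box_bump a b n x = 0" if "x \<notin> cbox a b" for x
  proof -
    from that obtain i where "x $ i < a $ i \<or> x $ i > b $ i" by (auto simp: mem_box_cart not_le)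
    then have "flat_exp 0 (real n * x $ i + (- (real n * a $ i))) * flat_exp 0 ((- real n) * x $ i + real n * b $ i) = 0"
    proof
      assume "x $ i < a $ i"
      then have "real n * x $ i \<le> real n * a $ i" by (intro mult_left_mono) auto
      then show ?thesis by (simp add: flat_exp_def)
    next
      assume "x $ i > b $ i"
      then have "real n * b $ i \<le> real n * x $ i" by (intro mult_left_mono) auto
      then show ?thesis by (simp add: flat_exp_def)
    qed
    then show ?thesis unfolding box_bump_def by (intro prod_zero) auto
  qed
qed (use assms in auto)

lemma box_bump_le: "\<bar>box_bump a b n x\<bar> \<le> 1"
proof -
  have "0 \<le> box_bump a b n x" "box_bump a b n x \<le> 1"
    unfolding box_bump_def
    by (rule prod_nonneg; simp add: flat_exp_0_bounds) (rule prod_le_1; simp add: flat_exp_0_bounds mult_le_one)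
  then show ?thesis by simp
qed

text \<open>For t > 0 the value is exp(-1/(n t)), which tends to 1. Multiplying the distances to the
  faces of a box by n therefore turns the bump into the indicator of the open box, while its support
  stays inside the closed one.\<close>

lemma flat_exp_scaled_lim: "(\<lambda>n. flat_exp 0 (real n * t)) \<longlonglongrightarrow> (if t > 0 then 1 else 0)"
proof (cases "t > 0")
  case True
  have "(\<lambda>n. exp (- (1 / t) * (1 / real n))) \<longlonglongrightarrow> exp (- (1 / t) * 0)"
    by (intro tendsto_intros lim_1_over_n)
  then have "(\<lambda>n. exp (- (1 / t) * (1 / real n))) \<longlonglongrightarrow> 1" by simp
  moreover have "\<forall>\<^sub>F n in sequentially. exp (- (1 / t) * (1 / real n)) = flat_exp 0 (real n * t)"
    using eventually_gt_at_top[of 0] by eventually_elim (use True in \<open>auto simp: flat_exp_def\<close>)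
  ultimately have "(\<lambda>n. flat_exp 0 (real n * t)) \<longlonglongrightarrow> 1" by (rule Lim_transform_eventually)
  then show ?thesis using True by simp
next
  case False
  then have "flat_exp 0 (real n * t) = 0" for n
    by (simp add: flat_exp_def not_less mult_nonneg_nonpos)
  then show ?thesis using False by simp
qed

lemma box_bump_lim: "(\<lambda>n. box_bump a b n x) \<longlonglongrightarrow> indicator (box a b) x"
proof -
  have eq: "indicator (box a b) x = (\<Prod>i\<in>UNIV. (if x $ i - a $ i > 0 then 1 else 0) * (if b $ i - x $ i > 0 then 1 else (0::real)))"
  proof (cases "x \<in> box a b")
    case True
    then show ?thesis by (auto simp: mem_box_cart)
  next
    case False
    then obtain i where "\<not> (a $ i < x $ i \<and> x $ i < b $ i)" by (auto simp: mem_box_cart)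
    then show ?thesis using False by (intro trans[OF _ prod_zero[symmetric]]) auto
  qed
  have "(\<lambda>n. \<Prod>i\<in>UNIV. flat_exp 0 (real n * (x $ i - a $ i)) * flat_exp 0 (real n * (b $ i - x $ i)))
    \<longlonglongrightarrow> (\<Prod>i\<in>UNIV. (if x $ i - a $ i > 0 then 1 else 0) * (if b $ i - x $ i > 0 then 1 else (0::real)))"
    by (intro tendsto_prod tendsto_mult flat_exp_scaled_lim)
  then show ?thesis unfolding eq box_bump_def by (simp add: algebra_simps)
qed

text \<open>Bumps show that h integrates to zero over boxes in \<Omega>. Boxes form an
  intersection-stable generator, so the same holds for the trace of every Borel set on a fixed box,
  in particular for the sets where h > 0 and where h < 0. Countably many closed boxes exhaust
  \<Omega>.\<close>

lemma fundamental_lemma_lborel: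
  fixes h :: "real^'d::finite \<Rightarrow> real"
  assumes \<Omega>: "open \<Omega>" and int: "integrable lborel h"
    and zero: "\<And>\<phi>. test_fun \<Omega> \<phi> \<Longrightarrow> integral\<^sup>L lborel (\<lambda>x. h x * \<phi> x) = 0"
  shows "AE x in lborel. x \<in> \<Omega> \<longrightarrow> h x = 0"
proof -
  have [measurable]: "h \<in> borel_measurable borel" using int by auto
  have box0: "integral\<^sup>L lborel (\<lambda>x. h x * indicator (box a b) x) = 0" if "cbox a b \<subseteq> \<Omega>" for a b
  proof -
    have "(\<lambda>n. integral\<^sup>L lborel (\<lambda>x. h x * box_bump a b n x)) \<longlonglongrightarrow> integral\<^sup>L lborel (\<lambda>x. h x * indicator (box a b) x)"
    proof (rule integral_dominated_convergence[where w="\<lambda>x. norm (h x)"])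
      show "(\<lambda>x. h x * box_bump a b n x) \<in> borel_measurable lborel" for n
        using smooth_fun_measurable[OF test_fun_smooth[OF box_bump_test[OF that]]] by measurable
      show "AE x in lborel. norm (h x * box_bump a b n x) \<le> norm (h x)" for n
        using box_bump_le[of a b n] by (auto simp: abs_mult intro!: AE_I2 mult_left_le)
      show "AE x in lborel. (\<lambda>n. h x * box_bump a b n x) \<longlonglongrightarrow> h x * indicator (box a b) x"
        by (auto intro!: AE_I2 tendsto_intros box_bump_lim)
    qed (use int in auto)
    then show ?thesis by (simp add: zero[OF box_bump_test[OF that]] LIMSEQ_const_iff)
  qed
  have inbox: "AE x in lborel. x \<in> box c d \<longrightarrow> h x = 0" if cd: "cbox c d \<subseteq> \<Omega>" for c d
  proof -
    let ?P = "\<lambda>S. integral\<^sup>L lborel (\<lambda>x. h x * indicator (S \<inter> box c d) x) = 0"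
    have P: "?P S" if "S \<in> sets borel" for S
    proof -
      have "Int_stable (range (\<lambda>(a, b). box a b::(real^'d) set))"
        "range (\<lambda>(a, b). box a b::(real^'d) set) \<subseteq> Pow UNIV"
        "S \<in> sigma_sets UNIV (range (\<lambda>(a, b). box a b::(real^'d) set))"
        using that by (auto simp: borel_eq_box Int_stable_def box_Int_box)
      then show ?thesis
      proof (induction S rule: sigma_sets_induct_disjoint)
        case (basic A)
        then obtain a b where A: "A = box a b" by auto
        \<comment> \<open>A generating box may leave \<Omega>, but its intersection with the fixed
          box is a box whose closure does not.\<close>
        obtain a' b' where I: "box a b \<inter> box c d = box a' b'" by (auto simp: box_Int_box)
        show ?case
        proof (cases "box a' b' = {}")
          case False
          then have "cbox a' b' = closure (box a' b')" by (simp add: closure_box)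
          also have "\<dots> \<subseteq> closure (box c d)" using I by (intro closure_mono) auto
          also have "\<dots> \<subseteq> cbox c d" by (rule closure_minimal[OF box_subset_cbox closed_cbox])
          finally show ?thesis unfolding A I using cd by (intro box0) auto
        qed (simp add: A I)
      next
        case empty show ?case by simp
      next
        case (compl A)
        then have [measurable]: "A \<in> sets borel" by (simp add: borel_eq_box)
        have "integral\<^sup>L lborel (\<lambda>x. h x * indicator ((UNIV - A) \<inter> box c d) x)
          = integral\<^sup>L lborel (\<lambda>x. h x * indicator (box c d) x - h x * indicator (A \<inter> box c d) x)"
          by (rule Bochner_Integration.integral_cong) (auto simp: indicator_def)
        also have "\<dots> = integral\<^sup>L lborel (\<lambda>x. h x * indicator (box c d) x) - integral\<^sup>L lborel (\<lambda>x. h x * indicator (A \<inter> box c d) x)"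
          by (intro Bochner_Integration.integral_diff integrable_real_mult_indicator int) auto
        finally show ?case using compl box0[OF cd] by simp
      next
        case (union A)
        then have [measurable]: "A i \<in> sets borel" for i by (auto simp: borel_eq_box)
        have "integral\<^sup>L lborel (\<lambda>x. h x * indicator ((\<Union>i. A i) \<inter> box c d) x)
          = (LINT x:(\<Union>i. A i \<inter> box c d)|lborel. h x)"
          unfolding set_lebesgue_integral_def
          by (rule Bochner_Integration.integral_cong) (auto simp: indicator_def)
        also have "\<dots> = (\<Sum>i. LINT x:(A i \<inter> box c d)|lborel. h x)"
        proof (rule lebesgue_integral_countable_add)
          show "A i \<inter> box c d \<inter> (A j \<inter> box c d) = {}" if "i \<noteq> j" for i j
            using union(1) that by (auto simp: disjoint_family_on_def)
          show "set_integrable lborel (\<Union>i. A i \<inter> box c d) h"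
            unfolding set_integrable_def using int
            by (intro integrable_mult_indicator) auto
        qed auto
        also have "\<dots> = 0" using union(3)
          by (simp add: set_lebesgue_integral_def mult.commute)
        finally show ?case .
      qed
    qed
    have nonneg: "AE x in lborel. x \<in> box c d \<longrightarrow> \<not> g x > 0" if "g = h \<or> g = (\<lambda>x. - h x)" for g
    proof -
      have [measurable]: "g \<in> borel_measurable borel" using that by auto
      let ?S = "{x. g x > 0}"
      have "integrable lborel (\<lambda>x. h x * indicator (?S \<inter> box c d) x)"
        using int by (intro integrable_real_mult_indicator) auto
      then have i: "integrable lborel (\<lambda>x. g x * indicator (?S \<inter> box c d) x)" using that by auto
      have "integral\<^sup>L lborel (\<lambda>x. g x * indicator (?S \<inter> box c d) x) = 0"
        using P[of ?S] that by auto
      then have "AE x in lborel. g x * indicator (?S \<inter> box c d) x = 0"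
        using i by (subst (asm) integral_nonneg_eq_0_iff_AE) (auto simp: indicator_def)
      then show ?thesis by eventually_elim (auto simp: indicator_def)
    qed
    show ?thesis using nonneg[of h] nonneg[of "\<lambda>x. - h x"] by (auto elim!: AE_mp)
  qed
  obtain D where D: "countable D" "D \<subseteq> Pow \<Omega>" "\<And>X. X \<in> D \<Longrightarrow> \<exists>a b. X = cbox a b" "\<Union>D = \<Omega>"
    using open_countable_Union_open_cbox[OF \<Omega>] by metis
  have "AE x in lborel. x \<in> X \<longrightarrow> h x = 0" if X: "X \<in> D" for X
  proof -
    obtain a b where ab: "X = cbox a b" using D(3)[OF X] by blast
    then have 1: "AE x in lborel. x \<in> box a b \<longrightarrow> h x = 0" using inbox D(2) X by auto
    \<comment> \<open>The argument on boxes reaches open boxes only; their faces are a null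
      set.\<close>
    have "cbox a b - box a b \<in> null_sets lborel"
      using null_sets_def[of lborel] negligible_frontier_interval[of a b]
      by (simp add: negligible_iff_null_sets null_sets_completion_iff)
    then have 2: "AE x in lborel. x \<notin> cbox a b - box a b" by (rule AE_not_in)
    show ?thesis using 1 2 by eventually_elim (auto simp: ab)
  qed
  then have "AE x in lborel. \<forall>X\<in>D. x \<in> X \<longrightarrow> h x = 0" by (subst AE_ball_countable[OF D(1)]) blast
  then show ?thesis by eventually_elim (use D(4) in auto)
qed

section \<open>Weak derivatives\<close>

lemma mi_ord_unit: "mi_ord (mi_unit i :: 'd::finite \<Rightarrow> nat) = 1"
  by (simp add: mi_ord_def mi_unit_def)

lemma mi_ord_add: "mi_ord (\<lambda>l. \<alpha> l + \<beta> l) = mi_ord \<alpha> + mi_ord \<beta>"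
  by (simp add: mi_ord_def sum.distrib)

lemma mi_ord_zero: "mi_ord (\<lambda>_. 0) = 0"
  by (simp add: mi_ord_def)

lemma finite_mi_ord_le: "finite {\<alpha> :: 'd::finite \<Rightarrow> nat. mi_ord \<alpha> \<le> m}"
proof (rule finite_subset)
  have "\<alpha> i \<le> m" if "mi_ord \<alpha> \<le> m" for \<alpha> :: "'d \<Rightarrow> nat" and i
    using that member_le_sum[of i UNIV \<alpha>] by (simp add: mi_ord_def)
  then show "{\<alpha> :: 'd \<Rightarrow> nat. mi_ord \<alpha> \<le> m} \<subseteq> Pi\<^sub>E UNIV (\<lambda>_. {..m})" by auto
qed (auto intro: finite_PiE)

lemma Lpnorm_wd_le_Hnorm:
  assumes "mi_ord \<alpha> \<le> m"
  shows "Lpnorm \<Omega> 2 (wd \<Omega> \<alpha> u) \<le> Hnorm \<Omega> m u"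
proof -
  have "(Lpnorm \<Omega> 2 (wd \<Omega> \<alpha> u))\<^sup>2 \<le> (\<Sum>\<alpha>\<in>{\<alpha>. mi_ord \<alpha> \<le> m}. (Lpnorm \<Omega> 2 (wd \<Omega> \<alpha> u))\<^sup>2)"
    by (rule member_le_sum) (use assms finite_mi_ord_le in auto)
  then show ?thesis unfolding Hnorm_def by (rule real_le_rsqrt)
qed

lemma Hnorm_nonneg: "0 \<le> Hnorm \<Omega> m u"
  unfolding Hnorm_def by (simp add: sum_nonneg)

locale bounded_open_set =
  fixes \<Omega> :: "(real^'d::finite) set"
  assumes open_\<Omega>: "open \<Omega>" and bounded_\<Omega>: "bounded \<Omega>"
begin

abbreviation M where "M \<equiv> lebesgue_on \<Omega>"

lemma \<Omega>_lmeasurable: "\<Omega> \<in> lmeasurable"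
  using open_\<Omega> bounded_\<Omega> by (rule lmeasurable_open[rotated])

lemma \<Omega>_lebesgue: "\<Omega> \<in> sets lebesgue"
  using \<Omega>_lmeasurable by (rule fmeasurableD)

lemma Lp_const: "Lp \<Omega> p (\<lambda>x. c)"
proof -
  interpret finite_measure M by (rule finite_measure_lebesgue_on[OF \<Omega>_lmeasurable])
  show ?thesis by (simp add: Lp_def)
qed

lemma Lp_bounded:
  fixes u :: "real^'d \<Rightarrow> 'a::euclidean_space"
  assumes "u \<in> borel_measurable M" "\<And>x. norm (u x) \<le> B" "p \<ge> 1"
  shows "Lp \<Omega> p u"
proof (rule Lp_le(1)[OF Lp_const[of p "1::real"] assms(1)])
  show "AE x in M. norm (u x) \<le> max B 0 * norm (1::real)"
    using assms(2) by (auto intro!: AE_I2 simp: le_max_iff_disj)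
qed (use assms in auto)

lemma smooth_fun_measurable_M: "smooth_fun f \<Longrightarrow> f \<in> borel_measurable M"
  using smooth_fun_continuous \<Omega>_lebesgue by (rule continuous_imp_measurable_on_sets_lebesgue)

lemma test_fun_Lp:
  assumes "test_fun \<Omega> f" "p \<ge> 1"
  shows "Lp \<Omega> p f"
proof -
  obtain B where "\<And>x. \<bar>f x\<bar> \<le> B" using test_fun_bounded[OF assms(1)] by blast
  then show ?thesis
    using Lp_bounded[of f B p] smooth_fun_measurable_M[OF test_fun_smooth[OF assms(1)]] assms(2) by auto
qed

lemma test_fun_cderiv_Lp: "test_fun \<Omega> f \<Longrightarrow> p \<ge> 1 \<Longrightarrow> Lp \<Omega> p (cderiv \<alpha> f)"
  by (rule test_fun_Lp[OF test_fun_cderiv])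

lemma dint_test:
  assumes "\<And>x. x \<notin> \<Omega> \<Longrightarrow> f x = 0" "f \<in> borel_measurable borel"
  shows "dint \<Omega> f = integral\<^sup>L lborel f"
proof -
  have "dint \<Omega> f = integral\<^sup>L lebesgue (\<lambda>x. if x \<in> \<Omega> then f x else 0)"
    unfolding dint_def by (rule Lebesgue_Measure.integral_restrict_UNIV[OF \<Omega>_lebesgue, symmetric])
  also have "(\<lambda>x. if x \<in> \<Omega> then f x else 0) = f" using assms(1) by auto
  finally show ?thesis using assms(2) by (simp add: integral_completion)
qed

lemma dint_test_cpartial:
  assumes f: "test_fun \<Omega> f" and g: "smooth_fun g"
  shows "dint \<Omega> (\<lambda>x. g x * cpartial i f x) = - dint \<Omega> (\<lambda>x. cpartial i g x * f x)"
proof -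
  have fg: "test_fun \<Omega> (\<lambda>x. f x * g x)" by (rule test_fun_mult[OF f g])
  have i1: "test_fun \<Omega> (\<lambda>x. f x * cpartial i g x)" by (rule test_fun_mult[OF f smooth_fun_cpartial[OF g]])
  have i2: "test_fun \<Omega> (\<lambda>x. cpartial i f x * g x)" by (rule test_fun_mult[OF test_fun_cpartial[OF f] g])
  have t: "dint \<Omega> h = integral\<^sup>L lborel h" if "test_fun \<Omega> h" for h
    by (rule dint_test[OF test_fun_zero_outside[OF that] smooth_fun_measurable[OF test_fun_smooth[OF that]]])
  have "0 = integral\<^sup>L lborel (cpartial i (\<lambda>x. f x * g x))"
    by (rule integral_cpartial_eq_0[OF fg, symmetric])
  also have "cpartial i (\<lambda>x. f x * g x) = (\<lambda>x. f x * cpartial i g x + cpartial i f x * g x)"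
    by (intro cpartial_mult smooth_fun_differentiable test_fun_smooth[OF f] g)
  also have "integral\<^sup>L lborel \<dots> = integral\<^sup>L lborel (\<lambda>x. f x * cpartial i g x) + integral\<^sup>L lborel (\<lambda>x. cpartial i f x * g x)"
    by (intro Bochner_Integration.integral_add test_fun_integrable[OF i1] test_fun_integrable[OF i2])
  finally show ?thesis using t[OF i1] t[OF i2] by (simp add: mult.commute)
qed

text \<open>Functions here are Lebesgue measurable on \<Omega>. The extension by zero is replaced by
  a Borel function equal to it almost everywhere, which makes the statement for
  \<open>lborel\<close> applicable.\<close>

lemma fundamental_lemma:
  fixes g :: "real^'d \<Rightarrow> real"
  assumes g: "Lp \<Omega> 2 g" and zero: "\<And>\<phi>. test_fun \<Omega> \<phi> \<Longrightarrow> dint \<Omega> (\<lambda>x. g x * \<phi> x) = 0"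
  shows "AE x in M. g x = 0"
proof -
  define h where "h x = (if x \<in> \<Omega> then g x else 0)" for x
  have "integrable M g" using L2_mult_integrable[OF g Lp_const[of 2 1]] by simp
  then have h: "integrable lebesgue h"
    unfolding h_def by (subst Lebesgue_Measure.integrable_restrict_UNIV[OF \<Omega>_lebesgue])
  then obtain g' where g'[measurable]: "g' \<in> borel_measurable lborel" and eq: "AE x in lborel. h x = g' x"
    using completion_ex_borel_measurable_real[of h lborel] by auto
  have eqL: "AE x in lebesgue. h x = g' x" using eq by (rule AE_completion)
  have hm[measurable]: "h \<in> borel_measurable lebesgue" using h by (rule borel_measurable_integrable)
  have g'L: "g' \<in> borel_measurable lebesgue" using g' by (rule measurable_completion)
  have "integrable lebesgue g'" using h by (subst (asm) integrable_cong_AE[OF _ g'L eqL]) auto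
  then have int: "integrable lborel g'" by (subst (asm) integrable_completion[OF g'])
  have "integral\<^sup>L lborel (\<lambda>x. g' x * \<phi> x) = 0" if \<phi>: "test_fun \<Omega> \<phi>" for \<phi>
  proof -
    note [measurable] = smooth_fun_measurable[OF test_fun_smooth[OF \<phi>]]
    have \<phi>L: "\<phi> \<in> borel_measurable lebesgue" by (rule measurable_completion) measurable
    have "integral\<^sup>L lborel (\<lambda>x. g' x * \<phi> x) = integral\<^sup>L lebesgue (\<lambda>x. g' x * \<phi> x)"
      by (rule integral_completion[symmetric]) measurable
    also have "\<dots> = integral\<^sup>L lebesgue (\<lambda>x. h x * \<phi> x)"
      by (rule integral_cong_AE) (use eqL \<phi>L g'L hm in auto)
    also have "\<dots> = integral\<^sup>L lebesgue (\<lambda>x. if x \<in> \<Omega> then g x * \<phi> x else 0)"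
      by (rule Bochner_Integration.integral_cong) (auto simp: h_def)
    also have "\<dots> = dint \<Omega> (\<lambda>x. g x * \<phi> x)"
      unfolding dint_def by (rule Lebesgue_Measure.integral_restrict_UNIV[OF \<Omega>_lebesgue])
    finally show ?thesis by (simp add: zero[OF \<phi>])
  qed
  from fundamental_lemma_lborel[OF open_\<Omega> int this]
  have "AE x in lborel. x \<in> \<Omega> \<longrightarrow> g' x = 0" .
  with eq have "AE x in lborel. x \<in> \<Omega> \<longrightarrow> g x = 0"
    by eventually_elim (auto simp: h_def)
  then have "AE x in lebesgue. x \<in> \<Omega> \<longrightarrow> g x = 0" by (rule AE_completion)
  then show ?thesis using \<Omega>_lebesgue by (simp add: AE_restrict_space_iff)
qed

section \<open>Algebra of weak derivatives\<close>

lemma is_weak_derivD: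
  "is_weak_deriv \<Omega> \<alpha> u g \<Longrightarrow> test_fun \<Omega> \<phi> \<Longrightarrow>
    dint \<Omega> (\<lambda>x. u x * cderiv \<alpha> \<phi> x) = (-1) ^ mi_ord \<alpha> * dint \<Omega> (\<lambda>x. g x * \<phi> x)"
  by (simp add: is_weak_deriv_def)

lemma dint_lin_mult:
  fixes u v w :: "real^'d \<Rightarrow> real"
  assumes "Lp \<Omega> 2 u" "Lp \<Omega> 2 v" "Lp \<Omega> 2 w"
  shows "dint \<Omega> (\<lambda>x. (a * u x + b * v x) * w x) = a * dint \<Omega> (\<lambda>x. u x * w x) + b * dint \<Omega> (\<lambda>x. v x * w x)"
proof -
  have "dint \<Omega> (\<lambda>x. (a * u x + b * v x) * w x) = dint \<Omega> (\<lambda>x. a * (u x * w x) + b * (v x * w x))"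
    by (simp add: algebra_simps)
  then show ?thesis
    unfolding dint_def using L2_mult_integrable[OF assms(1,3)] L2_mult_integrable[OF assms(2,3)] by simp
qed

lemma is_weak_deriv_lin:
  assumes "Lp \<Omega> 2 u" "Lp \<Omega> 2 v" "Lp \<Omega> 2 g" "Lp \<Omega> 2 k"
    and "is_weak_deriv \<Omega> \<alpha> u g" "is_weak_deriv \<Omega> \<alpha> v k"
  shows "is_weak_deriv \<Omega> \<alpha> (\<lambda>x. a * u x + b * v x) (\<lambda>x. a * g x + b * k x)"
  unfolding is_weak_deriv_def
proof (intro allI impI)
  fix \<phi> assume \<phi>: "test_fun \<Omega> \<phi>"
  show "dint \<Omega> (\<lambda>x. (a * u x + b * v x) * cderiv \<alpha> \<phi> x) = (- 1) ^ mi_ord \<alpha> * dint \<Omega> (\<lambda>x. (a * g x + b * k x) * \<phi> x)"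
    using dint_lin_mult[OF assms(1,2) test_fun_cderiv_Lp[OF \<phi>, of 2 \<alpha>], of a b]
      dint_lin_mult[OF assms(3,4) test_fun_Lp[OF \<phi>, of 2], of a b]
      is_weak_derivD[OF assms(5) \<phi>] is_weak_derivD[OF assms(6) \<phi>]
    by (simp add: algebra_simps)
qed

lemma weak_deriv_unique:
  assumes "Lp \<Omega> 2 g" "Lp \<Omega> 2 k" "is_weak_deriv \<Omega> \<alpha> u g" "is_weak_deriv \<Omega> \<alpha> u k"
  shows "AE x in M. g x = k x"
proof -
  have "AE x in M. 1 * g x + (-1) * k x = 0"
  proof (rule fundamental_lemma)
    show "Lp \<Omega> 2 (\<lambda>x. 1 * g x + (-1) * k x)" using Lp_diff(1)[OF assms(1,2)] by simp
    fix \<phi> assume \<phi>: "test_fun \<Omega> \<phi>"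
    show "dint \<Omega> (\<lambda>x. (1 * g x + (-1) * k x) * \<phi> x) = 0"
      using dint_lin_mult[OF assms(1,2) test_fun_Lp[OF \<phi>, of 2], of 1 "-1"]
        is_weak_derivD[OF assms(3) \<phi>] is_weak_derivD[OF assms(4) \<phi>] by simp
  qed
  then show ?thesis by eventually_elim simp
qed

text \<open>\<open>wd\<close> is a choice: any one weak derivative in L^2 shows that the choice is
  meaningful, and the fundamental lemma that it agrees with this derivative almost everywhere. All
  later identities between values of \<open>wd\<close> are therefore almost everywhere
  statements.\<close>

lemma wd_props:
  assumes "Lp \<Omega> 2 g" "is_weak_deriv \<Omega> \<alpha> u g"
  shows "Lp \<Omega> 2 (wd \<Omega> \<alpha> u)" "is_weak_deriv \<Omega> \<alpha> u (wd \<Omega> \<alpha> u)" "AE x in M. wd \<Omega> \<alpha> u x = g x"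
proof -
  let ?P = "\<lambda>g. Lp \<Omega> 2 g \<and> is_weak_deriv \<Omega> \<alpha> u g"
  have "?P (wd \<Omega> \<alpha> u)" unfolding wd_def using assms by (intro someI[of ?P]) auto
  then show 1: "Lp \<Omega> 2 (wd \<Omega> \<alpha> u)" "is_weak_deriv \<Omega> \<alpha> u (wd \<Omega> \<alpha> u)" by auto
  show "AE x in M. wd \<Omega> \<alpha> u x = g x" by (rule weak_deriv_unique[OF 1(1) assms(1) 1(2) assms(2)])
qed

lemma Hs_Lp: "Hs \<Omega> m u \<Longrightarrow> Lp \<Omega> 2 u"
  by (simp add: Hs_def)

lemma Hs_wd:
  assumes "Hs \<Omega> m u" "mi_ord \<alpha> \<le> m"
  shows "Lp \<Omega> 2 (wd \<Omega> \<alpha> u)" "is_weak_deriv \<Omega> \<alpha> u (wd \<Omega> \<alpha> u)"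
  using assms wd_props(1,2)[of _ \<alpha> u] unfolding Hs_def by blast+

lemma is_weak_deriv_zero: "is_weak_deriv \<Omega> (\<lambda>_. 0) u u"
  unfolding is_weak_deriv_def by (simp add: cderiv_zero test_fun_smooth mi_ord_zero)

lemma wd_zero: "Lp \<Omega> 2 u \<Longrightarrow> AE x in M. wd \<Omega> (\<lambda>_. 0) u x = u x"
  by (rule wd_props(3)[OF _ is_weak_deriv_zero])

text \<open>Derivatives of test functions are test functions, so the definition for u can be tested
  with \<open>cderiv \<beta> \<phi>\<close>. The sign (-1)^|\<alpha>| then cancels because its
  square is 1.\<close>

lemma is_weak_deriv_trans:
  assumes "is_weak_deriv \<Omega> \<alpha> u g" "is_weak_deriv \<Omega> (\<lambda>l. \<alpha> l + \<beta> l) u k"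
  shows "is_weak_deriv \<Omega> \<beta> g k"
  unfolding is_weak_deriv_def
proof (intro allI impI)
  fix \<phi> assume \<phi>: "test_fun \<Omega> \<phi>"
  have "dint \<Omega> (\<lambda>x. u x * cderiv \<alpha> (cderiv \<beta> \<phi>) x) = (-1) ^ mi_ord \<alpha> * dint \<Omega> (\<lambda>x. g x * cderiv \<beta> \<phi> x)"
    by (rule is_weak_derivD[OF assms(1) test_fun_cderiv[OF \<phi>]])
  moreover have "dint \<Omega> (\<lambda>x. u x * cderiv \<alpha> (cderiv \<beta> \<phi>) x) = (-1) ^ (mi_ord \<alpha> + mi_ord \<beta>) * dint \<Omega> (\<lambda>x. k x * \<phi> x)"
    using is_weak_derivD[OF assms(2) \<phi>] by (simp add: cderiv_cderiv[OF test_fun_smooth[OF \<phi>]] mi_ord_add)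
  ultimately have "(-1) ^ mi_ord \<alpha> * ((-1) ^ mi_ord \<alpha> * dint \<Omega> (\<lambda>x. g x * cderiv \<beta> \<phi> x))
      = (-1) ^ mi_ord \<alpha> * ((-1) ^ mi_ord \<alpha> * ((-1) ^ mi_ord \<beta> * dint \<Omega> (\<lambda>x. k x * \<phi> x)))"
    by (simp add: power_add)
  then show "dint \<Omega> (\<lambda>x. g x * cderiv \<beta> \<phi> x) = (- 1) ^ mi_ord \<beta> * dint \<Omega> (\<lambda>x. k x * \<phi> x)"
    by (simp add: mult.assoc[symmetric] flip: power_mult_distrib)
qed

lemma Hs_of_wd:
  assumes u: "Hs \<Omega> m u" and le: "mi_ord \<alpha> + n \<le> m"
  shows "Hs \<Omega> n (wd \<Omega> \<alpha> u)"
  unfolding Hs_def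
proof (intro conjI allI impI)
  show "Lp \<Omega> 2 (wd \<Omega> \<alpha> u)" using Hs_wd[OF u] le by simp
  fix \<beta> :: "'d \<Rightarrow> nat" assume \<beta>: "mi_ord \<beta> \<le> n"
  have "mi_ord (\<lambda>l. \<alpha> l + \<beta> l) \<le> m" using le \<beta> by (simp add: mi_ord_add)
  note * = Hs_wd[OF u this]
  have "is_weak_deriv \<Omega> \<beta> (wd \<Omega> \<alpha> u) (wd \<Omega> (\<lambda>l. \<alpha> l + \<beta> l) u)"
    by (rule is_weak_deriv_trans[OF _ *(2)]) (use Hs_wd[OF u] le in auto)
  then show "\<exists>g. Lp \<Omega> 2 g \<and> is_weak_deriv \<Omega> \<beta> (wd \<Omega> \<alpha> u) g" using * by blast
qed

text \<open>Partial derivatives are moved over one at a time, so they arrive on the other factor in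
  reversed order, hence \<open>rev\<close>; the multi-index does not see the order.\<close>

lemma test_fun_weak_deriv:
  assumes f: "test_fun \<Omega> f"
  shows "is_weak_deriv \<Omega> \<alpha> f (cderiv \<alpha> f)"
  unfolding is_weak_deriv_def
proof (intro allI impI)
  fix \<phi> assume \<phi>: "test_fun \<Omega> \<phi>"
  obtain "is" where is': "\<And>i. count_list is i = \<alpha> i" using ex_list_multi_index by blast
  have c: "dint \<Omega> (\<lambda>x. g x * cpartials is \<phi> x) = (-1) ^ length is * dint \<Omega> (\<lambda>x. cpartials (rev is) g x * \<phi> x)"
    if "smooth_fun g" for g
    using that
  proof (induction "is" arbitrary: g)
    case (Cons i js)
    have "dint \<Omega> (\<lambda>x. g x * cpartial i (cpartials js \<phi>) x) = - dint \<Omega> (\<lambda>x. cpartial i g x * cpartials js \<phi> x)"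
      by (rule dint_test_cpartial[OF test_fun_cpartials[OF \<phi>] Cons.prems])
    then show ?case using Cons.IH[OF smooth_fun_cpartial[OF Cons.prems, of i]]
      by (simp add: cpartials_append)
  qed simp
  have "cderiv \<alpha> f = cpartials (rev is) f"
    by (rule cderiv_eq[OF test_fun_smooth[OF f]]) (simp add: is')
  then show "dint \<Omega> (\<lambda>x. f x * cderiv \<alpha> \<phi> x) = (-1) ^ mi_ord \<alpha> * dint \<Omega> (\<lambda>x. cderiv \<alpha> f x * \<phi> x)"
    using c[OF test_fun_smooth[OF f]] cderiv_eq[OF test_fun_smooth[OF \<phi>] is'] length_multi_index[OF is'] by simp
qed

lemma wd_lin:
  assumes u: "Hs \<Omega> m u" and v: "Hs \<Omega> m v" and \<alpha>: "mi_ord \<alpha> \<le> m"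
  shows "AE x in M. wd \<Omega> \<alpha> (\<lambda>x. a * u x + b * v x) x = a * wd \<Omega> \<alpha> u x + b * wd \<Omega> \<alpha> v x"
proof (rule wd_props(3))
  show "Lp \<Omega> 2 (\<lambda>x. a * wd \<Omega> \<alpha> u x + b * wd \<Omega> \<alpha> v x)"
    using Lp_lin(1)[OF Hs_wd(1)[OF u \<alpha>] Hs_wd(1)[OF v \<alpha>], of a b] by simp
  show "is_weak_deriv \<Omega> \<alpha> (\<lambda>x. a * u x + b * v x) (\<lambda>x. a * wd \<Omega> \<alpha> u x + b * wd \<Omega> \<alpha> v x)"
    by (intro is_weak_deriv_lin Hs_Lp[OF u] Hs_Lp[OF v] Hs_wd[OF u \<alpha>] Hs_wd[OF v \<alpha>])
qed

text \<open>\<open>Hs0\<close> measures the distance by weak derivatives of the difference.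
  Linearity and uniqueness turn these into differences of classical derivatives of the test
  functions and weak derivatives of u, the form needed for limits.\<close>

lemma Hs0_approx:
  assumes "Hs0 \<Omega> m u"
  obtains f where "\<And>j. test_fun \<Omega> (f j)"
    "\<And>\<alpha>. mi_ord \<alpha> \<le> m \<Longrightarrow> (\<lambda>j::nat. Lpnorm \<Omega> 2 (\<lambda>x. cderiv \<alpha> (f j) x - wd \<Omega> \<alpha> u x)) \<longlonglongrightarrow> 0"
proof -
  from assms obtain f where u: "Hs \<Omega> m u" and f: "\<And>j. test_fun \<Omega> (f j)"
    and lim: "(\<lambda>j. Hnorm \<Omega> m (\<lambda>x. f j x - u x)) \<longlonglongrightarrow> 0"
    unfolding Hs0_def by blast
  have "(\<lambda>j. Lpnorm \<Omega> 2 (\<lambda>x. cderiv \<alpha> (f j) x - wd \<Omega> \<alpha> u x)) \<longlonglongrightarrow> 0" if \<alpha>: "mi_ord \<alpha> \<le> m" for \<alpha>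
  proof (rule real_tendsto_sandwich[OF _ _ tendsto_const lim])
    have "Lpnorm \<Omega> 2 (\<lambda>x. cderiv \<alpha> (f j) x - wd \<Omega> \<alpha> u x) \<le> Hnorm \<Omega> m (\<lambda>x. f j x - u x)" for j
    proof -
      let ?g = "\<lambda>x. 1 * cderiv \<alpha> (f j) x + (-1) * wd \<Omega> \<alpha> u x"
      have Lg: "Lp \<Omega> 2 ?g"
        using Lp_lin(1)[OF test_fun_cderiv_Lp[OF f[of j], of 2 \<alpha>] Hs_wd(1)[OF u \<alpha>], of 1 "-1"] by simp
      have "is_weak_deriv \<Omega> \<alpha> (\<lambda>x. 1 * f j x + (-1) * u x) ?g"
        by (intro is_weak_deriv_lin test_fun_Lp[OF f] Hs_Lp[OF u] test_fun_cderiv_Lp[OF f] Hs_wd[OF u \<alpha>]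
            test_fun_weak_deriv f) auto
      note * = wd_props[OF Lg this]
      have "Lpnorm \<Omega> 2 ?g = Lpnorm \<Omega> 2 (wd \<Omega> \<alpha> (\<lambda>x. 1 * f j x + (-1) * u x))"
        by (rule Lpnorm_cong_AE) (use * Lp_measurable[OF *(1)] Lp_measurable[OF Lg] in auto)
      then show ?thesis using Lpnorm_wd_le_Hnorm[OF \<alpha>, of \<Omega> "\<lambda>x. f j x - u x"] by simp
    qed
    then show "\<forall>\<^sub>F j in sequentially. Lpnorm \<Omega> 2 (\<lambda>x. cderiv \<alpha> (f j) x - wd \<Omega> \<alpha> u x) \<le> Hnorm \<Omega> m (\<lambda>x. f j x - u x)"
      by simp
  qed (simp add: Lpnorm_nonneg)
  then show ?thesis using that f by blast
qed

lemma Hs0_Hs: "Hs0 \<Omega> m u \<Longrightarrow> Hs \<Omega> m u"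
  by (simp add: Hs0_def)

section \<open>Limits of pairings and integration by parts\<close>

lemma dint_mult_tendsto:
  fixes g u :: "real^'d \<Rightarrow> real"
  assumes g: "Lp \<Omega> 2 g" and u: "Lp \<Omega> 2 u" and v: "\<And>j. Lp \<Omega> 2 (v j)"
    and lim: "(\<lambda>j::nat. Lpnorm \<Omega> 2 (\<lambda>x. v j x - u x)) \<longlonglongrightarrow> 0"
  shows "(\<lambda>j. dint \<Omega> (\<lambda>x. g x * v j x)) \<longlonglongrightarrow> dint \<Omega> (\<lambda>x. g x * u x)"
proof (rule LIMSEQ_I)
  have "(\<lambda>j. Lpnorm \<Omega> 2 g * Lpnorm \<Omega> 2 (\<lambda>x. v j x - u x)) \<longlonglongrightarrow> Lpnorm \<Omega> 2 g * 0"
    by (intro tendsto_intros lim)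
  moreover fix r :: real assume "r > 0"
  ultimately obtain N where N: "\<And>j. j \<ge> N \<Longrightarrow> \<bar>Lpnorm \<Omega> 2 g * Lpnorm \<Omega> 2 (\<lambda>x. v j x - u x)\<bar> < r"
    using LIMSEQ_D by fastforce
  have "norm (dint \<Omega> (\<lambda>x. g x * v j x) - dint \<Omega> (\<lambda>x. g x * u x)) \<le> Lpnorm \<Omega> 2 g * Lpnorm \<Omega> 2 (\<lambda>x. v j x - u x)" for j
  proof -
    have "dint \<Omega> (\<lambda>x. g x * v j x) - dint \<Omega> (\<lambda>x. g x * u x) = dint \<Omega> (\<lambda>x. g x * (v j x - u x))"
      unfolding dint_def
      by (subst Bochner_Integration.integral_diff[symmetric]) (auto intro!: L2_mult_integrable g u v simp: algebra_simps)
    then show ?thesis using L2_Cauchy_Schwarz_real[OF g Lp_diff(1)[OF v u], of j] by simp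
  qed
  then show "\<exists>no. \<forall>n\<ge>no. norm (dint \<Omega> (\<lambda>x. g x * v n x) - dint \<Omega> (\<lambda>x. g x * u x)) < r"
    using N by (meson abs_ge_self le_less_trans)
qed

text \<open>For test functions this is the definition of the weak derivative of g. Both sides are
  L^2 pairings, continuous under H^2 approximation of v, so no boundary term appears although g need
  not vanish on the boundary.\<close>

lemma wd_integral_by_parts:
  assumes g: "Hs \<Omega> 1 g" and v: "Hs0 \<Omega> 2 v"
  shows "dint \<Omega> (\<lambda>x. g x * wd \<Omega> (\<lambda>l. mi_unit i l + mi_unit j l) v x)
    = - dint \<Omega> (\<lambda>x. wd \<Omega> (mi_unit j) g x * wd \<Omega> (mi_unit i) v x)"
proof -
  let ?ij = "\<lambda>l. mi_unit i l + mi_unit j l"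
  obtain f where f: "\<And>j. test_fun \<Omega> (f j)"
    and lim: "\<And>\<alpha>. mi_ord \<alpha> \<le> 2 \<Longrightarrow> (\<lambda>j::nat. Lpnorm \<Omega> 2 (\<lambda>x. cderiv \<alpha> (f j) x - wd \<Omega> \<alpha> v x)) \<longlonglongrightarrow> 0"
    using Hs0_approx[OF v] by blast
  have ord: "mi_ord ?ij = 2" "mi_ord (mi_unit i) \<le> 2" "mi_ord (mi_unit j) \<le> 1"
    by (simp_all add: mi_ord_add mi_ord_unit)
  have ord2: "mi_ord ?ij \<le> 2" using ord by simp
  note wdv = Hs_wd(1)[OF Hs0_Hs[OF v]] and wdg = Hs_wd[OF g ord(3)]
  have 1: "(\<lambda>n. dint \<Omega> (\<lambda>x. g x * cderiv ?ij (f n) x)) \<longlonglongrightarrow> dint \<Omega> (\<lambda>x. g x * wd \<Omega> ?ij v x)"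
    by (intro dint_mult_tendsto Hs_Lp[OF g] wdv ord2 test_fun_cderiv_Lp f lim) auto
  have 2: "(\<lambda>n. dint \<Omega> (\<lambda>x. wd \<Omega> (mi_unit j) g x * cderiv (mi_unit i) (f n) x)) \<longlonglongrightarrow> dint \<Omega> (\<lambda>x. wd \<Omega> (mi_unit j) g x * wd \<Omega> (mi_unit i) v x)"
    by (intro dint_mult_tendsto wdg wdv ord test_fun_cderiv_Lp f lim) auto
  have eq: "dint \<Omega> (\<lambda>x. g x * cderiv ?ij (f n) x) = - dint \<Omega> (\<lambda>x. wd \<Omega> (mi_unit j) g x * cderiv (mi_unit i) (f n) x)" for n
  proof -
    have "cderiv ?ij (f n) = cderiv (mi_unit j) (cderiv (mi_unit i) (f n))"
      by (simp add: cderiv_cderiv[OF test_fun_smooth[OF f]] add.commute)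
    then show ?thesis
      using is_weak_derivD[OF wdg(2) test_fun_cderiv[OF f, of "mi_unit i" n]] by (simp add: mi_ord_unit)
  qed
  show ?thesis by (rule LIMSEQ_unique[OF 1]) (use tendsto_minus[OF 2] eq in simp)
qed

lemma Lp_wgrad: "Hs \<Omega> m u \<Longrightarrow> m \<ge> 1 \<Longrightarrow> Lp \<Omega> 2 (wgrad \<Omega> u)"
  unfolding wgrad_def by (intro Lp_vec Hs_wd(1)[of m]) (auto simp: mi_ord_unit)

lemma Lp_whess: "Hs \<Omega> m u \<Longrightarrow> m \<ge> 2 \<Longrightarrow> Lp \<Omega> 2 (whess \<Omega> u)"
  unfolding whess_def by (intro Lp_vec Hs_wd(1)[of m]) (auto simp: mi_ord_unit mi_ord_add)

lemma Hs_whess_nth: "Hs \<Omega> 3 u \<Longrightarrow> Hs \<Omega> 1 (\<lambda>x. whess \<Omega> u x $ i $ j)"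
  unfolding whess_def using Hs_of_wd[of 3 u "\<lambda>l. mi_unit i l + mi_unit j l" 1]
  by (simp add: mi_ord_unit mi_ord_add)

lemma Lp_wdiv:
  assumes "\<And>i j. Hs \<Omega> 1 (\<lambda>x. \<xi> x $ i $ j)"
  shows "Lp \<Omega> 2 (wdiv \<Omega> \<xi>)"
  unfolding wdiv_def by (intro Lp_vec Lp_sum(1) Hs_wd(1)[OF assms]) (auto simp: mi_ord_unit)

text \<open>Entry by entry, the derivative of index j is moved over, which contracts the second
  index of the Hessian, exactly the one contracted by \<open>wdiv\<close>.\<close>

lemma whess_integral_by_parts:
  assumes u: "Hs \<Omega> 3 u" and v: "Hs0 \<Omega> 2 v"
  shows "dint \<Omega> (\<lambda>x. whess \<Omega> u x \<bullet> whess \<Omega> v x) = - dint \<Omega> (\<lambda>x. wdiv \<Omega> (whess \<Omega> u) x \<bullet> wgrad \<Omega> v x)"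
proof -
  let ?ij = "\<lambda>i j l. mi_unit i l + mi_unit j l"
  let ?g = "\<lambda>i j x. whess \<Omega> u x $ i $ j"
  have g: "Hs \<Omega> 1 (?g i j)" for i j by (rule Hs_whess_nth[OF u])
  have w2: "Lp \<Omega> 2 (wd \<Omega> (?ij i j) v)" for i j
    by (rule Hs_wd(1)[OF Hs0_Hs[OF v]]) (simp add: mi_ord_unit mi_ord_add)
  have w1: "Lp \<Omega> 2 (wd \<Omega> (mi_unit i) v)" for i
    by (rule Hs_wd(1)[OF Hs0_Hs[OF v]]) (simp add: mi_ord_unit)
  have g1: "Lp \<Omega> 2 (wd \<Omega> (mi_unit j) (?g i j))" for i j
    by (rule Hs_wd(1)[OF g]) (simp add: mi_ord_unit)
  have "dint \<Omega> (\<lambda>x. whess \<Omega> u x \<bullet> whess \<Omega> v x) = dint \<Omega> (\<lambda>x. \<Sum>i\<in>UNIV. \<Sum>j\<in>UNIV. ?g i j x * wd \<Omega> (?ij i j) v x)"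
    by (simp add: inner_vec_def whess_def)
  also have "\<dots> = (\<Sum>i\<in>UNIV. \<Sum>j\<in>UNIV. dint \<Omega> (\<lambda>x. ?g i j x * wd \<Omega> (?ij i j) v x))"
    unfolding dint_def
    by (simp add: Bochner_Integration.integral_sum Bochner_Integration.integrable_sum L2_mult_integrable Hs_Lp[OF g] w2)
  also have "\<dots> = (\<Sum>i\<in>UNIV. \<Sum>j\<in>UNIV. - dint \<Omega> (\<lambda>x. wd \<Omega> (mi_unit j) (?g i j) x * wd \<Omega> (mi_unit i) v x))"
    by (intro sum.cong refl wd_integral_by_parts[OF g v])
  also have "\<dots> = - dint \<Omega> (\<lambda>x. \<Sum>i\<in>UNIV. \<Sum>j\<in>UNIV. wd \<Omega> (mi_unit j) (?g i j) x * wd \<Omega> (mi_unit i) v x)"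
    unfolding dint_def
    by (simp add: Bochner_Integration.integral_sum Bochner_Integration.integrable_sum L2_mult_integrable g1 w1 sum_negf)
  also have "\<dots> = - dint \<Omega> (\<lambda>x. wdiv \<Omega> (whess \<Omega> u) x \<bullet> wgrad \<Omega> v x)"
    by (simp add: inner_vec_def wdiv_def wgrad_def sum_distrib_right)
  finally show ?thesis .
qed

text \<open>One subsequence serves all q: the sum over q of the squared differences tends to zero in
  L^1, hence almost everywhere along a subsequence, and it dominates each summand.\<close>

lemma L2_AE_subseq:
  fixes a :: "'q::finite \<Rightarrow> real^'d \<Rightarrow> real"
  assumes v: "\<And>q j. Lp \<Omega> 2 (v q j)" and a: "\<And>q. Lp \<Omega> 2 (a q)"
    and lim: "\<And>q. (\<lambda>j::nat. Lpnorm \<Omega> 2 (\<lambda>x. v q j x - a q x)) \<longlonglongrightarrow> 0"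
  obtains r :: "nat \<Rightarrow> nat" where "strict_mono r" "AE x in M. \<forall>q. (\<lambda>j. v q (r j) x) \<longlonglongrightarrow> a q x"
proof -
  let ?s = "\<lambda>j x. \<Sum>q\<in>UNIV. (v q j x - a q x)\<^sup>2"
  have L: "Lp \<Omega> 2 (\<lambda>x. v q j x - a q x)" for q j by (rule Lp_diff(1)[OF v a]) simp
  have int: "integrable M (\<lambda>x. (v q j x - a q x)\<^sup>2)" for q j using L[of q j] by (simp add: Lp2_iff)
  have "(\<integral>x. norm (?s j x) \<partial>M) = (\<Sum>q\<in>UNIV. (Lpnorm \<Omega> 2 (\<lambda>x. v q j x - a q x))\<^sup>2)" for j
    unfolding Lpnorm2_sq dint_def using int by (simp add: sum_nonneg Bochner_Integration.integral_sum)
  moreover have "(\<lambda>j. \<Sum>q\<in>UNIV. (Lpnorm \<Omega> 2 (\<lambda>x. v q j x - a q x))\<^sup>2) \<longlonglongrightarrow> (\<Sum>q\<in>(UNIV::'q set). 0\<^sup>2)"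
    by (intro tendsto_sum tendsto_power lim)
  ultimately have "(\<lambda>j. \<integral>x. norm (?s j x) \<partial>M) \<longlonglongrightarrow> 0" by simp
  then obtain r where r: "strict_mono r" "AE x in M. (\<lambda>j. ?s (r j) x) \<longlonglongrightarrow> 0"
    using tendsto_L1_AE_subseq[of M ?s] int by (auto intro: Bochner_Integration.integrable_sum)
  from r(2) have "AE x in M. \<forall>q. (\<lambda>j. v q (r j) x) \<longlonglongrightarrow> a q x"
  proof eventually_elim
    case (elim x)
    show ?case
    proof
      fix q
      have "(\<lambda>j. (v q (r j) x - a q x)\<^sup>2) \<longlonglongrightarrow> 0"
        by (rule real_tendsto_sandwich[OF _ _ tendsto_const elim]) (auto intro!: always_eventually member_le_sum)
      then have "(\<lambda>j. sqrt ((v q (r j) x - a q x)\<^sup>2)) \<longlonglongrightarrow> sqrt 0" by (rule tendsto_real_sqrt)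
      then have "(\<lambda>j. v q (r j) x - a q x) \<longlonglongrightarrow> 0" by (simp add: tendsto_rabs_zero_iff)
      then show "(\<lambda>j. v q (r j) x) \<longlonglongrightarrow> a q x" by (simp add: LIM_zero_iff)
    qed
  qed
  then show ?thesis using that r(1) by blast
qed

end

section \<open>The Gagliardo inequality in dimension at most three\<close>

text \<open>A square root on the extended half-line, so that Cauchy-Schwarz can be applied to
  iterated integrals before any of them is known to be finite.\<close>

definition esqrt :: "ennreal \<Rightarrow> ennreal" where
  "esqrt x = (if x = \<infinity> then \<infinity> else ennreal (sqrt (enn2real x)))"

lemma esqrt_square: "(esqrt x)\<^sup>2 = x"
proof (cases x)
  case (real r)
  then show ?thesis by (simp add: esqrt_def ennreal_power)
qed (simp add: esqrt_def power2_eq_square)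

lemma esqrt_measurable[measurable]: "esqrt \<in> borel_measurable borel"
  unfolding esqrt_def[abs_def] by measurable

text \<open>The infinite cases rest on zero times infinity being zero: if one factor vanishes, the
  hypothesis already forces A to vanish.\<close>

lemma square_le_esqrt_mult:
  assumes "A\<^sup>2 \<le> P * Q"
  shows "A \<le> esqrt P * esqrt Q"
proof (cases P)
  case P: (real p)
  show ?thesis
  proof (cases Q)
    case Q: (real q)
    show ?thesis
    proof (cases A)
      case A: (real a)
      have "a\<^sup>2 \<le> p * q"
        using assms P Q A by (simp add: ennreal_power flip: ennreal_mult)
      then have "a \<le> sqrt p * sqrt q" using real_le_rsqrt[of a "p * q"] by (simp add: real_sqrt_mult)
      then show ?thesis using P Q A by (simp add: esqrt_def flip: ennreal_mult)
    next
      case top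
      then show ?thesis using assms P Q by (simp add: top_unique flip: ennreal_mult)
    qed
  next
    case top
    then show ?thesis using assms P
      by (cases "p = 0") (auto simp: esqrt_def ennreal_mult_top ennreal_top_mult)
  qed
next
  case top
  show ?thesis
  proof (cases "Q = 0")
    case True
    then show ?thesis using assms by simp
  next
    case False
    then have "esqrt Q \<noteq> 0" using esqrt_square[of Q] by auto
    then show ?thesis using top by (simp add: esqrt_def ennreal_top_mult)
  qed
qed

text \<open>Stated for squares because the bound it produces is again a bound on a square, so it can
  be iterated variable by variable.\<close>

lemma nn_integral_square_le:
  assumes [measurable]: "A \<in> borel_measurable M" "P \<in> borel_measurable M" "Q \<in> borel_measurable M"
    and le: "\<And>x. (A x)\<^sup>2 \<le> P x * Q x"
  shows "(\<integral>\<^sup>+x. A x \<partial>M)\<^sup>2 \<le> (\<integral>\<^sup>+x. P x \<partial>M) * (\<integral>\<^sup>+x. Q x \<partial>M)"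
proof -
  have "(\<integral>\<^sup>+x. A x \<partial>M)\<^sup>2 \<le> (\<integral>\<^sup>+x. esqrt (P x) * esqrt (Q x) \<partial>M)\<^sup>2"
    by (intro power_mono nn_integral_mono square_le_esqrt_mult le) auto
  also have "\<dots> \<le> (\<integral>\<^sup>+x. (esqrt (P x))\<^sup>2 \<partial>M) * (\<integral>\<^sup>+x. (esqrt (Q x))\<^sup>2 \<partial>M)"
    by (rule Cauchy_Schwarz_nn_integral) measurable
  finally show ?thesis by (simp add: esqrt_square)
qed

text \<open>The factors are arbitrary so that one-point factors cover the dimensions below three.\<close>
lemma gagliardo_product:
  assumes M1: "sigma_finite_measure M1" and M2: "sigma_finite_measure M2" and M3: "sigma_finite_measure M3"
    and A[measurable]: "A \<in> borel_measurable (M1 \<Otimes>\<^sub>M (M2 \<Otimes>\<^sub>M M3))"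
    and q[measurable]: "q \<in> borel_measurable (M1 \<Otimes>\<^sub>M (M2 \<Otimes>\<^sub>M M3))"
    and le: "\<And>x y z. x \<in> space M1 \<Longrightarrow> y \<in> space M2 \<Longrightarrow> z \<in> space M3 \<Longrightarrow> (A (x, y, z))\<^sup>2 \<le>
      (\<integral>\<^sup>+x'. q (x', y, z) \<partial>M1) * (\<integral>\<^sup>+y'. q (x, y', z) \<partial>M2) * (\<integral>\<^sup>+z'. q (x, y, z') \<partial>M3)"
    and sp: "space M1 = UNIV" "space M2 = UNIV" "space M3 = UNIV"
  shows "(\<integral>\<^sup>+x. \<integral>\<^sup>+y. \<integral>\<^sup>+z. A (x, y, z) \<partial>M3 \<partial>M2 \<partial>M1)\<^sup>2 \<le> (\<integral>\<^sup>+x. \<integral>\<^sup>+y. \<integral>\<^sup>+z. q (x, y, z) \<partial>M3 \<partial>M2 \<partial>M1) ^ 3"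
proof -
  interpret M1: sigma_finite_measure M1 by fact
  interpret M2: sigma_finite_measure M2 by fact
  interpret M3: sigma_finite_measure M3 by fact
  interpret P12: pair_sigma_finite M1 M2 ..
  interpret P23: pair_sigma_finite M2 M3 ..
  interpret P13: pair_sigma_finite M1 M3 ..
  note [simp] = sp
  define G1 where "G1 y z = (\<integral>\<^sup>+x'. q (x', y, z) \<partial>M1)" for y z
  define G2 where "G2 x z = (\<integral>\<^sup>+y'. q (x, y', z) \<partial>M2)" for x z
  define G3 where "G3 x y = (\<integral>\<^sup>+z'. q (x, y, z') \<partial>M3)" for x y
  define I where "I x = (\<integral>\<^sup>+y. G3 x y \<partial>M2)" for x
  define J where "J y = (\<integral>\<^sup>+z. G1 y z \<partial>M3)" for y
  define T where "T = (\<integral>\<^sup>+x. I x \<partial>M1)"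
  have [measurable]: "(\<lambda>z. A (x, y, z)) \<in> borel_measurable M3" "(\<lambda>z. q (x, y, z)) \<in> borel_measurable M3"
     "(\<lambda>y. q (x, y, z)) \<in> borel_measurable M2" "(\<lambda>x. q (x, y, z)) \<in> borel_measurable M1" for x y z
    by (rule measurable_compose[OF _ A] measurable_compose[OF _ q], simp)+
  have [measurable]: "(\<lambda>(y, z). q (x, y, z)) \<in> borel_measurable (M2 \<Otimes>\<^sub>M M3)" 
     "(\<lambda>(y, z). A (x, y, z)) \<in> borel_measurable (M2 \<Otimes>\<^sub>M M3)" 
     "(\<lambda>(x, z). q (x, y, z)) \<in> borel_measurable (M1 \<Otimes>\<^sub>M M3)" for x y
    by (auto intro!: measurable_compose[OF _ A] measurable_compose[OF _ q] simp: split_def)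
  have [measurable]: "(\<lambda>p. G1 (fst p) (snd p)) \<in> borel_measurable (M2 \<Otimes>\<^sub>M M3)"
    "(\<lambda>p. G2 (fst p) (snd p)) \<in> borel_measurable (M1 \<Otimes>\<^sub>M M3)"
    "(\<lambda>p. G3 (fst p) (snd p)) \<in> borel_measurable (M1 \<Otimes>\<^sub>M M2)"
    "G1 y \<in> borel_measurable M3" "G2 x \<in> borel_measurable M3" "G3 x \<in> borel_measurable M2"
    "(\<lambda>p. \<integral>\<^sup>+z. A (fst p, snd p, z) \<partial>M3) \<in> borel_measurable (M1 \<Otimes>\<^sub>M M2)"
    "(\<lambda>y. \<integral>\<^sup>+z. A (x, y, z) \<partial>M3) \<in> borel_measurable M2" for x y
    unfolding G1_def G2_def G3_def by measurable
  have [measurable]: "I \<in> borel_measurable M1" "J \<in> borel_measurable M2"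
    "(\<lambda>x. \<integral>\<^sup>+y. \<integral>\<^sup>+z. A (x, y, z) \<partial>M3 \<partial>M2) \<in> borel_measurable M1"
    unfolding I_def J_def by measurable
  have swap: "(\<integral>\<^sup>+z. G2 x z \<partial>M3) = I x" for x
    unfolding I_def G2_def G3_def by (rule P23.Fubini') measurable
  have swapT: "(\<integral>\<^sup>+y. J y \<partial>M2) = T"
  proof -
    have "J y = (\<integral>\<^sup>+x. G3 x y \<partial>M1)" for y
      unfolding J_def G1_def G3_def by (rule P13.Fubini') measurable
    moreover have "(\<integral>\<^sup>+y. \<integral>\<^sup>+x. G3 x y \<partial>M1 \<partial>M2) = T"
      unfolding T_def I_def by (rule P12.Fubini') measurable
    ultimately show ?thesis by simp
  qed
  \<comment> \<open>Each of the three line integrals is constant in one variable. Integrating in z,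
    \<open>G3\<close> is a constant and Cauchy-Schwarz separates \<open>G2\<close> from
    \<open>G1\<close>.\<close>
  have s1: "(\<integral>\<^sup>+z. A (x, y, z) \<partial>M3)\<^sup>2 \<le> (G3 x y * I x) * J y" for x y
  proof -
    have "(\<integral>\<^sup>+z. A (x, y, z) \<partial>M3)\<^sup>2 \<le> (\<integral>\<^sup>+z. G3 x y * G2 x z \<partial>M3) * (\<integral>\<^sup>+z. G1 y z \<partial>M3)"
      using le[of x y] by (intro nn_integral_square_le) (auto simp: G1_def G2_def G3_def ac_simps)
    then show ?thesis by (simp add: nn_integral_cmult swap J_def)
  qed
  \<comment> \<open>In the y direction \<open>I x\<close> is the constant factor, and
    \<open>J\<close> integrates to the total integral \<open>T\<close>.\<close>
  have s2: "(\<integral>\<^sup>+y. \<integral>\<^sup>+z. A (x, y, z) \<partial>M3 \<partial>M2)\<^sup>2 \<le> I x * (I x * T)" for x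
  proof -
    have "(\<integral>\<^sup>+y. \<integral>\<^sup>+z. A (x, y, z) \<partial>M3 \<partial>M2)\<^sup>2 \<le> (\<integral>\<^sup>+y. G3 x y * I x \<partial>M2) * (\<integral>\<^sup>+y. J y \<partial>M2)"
      by (intro nn_integral_square_le s1) measurable
    moreover have "(\<integral>\<^sup>+y. G3 x y * I x \<partial>M2) = I x * I x"
      by (subst nn_integral_multc) (measurable, simp add: I_def[symmetric])
    ultimately show ?thesis by (simp add: swapT mult.assoc)
  qed
  have "(\<integral>\<^sup>+x. \<integral>\<^sup>+y. \<integral>\<^sup>+z. A (x, y, z) \<partial>M3 \<partial>M2 \<partial>M1)\<^sup>2 \<le> (\<integral>\<^sup>+x. I x \<partial>M1) * (\<integral>\<^sup>+x. I x * T \<partial>M1)"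
    by (intro nn_integral_square_le s2) measurable
  also have "\<dots> = T ^ 3" by (simp add: nn_integral_multc T_def[symmetric] power3_eq_cube mult.assoc)
  finally show ?thesis by (simp add: T_def I_def G3_def)
qed

section \<open>Lebesgue measure on vectors as a product measure\<close>

lemma measurable_vec_lambda_real:
  fixes f :: "'a \<Rightarrow> 'd::finite \<Rightarrow> real"
  assumes "\<And>i. (\<lambda>x. f x i) \<in> borel_measurable N"
  shows "(\<lambda>x. \<chi> i. f x i) \<in> borel_measurable N"
proof (subst borel_measurable_euclidean_space, safe)
  fix b :: "real^'d" assume "b \<in> Basis"
  then obtain i where "b = axis i 1" by (auto simp: Basis_vec_def)
  then show "(\<lambda>x. (\<chi> i. f x i) \<bullet> b) \<in> borel_measurable N"
    using assms by (simp add: inner_axis)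
qed

lemma prod_Basis_vec: "(\<Prod>b\<in>Basis. (x :: real^'d::finite) \<bullet> b) = (\<Prod>i\<in>UNIV. x $ i)"
proof -
  have B: "(Basis :: (real^'d) set) = (\<lambda>i. axis i 1) ` UNIV" by (auto simp: Basis_vec_def)
  have inj: "inj (\<lambda>i::'d. axis i (1::real))" by (auto simp: inj_def axis_eq_axis)
  show ?thesis unfolding B by (subst prod.reindex[OF inj]) (simp add: inner_axis)
qed

text \<open>Lebesgue measure is determined by its values on boxes, and the preimage of a box under
  the coordinate map is a product of intervals. Naming the elements of the finite index type
  supplies the coordinates; dimensions two and three follow the same pattern.\<close>

lemma lborel_vec1:
  assumes U: "UNIV = {a::'d::finite}"
  shows "lborel = distr lborel borel (\<lambda>x. (\<chi> i. x) :: real^'d)"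
proof (rule lborel_eqI)
  have [measurable]: "(\<lambda>x. (\<chi> i. x) :: real^'d) \<in> borel_measurable borel"
    by (rule measurable_vec_lambda_real) measurable
  fix l u :: "real^'d" assume le: "\<And>b. b \<in> Basis \<Longrightarrow> l \<bullet> b \<le> u \<bullet> b"
  have le': "l $ i \<le> u $ i" for i using le[of "axis i 1"] by (simp add: inner_axis axis_in_Basis_iff)
  have all: "(\<forall>i. P i) \<longleftrightarrow> P a" for P :: "'d \<Rightarrow> bool" using U by (metis UNIV_I singletonD)
  have "(\<lambda>x. (\<chi> i. x) :: real^'d) -` box l u = {l $ a<..<u $ a}"
    by (auto simp: mem_box_cart all)
  then show "emeasure (distr lborel borel (\<lambda>x. (\<chi> i. x) :: real^'d)) (box l u) = ennreal (\<Prod>b\<in>Basis. (u - l) \<bullet> b)"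
    using le' by (subst emeasure_distr) (auto simp: prod_Basis_vec U)
qed simp

lemma lborel_vec2:
  assumes U: "UNIV = {a::'d::finite, b}" and ab: "a \<noteq> b"
  shows "lborel = distr (lborel \<Otimes>\<^sub>M lborel) borel (\<lambda>(x, y). (\<chi> i. if i = a then x else y) :: real^'d)"
proof (rule lborel_eqI)
  let ?v = "\<lambda>(x, y). (\<chi> i. if i = a then x else y) :: real^'d"
  have [measurable]: "?v \<in> borel_measurable (lborel \<Otimes>\<^sub>M lborel)"
    unfolding split_def by (rule measurable_vec_lambda_real) measurable
  fix l u :: "real^'d" assume le: "\<And>b. b \<in> Basis \<Longrightarrow> l \<bullet> b \<le> u \<bullet> b"
  have le': "l $ i \<le> u $ i" for i using le[of "axis i 1"] by (simp add: inner_axis axis_in_Basis_iff)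
  have all: "(\<forall>i. P i) \<longleftrightarrow> P a \<and> P b" for P :: "'d \<Rightarrow> bool" using U by (metis UNIV_I insert_iff singletonD)
  have "?v -` box l u = {l $ a<..<u $ a} \<times> {l $ b<..<u $ b}"
    using ab by (auto simp: mem_box_cart all)
  then show "emeasure (distr (lborel \<Otimes>\<^sub>M lborel) borel ?v) (box l u) = ennreal (\<Prod>b\<in>Basis. (u - l) \<bullet> b)"
    using le' ab
    by (subst emeasure_distr) (auto simp: prod_Basis_vec U space_pair_measure lborel.emeasure_pair_measure_Times ennreal_mult)
qed simp

lemma lborel_vec3:
  assumes U: "UNIV = {a::'d::finite, b, c}" and ab: "a \<noteq> b" "a \<noteq> c" "b \<noteq> c"
  shows "lborel = distr (lborel \<Otimes>\<^sub>M (lborel \<Otimes>\<^sub>M lborel)) borel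
    (\<lambda>(x, y, z). (\<chi> i. if i = a then x else if i = b then y else z) :: real^'d)"
proof (rule lborel_eqI)
  let ?v = "\<lambda>(x, y, z). (\<chi> i. if i = a then x else if i = b then y else z) :: real^'d"
  have [measurable]: "?v \<in> borel_measurable (lborel \<Otimes>\<^sub>M (lborel \<Otimes>\<^sub>M lborel))"
    unfolding split_def by (rule measurable_vec_lambda_real) measurable
  have L2: "sigma_finite_measure (lborel \<Otimes>\<^sub>M lborel :: (real \<times> real) measure)"
    unfolding lborel_prod by (rule sigma_finite_lborel)
  fix l u :: "real^'d" assume le: "\<And>b. b \<in> Basis \<Longrightarrow> l \<bullet> b \<le> u \<bullet> b"
  have le': "l $ i \<le> u $ i" for i using le[of "axis i 1"] by (simp add: inner_axis axis_in_Basis_iff)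
  have all: "(\<forall>i. P i) \<longleftrightarrow> P a \<and> P b \<and> P c" for P :: "'d \<Rightarrow> bool" using U by (metis UNIV_I insert_iff singletonD)
  have "?v -` box l u = {l $ a<..<u $ a} \<times> {l $ b<..<u $ b} \<times> {l $ c<..<u $ c}"
    using ab by (auto simp: mem_box_cart all)
  then show "emeasure (distr (lborel \<Otimes>\<^sub>M (lborel \<Otimes>\<^sub>M lborel)) borel ?v) (box l u) = ennreal (\<Prod>b\<in>Basis. (u - l) \<bullet> b)"
    using le' ab
    by (subst emeasure_distr) (auto simp: prod_Basis_vec U space_pair_measure sigma_finite_measure.emeasure_pair_measure_Times[OF L2] lborel.emeasure_pair_measure_Times ennreal_mult mult.assoc)
qed simp

lemma nn_integral_unit: "(\<integral>\<^sup>+x. f x \<partial>count_space (UNIV :: unit set)) = f ()"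
  by (subst nn_integral_count_space_finite, simp, subst UNIV_unit, simp)

text \<open>In dimension below three the missing factors are one-point spaces, over which the
  integral of q is its value. This is what the pointwise hypothesis \<open>le\<close> feeds, while
  \<open>le_line\<close> serves the genuine directions.\<close>

lemma gagliardo_vec:
  fixes w q :: "real^'d::finite \<Rightarrow> ennreal"
  assumes d: "CARD('d) \<le> 3"
    and [measurable]: "w \<in> borel_measurable borel" "q \<in> borel_measurable borel"
    and le: "\<And>x. (w x)\<^sup>2 \<le> q x"
    and le_line: "\<And>x i. (w x)\<^sup>2 \<le> (\<integral>\<^sup>+t. q (\<chi> j. if j = i then t else x $ j) \<partial>lborel)"
  shows "(\<integral>\<^sup>+x. (w x) ^ 3 \<partial>lborel)\<^sup>2 \<le> (\<integral>\<^sup>+x. q x \<partial>lborel) ^ 3"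
proof -
  have cube: "((w x) ^ 3)\<^sup>2 \<le> A * B * C" if "(w x)\<^sup>2 \<le> A" "(w x)\<^sup>2 \<le> B" "(w x)\<^sup>2 \<le> C" for x A B C
  proof -
    have "((w x) ^ 3)\<^sup>2 = (w x)\<^sup>2 * (w x)\<^sup>2 * (w x)\<^sup>2"
      by (simp add: power2_eq_square power3_eq_cube ac_simps)
    also have "\<dots> \<le> A * B * C" using that by (intro mult_mono) auto
    finally show ?thesis .
  qed
  have "CARD('d) > 0" by simp
  with d consider "CARD('d) = 1" | "CARD('d) = 2" | "CARD('d) = 3" by linarith
  then show ?thesis
  proof cases
    case 1
    then obtain a :: 'd where U: "UNIV = {a}" using card_1_singletonE by blast
    let ?v = "\<lambda>x. (\<chi> i. x) :: real^'d" and ?u = "count_space (UNIV :: unit set)"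
    have [measurable]: "?v \<in> borel_measurable borel" by (rule measurable_vec_lambda_real) measurable
    have int: "(\<integral>\<^sup>+x. f x \<partial>lborel) = (\<integral>\<^sup>+x. \<integral>\<^sup>+y. \<integral>\<^sup>+z. f (?v x) \<partial>?u \<partial>?u \<partial>lborel)"
      if [measurable]: "f \<in> borel_measurable borel" for f :: "real^'d \<Rightarrow> ennreal"
      by (subst lborel_vec1[OF U], subst nn_integral_distr) (auto simp: nn_integral_unit)
    have eq: "(\<chi> j. if j = a then t else ?v x $ j) = ?v t" for t x
      using U by (auto simp: vec_eq_iff)
    have l: "(w (?v x))\<^sup>2 \<le> (\<integral>\<^sup>+t. q (?v t) \<partial>lborel)" for x
      using le_line[of "?v x" a] unfolding eq .
    have "(\<integral>\<^sup>+x. \<integral>\<^sup>+y. \<integral>\<^sup>+z. (\<lambda>(x, y, z). (w (?v x)) ^ 3) (x, y, z) \<partial>?u \<partial>?u \<partial>lborel)\<^sup>2 \<le>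
      (\<integral>\<^sup>+x. \<integral>\<^sup>+y. \<integral>\<^sup>+z. (\<lambda>(x, y, z). q (?v x)) (x, y, z) \<partial>?u \<partial>?u \<partial>lborel) ^ 3"
    proof (rule gagliardo_product)
      fix x y z
      show "((\<lambda>(x, y, z). (w (?v x)) ^ 3) (x, y, z))\<^sup>2 \<le> (\<integral>\<^sup>+x'. (\<lambda>(x, y, z). q (?v x)) (x', y, z) \<partial>lborel)
        * (\<integral>\<^sup>+y'. (\<lambda>(x, y, z). q (?v x)) (x, y', z) \<partial>?u) * (\<integral>\<^sup>+z'. (\<lambda>(x, y, z). q (?v x)) (x, y, z') \<partial>?u)"
        unfolding prod.case nn_integral_unit by (rule cube[OF l le le])
    qed (auto simp: split_def intro: sigma_finite_lborel sigma_finite_measure_count_space)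
    then show ?thesis by (simp add: int)
  next
    case 2
    then obtain a b :: 'd where U: "UNIV = {a, b}" "a \<noteq> b" by (meson card_2_iff)
    let ?v = "\<lambda>x y. (\<chi> i. if i = a then x else y) :: real^'d" and ?u = "count_space (UNIV :: unit set)"
    have [measurable]: "(\<lambda>p. ?v (fst p) (snd p)) \<in> borel_measurable (lborel \<Otimes>\<^sub>M lborel)"
      by (rule measurable_vec_lambda_real) measurable
    have [measurable]: "(\<lambda>p. ?v (fst p) (fst (snd p))) \<in> borel_measurable (lborel \<Otimes>\<^sub>M (lborel \<Otimes>\<^sub>M ?u))"
      by (rule measurable_vec_lambda_real) measurable
    have int: "(\<integral>\<^sup>+x. f x \<partial>lborel) = (\<integral>\<^sup>+x. \<integral>\<^sup>+y. \<integral>\<^sup>+z. f (?v x y) \<partial>?u \<partial>lborel \<partial>lborel)"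
      if [measurable]: "f \<in> borel_measurable borel" for f :: "real^'d \<Rightarrow> ennreal"
      by (subst lborel_vec2[OF U], subst nn_integral_distr)
        (auto simp: nn_integral_unit split_def lborel.nn_integral_fst[symmetric] cong: if_cong)
    have all: "(\<forall>i. P i) \<longleftrightarrow> P a \<and> P b" for P :: "'d \<Rightarrow> bool" using U by (metis UNIV_I insert_iff singletonD)
    have eq: "(\<chi> j. if j = a then t else ?v x y $ j) = ?v t y" "(\<chi> j. if j = b then t else ?v x y $ j) = ?v x t" for t x y
      using U(2) by (auto simp: vec_eq_iff all)
    have l: "(w (?v x y))\<^sup>2 \<le> (\<integral>\<^sup>+t. q (?v t y) \<partial>lborel)" "(w (?v x y))\<^sup>2 \<le> (\<integral>\<^sup>+t. q (?v x t) \<partial>lborel)" for x y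
      using le_line[of "?v x y" a] le_line[of "?v x y" b] unfolding eq .
    have "(\<integral>\<^sup>+x. \<integral>\<^sup>+y. \<integral>\<^sup>+z. (\<lambda>(x, y, z). (w (?v x y)) ^ 3) (x, y, z) \<partial>?u \<partial>lborel \<partial>lborel)\<^sup>2 \<le>
      (\<integral>\<^sup>+x. \<integral>\<^sup>+y. \<integral>\<^sup>+z. (\<lambda>(x, y, z). q (?v x y)) (x, y, z) \<partial>?u \<partial>lborel \<partial>lborel) ^ 3"
    proof (rule gagliardo_product)
      fix x y z
      show "((\<lambda>(x, y, z). (w (?v x y)) ^ 3) (x, y, z))\<^sup>2 \<le> (\<integral>\<^sup>+x'. (\<lambda>(x, y, z). q (?v x y)) (x', y, z) \<partial>lborel)
        * (\<integral>\<^sup>+y'. (\<lambda>(x, y, z). q (?v x y)) (x, y', z) \<partial>lborel) * (\<integral>\<^sup>+z'. (\<lambda>(x, y, z). q (?v x y)) (x, y, z') \<partial>?u)"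
        unfolding prod.case nn_integral_unit by (rule cube[OF l le])
    qed (auto simp: split_def intro: sigma_finite_lborel sigma_finite_measure_count_space)
    then show ?thesis by (simp add: int)
  next
    case 3
    then obtain a b c :: 'd where U: "UNIV = {a, b, c}" "a \<noteq> b" "a \<noteq> c" "b \<noteq> c" by (metis card_3_iff)
    let ?v = "\<lambda>x y z. (\<chi> i. if i = a then x else if i = b then y else z) :: real^'d"
    have [measurable]: "(\<lambda>p. ?v (fst p) (fst (snd p)) (snd (snd p))) \<in> borel_measurable (lborel \<Otimes>\<^sub>M (lborel \<Otimes>\<^sub>M lborel))"
      by (rule measurable_vec_lambda_real) measurable
    have [measurable]: "(\<lambda>p. ?v x (fst p) (snd p)) \<in> borel_measurable (lborel \<Otimes>\<^sub>M lborel)" for x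
      by (rule measurable_vec_lambda_real) measurable
    have L2: "sigma_finite_measure (lborel \<Otimes>\<^sub>M lborel :: (real \<times> real) measure)"
      unfolding lborel_prod by (rule sigma_finite_lborel)
    have int: "(\<integral>\<^sup>+x. f x \<partial>lborel) = (\<integral>\<^sup>+x. \<integral>\<^sup>+y. \<integral>\<^sup>+z. f (?v x y z) \<partial>lborel \<partial>lborel \<partial>lborel)"
      if [measurable]: "f \<in> borel_measurable borel" for f :: "real^'d \<Rightarrow> ennreal"
      by (subst lborel_vec3[OF U], subst nn_integral_distr)
        (auto simp: split_def sigma_finite_measure.nn_integral_fst[OF L2, symmetric] lborel.nn_integral_fst[symmetric] cong: if_cong)
    have all: "(\<forall>i. P i) \<longleftrightarrow> P a \<and> P b \<and> P c" for P :: "'d \<Rightarrow> bool" using U by (metis UNIV_I insert_iff singletonD)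
    have eq: "(\<chi> j. if j = a then t else ?v x y z $ j) = ?v t y z" "(\<chi> j. if j = b then t else ?v x y z $ j) = ?v x t z"
       "(\<chi> j. if j = c then t else ?v x y z $ j) = ?v x y t" for t x y z
      using U(2-) by (auto simp: vec_eq_iff all)
    have l: "(w (?v x y z))\<^sup>2 \<le> (\<integral>\<^sup>+t. q (?v t y z) \<partial>lborel)" "(w (?v x y z))\<^sup>2 \<le> (\<integral>\<^sup>+t. q (?v x t z) \<partial>lborel)"
      "(w (?v x y z))\<^sup>2 \<le> (\<integral>\<^sup>+t. q (?v x y t) \<partial>lborel)" for x y z
      using le_line[of "?v x y z" a] le_line[of "?v x y z" b] le_line[of "?v x y z" c] unfolding eq .
    have "(\<integral>\<^sup>+x. \<integral>\<^sup>+y. \<integral>\<^sup>+z. (\<lambda>(x, y, z). (w (?v x y z)) ^ 3) (x, y, z) \<partial>lborel \<partial>lborel \<partial>lborel)\<^sup>2 \<le>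
      (\<integral>\<^sup>+x. \<integral>\<^sup>+y. \<integral>\<^sup>+z. (\<lambda>(x, y, z). q (?v x y z)) (x, y, z) \<partial>lborel \<partial>lborel \<partial>lborel) ^ 3"
    proof (rule gagliardo_product)
      fix x y z
      show "((\<lambda>(x, y, z). (w (?v x y z)) ^ 3) (x, y, z))\<^sup>2 \<le> (\<integral>\<^sup>+x'. (\<lambda>(x, y, z). q (?v x y z)) (x', y, z) \<partial>lborel)
        * (\<integral>\<^sup>+y'. (\<lambda>(x, y, z). q (?v x y z)) (x, y', z) \<partial>lborel) * (\<integral>\<^sup>+z'. (\<lambda>(x, y, z). q (?v x y z)) (x, y, z') \<partial>lborel)"
        unfolding prod.case by (rule cube[OF l])
    qed (auto simp: split_def intro: sigma_finite_lborel)
    then show ?thesis by (simp add: int)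
  qed
qed

section \<open>The Sobolev inequality\<close>

lemma smooth_fun_power: "smooth_fun f \<Longrightarrow> smooth_fun (\<lambda>x. f x ^ n)"
  by (induction n) (auto intro: smooth_fun_const smooth_fun_mult)

lemma test_fun_power:
  assumes "test_fun \<Omega> f" "n > 0"
  shows "test_fun \<Omega> (\<lambda>x. f x ^ n)"
proof -
  obtain m where n: "n = Suc m" using assms(2) gr0_implies_Suc by blast
  show ?thesis unfolding n power_Suc
    by (rule test_fun_mult[OF assms(1) smooth_fun_power[OF test_fun_smooth[OF assms(1)]]])
qed

text \<open>Fundamental theorem of calculus for u^4 along the line in direction i, starting outside
  the support. The fourth power is the square of u^2, the function whose cube is u^6.\<close>

lemma test_fun_line_bound:
  fixes u :: "real^'d::finite \<Rightarrow> real"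
  assumes u: "test_fun \<Omega> u"
  shows "ennreal ((u x) ^ 4) \<le>
    (\<integral>\<^sup>+t. ennreal (4 * \<bar>u (\<chi> j. if j = i then t else x $ j)\<bar> ^ 3 * \<bar>cpartial i u (\<chi> j. if j = i then t else x $ j)\<bar>) \<partial>lborel)"
proof -
  note sm = test_fun_smooth[OF u]
  define y where "y t = x + t *\<^sub>R axis i 1" for t
  define g' where "g' t = 4 * (u (y t)) ^ 3 * cpartial i u (y t)" for t
  obtain K where K: "compact K" "K \<subseteq> \<Omega>" "\<And>x. x \<notin> K \<Longrightarrow> u x = 0" using test_funE[OF u] by blast
  obtain R0 where R0: "\<And>x. x \<in> K \<Longrightarrow> norm x \<le> R0" using K(1) compact_imp_bounded bounded_iff by metis
  \<comment> \<open>Large enough that moving back from x by R leaves the ball containing K.\<close>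
  define R where "R = norm x + \<bar>R0\<bar> + 1"
  have R: "R > 0" by (simp add: R_def add_nonneg_pos)
  have zero: "u (y (- R)) = 0"
  proof (rule K(3), rule notI)
    assume "y (- R) \<in> K"
    then have "norm (y (- R)) \<le> R0" by (rule R0)
    moreover have "norm (R *\<^sub>R axis i (1::real)) \<le> norm (y (- R)) + norm x"
      using norm_triangle_ineq4[of x "y (- R)"] by (simp add: y_def norm_minus_commute algebra_simps)
    moreover have "norm (R *\<^sub>R axis i (1::real)) = R" using R by (simp add: norm_axis_1)
    ultimately show False by (simp add: R_def)
  qed
  have y_cont: "continuous_on S y" for S unfolding y_def by (intro continuous_intros)
  have cont: "continuous_on S g'" for S
    unfolding g'_def using y_cont
    by (intro continuous_intros continuous_on_compose2[OF smooth_fun_continuous[OF sm, of UNIV]]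
        continuous_on_compose2[OF smooth_fun_continuous[OF smooth_fun_cpartial[OF sm], of UNIV]]) auto
  have der: "((\<lambda>t. (u (y t)) ^ 4) has_vector_derivative g' t) (at t within {-R..0})" for t
  proof -
    have "((\<lambda>t. u (y t)) has_real_derivative cpartial i u (y t)) (at t)"
      unfolding y_def by (rule cpartial_line[OF smooth_fun_differentiable[OF sm]])
    then have "((\<lambda>t. (u (y t)) ^ 4) has_real_derivative g' t) (at t)"
      unfolding g'_def by (auto intro!: derivative_eq_intros)
    then show ?thesis
      by (simp add: has_real_derivative_iff_has_vector_derivative has_vector_derivative_at_within)
  qed
  have "integral\<^sup>L lborel (\<lambda>t. indicator {-R..0} t *\<^sub>R g' t) = (u (y 0)) ^ 4 - (u (y (-R))) ^ 4"
    by (rule integral_FTC_atLeastAtMost) (use R der cont in auto)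
  also have "\<dots> = (u x) ^ 4" using zero by (simp add: y_def)
  finally have "ennreal ((u x) ^ 4) = ennreal (norm (integral\<^sup>L lborel (\<lambda>t. indicator {-R..0} t *\<^sub>R g' t)))"
    by simp
  also have "\<dots> \<le> (\<integral>\<^sup>+t. ennreal (norm (indicator {-R..0} t *\<^sub>R g' t)) \<partial>lborel)"
    using borel_integrable_atLeastAtMost'[OF cont] by (intro integral_norm_bound_ennreal) (simp add: set_integrable_def)
  also have "\<dots> \<le> (\<integral>\<^sup>+t. ennreal (norm (g' t)) \<partial>lborel)"
    by (intro nn_integral_mono) (auto simp: indicator_def)
  also have "\<dots> = (\<integral>\<^sup>+t. ennreal (4 * \<bar>u (\<chi> j. if j = i then t else x $ j)\<bar> ^ 3 * \<bar>cpartial i u (\<chi> j. if j = i then t else x $ j)\<bar>) \<partial>lborel)"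
    (is "_ = nn_integral lborel ?Q")
  proof -
    \<comment> \<open>\<open>y\<close> is parametrised by the increment, the statement by the
      coordinate itself; a translation by \<open>x $ i\<close> reconciles the two integrals.\<close>
    have yx: "y t = (\<chi> j. if j = i then x $ i + 1 * t else x $ j)" for t
      by (auto simp: y_def vec_eq_iff axis_def)
    have meas: "(\<lambda>t. \<chi> j. if j = i then t else x $ j) \<in> borel_measurable borel"
      by (rule measurable_vec_lambda_real) measurable
    note [measurable] = measurable_compose[OF meas smooth_fun_measurable[OF sm]]
      measurable_compose[OF meas smooth_fun_measurable[OF smooth_fun_cpartial[OF sm]]]
    have "nn_integral lborel ?Q = (\<integral>\<^sup>+t. ?Q (x $ i + 1 * t) \<partial>lborel)"
      by (subst nn_integral_real_affine[of _ 1 "x $ i"]) simp_all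
    also have "\<dots> = (\<integral>\<^sup>+t. ennreal (norm (g' t)) \<partial>lborel)"
      unfolding g'_def yx by (simp add: abs_mult power_abs)
    finally show ?thesis by simp
  qed
  finally show ?thesis .
qed

context bounded_open_set
begin

lemma nn_integral_lborel_M:
  assumes "f \<in> borel_measurable borel" "\<And>x. x \<notin> \<Omega> \<Longrightarrow> f x = 0"
  shows "(\<integral>\<^sup>+x. f x \<partial>lborel) = (\<integral>\<^sup>+x. f x \<partial>M)"
proof -
  have "(\<integral>\<^sup>+x. f x \<partial>M) = (\<integral>\<^sup>+x. f x * indicator \<Omega> x \<partial>lebesgue)"
    using \<Omega>_lebesgue by (subst nn_integral_restrict_space) auto
  also have "(\<lambda>x. f x * indicator \<Omega> x) = f" using assms(2) by (auto simp: indicator_def)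
  finally show ?thesis by (simp add: nn_integral_completion)
qed

text \<open>The Gagliardo inequality is applied to w = u^2 with q = 4 |u|^3 (|u| + sum of |d_i u|);
  the summand |u| provides the pointwise bound used in low dimension. With Y the L^2 norm of u^3 and
  S the bracket on the right, Cauchy-Schwarz bounds the integral of q by 4 Y S. Hence Y^4 \<le> (4 Y
  S)^3, and dividing by Y^3 gives the constant 64.\<close>

lemma test_fun_Sobolev:
  assumes d: "CARD('d) \<le> 3" and u: "test_fun \<Omega> u"
  shows "Lpnorm \<Omega> 2 (\<lambda>x. (u x) ^ 3) \<le> 64 * (Lpnorm \<Omega> 2 u + (\<Sum>i\<in>UNIV. Lpnorm \<Omega> 2 (cpartial i u))) ^ 3"
proof -
  note sm = test_fun_smooth[OF u]
  note [measurable] = smooth_fun_measurable[OF sm] smooth_fun_measurable[OF smooth_fun_cpartial[OF sm]]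
  define Y where "Y = Lpnorm \<Omega> 2 (\<lambda>x. (u x) ^ 3)"
  define S where "S = Lpnorm \<Omega> 2 u + (\<Sum>i\<in>UNIV. Lpnorm \<Omega> 2 (cpartial i u))"
  have Y0: "Y \<ge> 0" and S0: "S \<ge> 0" unfolding Y_def S_def by (auto intro!: add_nonneg_nonneg sum_nonneg Lpnorm_nonneg)
  define q where "q x = 4 * \<bar>u x\<bar> ^ 3 * \<bar>u x\<bar> + (\<Sum>i\<in>UNIV. 4 * \<bar>u x\<bar> ^ 3 * \<bar>cpartial i u x\<bar>)" for x
  have qm[measurable]: "q \<in> borel_measurable borel" unfolding q_def by measurable
  have q0: "q x \<ge> 0" for x unfolding q_def by (auto intro!: add_nonneg_nonneg sum_nonneg)
  have q_ge: "4 * \<bar>u x\<bar> ^ 3 * \<bar>cpartial i u x\<bar> \<le> q x" for x i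
  proof -
    have "4 * \<bar>u x\<bar> ^ 3 * \<bar>cpartial i u x\<bar> \<le> (\<Sum>i\<in>UNIV. 4 * \<bar>u x\<bar> ^ 3 * \<bar>cpartial i u x\<bar>)"
      by (rule member_le_sum) auto
    then show ?thesis unfolding q_def by (simp add: add_increasing)
  qed
  have u4: "(u x) ^ 4 = \<bar>u x\<bar> ^ 3 * \<bar>u x\<bar>" for x
    using power_even_abs[of 4 "u x"] by (simp add: power4_eq_xxxx power3_eq_cube mult.assoc)
  have sq: "(ennreal ((u x)\<^sup>2))\<^sup>2 = ennreal ((u x) ^ 4)" for x
    by (simp add: ennreal_power flip: power_mult)
  have "(\<integral>\<^sup>+x. (ennreal ((u x)\<^sup>2)) ^ 3 \<partial>lborel)\<^sup>2 \<le> (\<integral>\<^sup>+x. ennreal (q x) \<partial>lborel) ^ 3"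
  proof (rule gagliardo_vec[OF d])
    show "(ennreal ((u x)\<^sup>2))\<^sup>2 \<le> ennreal (q x)" for x
      unfolding sq u4 q_def by (intro ennreal_leI) (auto intro!: add_increasing2 sum_nonneg)
    fix x i
    have "ennreal ((u x) ^ 4) \<le> (\<integral>\<^sup>+t. ennreal (q (\<chi> j. if j = i then t else x $ j)) \<partial>lborel)"
      by (rule order_trans[OF test_fun_line_bound[OF u, of x i]]) (intro nn_integral_mono ennreal_leI q_ge)
    then show "(ennreal ((u x)\<^sup>2))\<^sup>2 \<le> (\<integral>\<^sup>+t. ennreal (q (\<chi> j. if j = i then t else x $ j)) \<partial>lborel)"
      unfolding sq .
  qed measurable
  also have "(\<integral>\<^sup>+x. (ennreal ((u x)\<^sup>2)) ^ 3 \<partial>lborel) = ennreal (Y\<^sup>2)"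
  proof -
    have t3: "Lp \<Omega> 2 (\<lambda>x. (u x) ^ 3)" by (intro test_fun_Lp test_fun_power u) auto
    have "(\<integral>\<^sup>+x. (ennreal ((u x)\<^sup>2)) ^ 3 \<partial>lborel) = (\<integral>\<^sup>+x. ennreal ((norm ((u x) ^ 3))\<^sup>2) \<partial>lborel)"
      by (intro nn_integral_cong) (simp add: ennreal_power flip: power_mult)
    also have "\<dots> = (\<integral>\<^sup>+x. ennreal ((norm ((u x) ^ 3))\<^sup>2) \<partial>M)"
      by (rule nn_integral_lborel_M) (auto simp: test_fun_zero_outside[OF u])
    also have "\<dots> = ennreal (Y\<^sup>2)"
      unfolding Y_def Lpnorm2_sq dint_def using t3 by (intro nn_integral_eq_integral) (auto simp: Lp2_iff)
    finally show ?thesis .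
  qed
  also have "(\<integral>\<^sup>+x. ennreal (q x) \<partial>lborel) \<le> ennreal (4 * Y * S)"
  proof -
    have a3: "Lp \<Omega> 2 (\<lambda>x. \<bar>u x\<bar> ^ 3)" and Ya: "Lpnorm \<Omega> 2 (\<lambda>x. \<bar>u x\<bar> ^ 3) = Y"
      using test_fun_Lp[OF test_fun_power[OF u, of 3], of 2] smooth_fun_measurable_M[OF sm]
      by (auto simp: Lp2_iff Y_def Lpnorm_def power_abs)
    have a1: "Lp \<Omega> 2 (\<lambda>x. \<bar>f x\<bar>)" "Lpnorm \<Omega> 2 (\<lambda>x. \<bar>f x\<bar>) = Lpnorm \<Omega> 2 f" if "test_fun \<Omega> f" for f
      using test_fun_Lp[OF that, of 2] by (auto simp: Lp2_iff Lpnorm_def)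
    have prod: "integrable M (\<lambda>x. \<bar>u x\<bar> ^ 3 * \<bar>f x\<bar>)" "dint \<Omega> (\<lambda>x. \<bar>u x\<bar> ^ 3 * \<bar>f x\<bar>) \<le> Y * Lpnorm \<Omega> 2 f"
      if "test_fun \<Omega> f" for f
      using L2_mult_integrable[OF a3 a1(1)[OF that]] L2_Cauchy_Schwarz_real[OF a3 a1(1)[OF that]]
      unfolding Ya a1(2)[OF that] by auto
    note pu = prod[OF u] and pd = prod[OF test_fun_cpartial[OF u]]
    have iq: "integrable M q"
      unfolding q_def mult.assoc
      by (intro Bochner_Integration.integrable_add Bochner_Integration.integrable_sum integrable_mult_right pu pd)
    have "(\<integral>\<^sup>+x. ennreal (q x) \<partial>lborel) = (\<integral>\<^sup>+x. ennreal (q x) \<partial>M)"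
      by (rule nn_integral_lborel_M) (auto simp: q_def test_fun_zero_outside[OF u])
    also have "\<dots> = ennreal (integral\<^sup>L M q)"
      using iq q0 by (intro nn_integral_eq_integral) auto
    also have "integral\<^sup>L M q = 4 * dint \<Omega> (\<lambda>x. \<bar>u x\<bar> ^ 3 * \<bar>u x\<bar>) + (\<Sum>i\<in>UNIV. 4 * dint \<Omega> (\<lambda>x. \<bar>u x\<bar> ^ 3 * \<bar>cpartial i u x\<bar>))"
      unfolding q_def dint_def mult.assoc using pu(1) pd(1)
      by (subst Bochner_Integration.integral_add) (auto intro!: Bochner_Integration.integral_sum)
    also have "\<dots> \<le> 4 * (Y * Lpnorm \<Omega> 2 u) + (\<Sum>i\<in>UNIV. 4 * (Y * Lpnorm \<Omega> 2 (cpartial i u)))"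
      by (intro add_mono sum_mono mult_left_mono pu pd) auto
    also have "\<dots> = 4 * Y * S" by (simp add: S_def algebra_simps sum_distrib_left)
    finally show ?thesis by (simp add: ennreal_leI)
  qed
  finally have "(ennreal (Y\<^sup>2))\<^sup>2 \<le> (ennreal (4 * Y * S)) ^ 3" by (simp add: power_mono)
  then have le: "(Y\<^sup>2)\<^sup>2 \<le> (4 * Y * S) ^ 3" using Y0 S0 by (simp add: ennreal_power)
  have "Y \<le> 64 * S ^ 3"
  proof (cases "Y = 0")
    case False
    then have "Y ^ 3 > 0" using Y0 by simp
    moreover have "Y ^ 3 * Y \<le> Y ^ 3 * (64 * S ^ 3)"
      using le by (simp add: power2_eq_square power3_eq_cube algebra_simps)
    ultimately show ?thesis by (simp only: mult_le_cancel_left_pos)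
  qed (use S0 in simp)
  then show ?thesis by (simp add: Y_def S_def)
qed

text \<open>Arranged so that m enters only through the distances to the limit functions: along a
  convergent sequence the right-hand side converges. The inner factor 4 is that of
  \<open>Lp_add\<close>.\<close>

lemma Lpnorm2_cube_test_bounded:
  assumes d: "CARD('d) \<le> 3" and u: "\<And>m. test_fun \<Omega> (u m)"
    and v: "Lp \<Omega> 2 v" and A: "\<And>l. Lp \<Omega> 2 (A l)"
  shows "Lpnorm \<Omega> 2 (\<lambda>x. (u m x) ^ 3) \<le> 64 * (4 * (Lpnorm \<Omega> 2 (\<lambda>x. u m x - v x) +
     (\<Sum>l\<in>UNIV. Lpnorm \<Omega> 2 (\<lambda>x. cpartial l (u m) x - A l x)) + (Lpnorm \<Omega> 2 v + (\<Sum>l\<in>UNIV. Lpnorm \<Omega> 2 (A l))))) ^ 3"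
proof -
  have tri: "Lpnorm \<Omega> 2 f \<le> 4 * (Lpnorm \<Omega> 2 (\<lambda>x. f x - g x) + Lpnorm \<Omega> 2 g)" if "Lp \<Omega> 2 f" "Lp \<Omega> 2 g" for f g :: "real^'d \<Rightarrow> real"
    using Lp_add(2)[OF Lp_diff(1)[OF that] that(2)] by simp
  have "Lpnorm \<Omega> 2 (u m) + (\<Sum>l\<in>UNIV. Lpnorm \<Omega> 2 (cpartial l (u m))) \<le>
    4 * (Lpnorm \<Omega> 2 (\<lambda>x. u m x - v x) + Lpnorm \<Omega> 2 v) +
    (\<Sum>l\<in>UNIV. 4 * (Lpnorm \<Omega> 2 (\<lambda>x. cpartial l (u m) x - A l x) + Lpnorm \<Omega> 2 (A l)))"
    by (intro add_mono sum_mono tri v A test_fun_Lp u test_fun_cpartial) auto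
  also have "\<dots> = 4 * (Lpnorm \<Omega> 2 (\<lambda>x. u m x - v x) +
     (\<Sum>l\<in>UNIV. Lpnorm \<Omega> 2 (\<lambda>x. cpartial l (u m) x - A l x)) + (Lpnorm \<Omega> 2 v + (\<Sum>l\<in>UNIV. Lpnorm \<Omega> 2 (A l))))"
    by (simp add: sum.distrib algebra_simps sum_distrib_left)
  finally have "(Lpnorm \<Omega> 2 (u m) + (\<Sum>l\<in>UNIV. Lpnorm \<Omega> 2 (cpartial l (u m)))) ^ 3 \<le> \<dots> ^ 3"
    by (intro power_mono) (auto intro!: add_nonneg_nonneg sum_nonneg Lpnorm_nonneg)
  then show ?thesis using test_fun_Sobolev[OF d u[of m]] by (meson mult_left_mono order_trans zero_le_numeral)
qed

text \<open>The L^6 bound passes to the limit by Fatou's lemma along an almost everywhere convergent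
  subsequence; L^4 follows from |v|^4 = |v| |v|^3 and Cauchy-Schwarz. Here 4096 is 64 times 4^3, and
  8 is its fourth root. The uniform bound on the cubes of the approximants is what controls the
  cubic test functions later.\<close>

lemma Sobolev_limit:
  assumes d: "CARD('d) \<le> 3" and u: "\<And>m. test_fun \<Omega> (u m)"
    and v: "Lp \<Omega> 2 v" and A: "\<And>l. Lp \<Omega> 2 (A l)"
    and lim: "(\<lambda>m::nat. Lpnorm \<Omega> 2 (\<lambda>x. u m x - v x)) \<longlonglongrightarrow> 0"
    and limd: "\<And>l. (\<lambda>m. Lpnorm \<Omega> 2 (\<lambda>x. cpartial l (u m) x - A l x)) \<longlonglongrightarrow> 0"
  defines "S \<equiv> Lpnorm \<Omega> 2 v + (\<Sum>l\<in>UNIV. Lpnorm \<Omega> 2 (A l))"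
  shows "Lp \<Omega> 4 v" "Lpnorm \<Omega> 4 v \<le> 8 * S"
    and "\<exists>B. \<forall>m. Lpnorm \<Omega> 2 (\<lambda>x. (u m x) ^ 3) \<le> B"
proof -
  have S0: "S \<ge> 0" unfolding S_def by (auto intro!: add_nonneg_nonneg sum_nonneg Lpnorm_nonneg)
  define b where "b m = 64 * (4 * (Lpnorm \<Omega> 2 (\<lambda>x. u m x - v x) +
     (\<Sum>l\<in>UNIV. Lpnorm \<Omega> 2 (\<lambda>x. cpartial l (u m) x - A l x)) + S)) ^ 3" for m
  have le: "Lpnorm \<Omega> 2 (\<lambda>x. (u m x) ^ 3) \<le> b m" for m
    unfolding b_def S_def by (rule Lpnorm2_cube_test_bounded[OF d u v A])
  have "b \<longlonglongrightarrow> 64 * (4 * (0 + (\<Sum>l\<in>(UNIV::'d set). 0) + S)) ^ 3"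
    unfolding b_def by (intro tendsto_intros lim limd)
  then have blim: "b \<longlonglongrightarrow> 4096 * S ^ 3" by (simp add: power_mult_distrib)
  then obtain B where "\<And>m. \<bar>b m\<bar> \<le> B" using convergent_imp_Bseq[of b] by (auto simp: convergent_def Bseq_def)
  then show "\<exists>B. \<forall>m. Lpnorm \<Omega> 2 (\<lambda>x. (u m x) ^ 3) \<le> B" using le by (meson abs_le_D1 order_trans)
  obtain r :: "nat \<Rightarrow> nat" where r: "strict_mono r" "AE x in M. \<forall>q::unit. (\<lambda>j. u (r j) x) \<longlonglongrightarrow> v x"
    using L2_AE_subseq[of "\<lambda>_. u" "\<lambda>_. v"] test_fun_Lp[OF u] v lim by auto
  have vm[measurable]: "v \<in> borel_measurable M" using v by (rule Lp_measurable)
  have um[measurable]: "u m \<in> borel_measurable M" for m using test_fun_Lp[OF u, of 2] by (auto intro: Lp_measurable)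
  have "(\<integral>\<^sup>+x. ennreal ((v x) ^ 6) \<partial>M) = (\<integral>\<^sup>+x. liminf (\<lambda>j. ennreal ((u (r j) x) ^ 6)) \<partial>M)"
  proof (rule nn_integral_cong_AE)
    show "AE x in M. ennreal ((v x) ^ 6) = liminf (\<lambda>j. ennreal ((u (r j) x) ^ 6))"
      using r(2)
    proof eventually_elim
      case (elim x)
      then have "(\<lambda>j. ennreal ((u (r j) x) ^ 6)) \<longlonglongrightarrow> ennreal ((v x) ^ 6)" by (auto intro!: tendsto_intros)
      then show ?case by (intro lim_imp_Liminf[symmetric]) auto
    qed
  qed
  also have "\<dots> \<le> liminf (\<lambda>j. \<integral>\<^sup>+x. ennreal ((u (r j) x) ^ 6) \<partial>M)"
    by (rule nn_integral_liminf) measurable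
  also have "\<dots> \<le> liminf (\<lambda>j. ennreal ((b (r j))\<^sup>2))"
  proof (rule Liminf_mono, rule always_eventually, rule allI)
    fix j
    have t3: "Lp \<Omega> 2 (\<lambda>x. (u (r j) x) ^ 3)" by (intro test_fun_Lp test_fun_power u) auto
    have "(\<integral>\<^sup>+x. ennreal ((u (r j) x) ^ 6) \<partial>M) = (\<integral>\<^sup>+x. ennreal ((norm ((u (r j) x) ^ 3))\<^sup>2) \<partial>M)"
      by (simp flip: power_mult)
    also have "\<dots> = ennreal ((Lpnorm \<Omega> 2 (\<lambda>x. (u (r j) x) ^ 3))\<^sup>2)"
      unfolding Lpnorm2_sq dint_def using t3 by (intro nn_integral_eq_integral) (auto simp: Lp2_iff)
    also have "\<dots> \<le> ennreal ((b (r j))\<^sup>2)" by (intro ennreal_leI power_mono le Lpnorm_nonneg)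
    finally show "(\<integral>\<^sup>+x. ennreal ((u (r j) x) ^ 6) \<partial>M) \<le> ennreal ((b (r j))\<^sup>2)" .
  qed
  also have "\<dots> = ennreal ((4096 * S ^ 3)\<^sup>2)"
  proof (rule lim_imp_Liminf)
    have "(\<lambda>j. b (r j)) \<longlonglongrightarrow> 4096 * S ^ 3" using LIMSEQ_subseq_LIMSEQ[OF blim r(1)] by (simp add: comp_def)
    then show "(\<lambda>j. ennreal ((b (r j))\<^sup>2)) \<longlonglongrightarrow> ennreal ((4096 * S ^ 3)\<^sup>2)" by (intro tendsto_intros)
  qed simp
  finally have fin: "(\<integral>\<^sup>+x. ennreal ((v x) ^ 6) \<partial>M) \<le> ennreal ((4096 * S ^ 3)\<^sup>2)" .
  have int6: "integrable M (\<lambda>x. (v x) ^ 6)"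
    by (rule integrableI_bounded) (use fin in \<open>auto intro: le_less_trans\<close>)
  then have v3: "Lp \<Omega> 2 (\<lambda>x. \<bar>v x\<bar> ^ 3)" by (auto simp: Lp2_iff power_abs simp flip: power_mult)
  have "(Lpnorm \<Omega> 2 (\<lambda>x. \<bar>v x\<bar> ^ 3))\<^sup>2 = integral\<^sup>L M (\<lambda>x. (v x) ^ 6)"
    unfolding Lpnorm2_sq dint_def by (simp add: power_abs flip: power_mult)
  also have "\<dots> \<le> (4096 * S ^ 3)\<^sup>2"
    using fin nn_integral_eq_integral[OF int6] by (simp add: ennreal_le_iff)
  finally have n3: "Lpnorm \<Omega> 2 (\<lambda>x. \<bar>v x\<bar> ^ 3) \<le> 4096 * S ^ 3" by (rule power2_le_imp_le) (use S0 in simp)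
  have va: "Lp \<Omega> 2 (\<lambda>x. \<bar>v x\<bar>)" "Lpnorm \<Omega> 2 (\<lambda>x. \<bar>v x\<bar>) = Lpnorm \<Omega> 2 v"
    using v by (auto simp: Lp2_iff Lpnorm_def)
  have v4: "norm (v x) ^ 4 = \<bar>v x\<bar> * \<bar>v x\<bar> ^ 3" for x
    by (simp add: power4_eq_xxxx power3_eq_cube mult.assoc)
  show L4: "Lp \<Omega> 4 v"
    using L2_mult_integrable[OF va(1) v3] v unfolding v4[symmetric] by (simp add: Lp_def)
  have "dint \<Omega> (\<lambda>x. norm (v x) powr 4) = dint \<Omega> (\<lambda>x. \<bar>v x\<bar> * \<bar>v x\<bar> ^ 3)"
    using v4 by simp
  also have "\<dots> \<le> Lpnorm \<Omega> 2 v * Lpnorm \<Omega> 2 (\<lambda>x. \<bar>v x\<bar> ^ 3)"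
    using L2_Cauchy_Schwarz_real[OF va(1) v3] va(2) by simp
  also have "\<dots> \<le> S * (4096 * S ^ 3)"
    by (intro mult_mono n3 Lpnorm_nonneg S0) (simp add: S_def sum_nonneg Lpnorm_nonneg)
  also have "\<dots> = (8 * S) powr 4" using S0 by (simp add: power4_eq_xxxx power3_eq_cube)
  finally have "Lpnorm \<Omega> 4 v \<le> ((8 * S) powr 4) powr (1 / 4)"
    unfolding Lpnorm_def by (intro powr_mono2) (auto simp: dint_def intro!: integral_nonneg_AE)
  also have "\<dots> = 8 * S" using S0 by (simp only: powr_powr) simp
  finally show "Lpnorm \<Omega> 4 v \<le> 8 * S" .
qed

text \<open>Partial derivatives of the approximating test functions are test functions again, and
  H^2 convergence of the latter is H^1 convergence of the former. So the Sobolev bound applies to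
  each first derivative of u although it is stated for limits of test functions only.\<close>

lemma grad_Lp4:
  assumes d: "CARD('d) \<le> 3" and u: "Hs0 \<Omega> 2 u"
  shows "Lp \<Omega> 4 (wd \<Omega> (mi_unit i) u)"
    and "m \<ge> 2 \<Longrightarrow> Lpnorm \<Omega> 4 (wd \<Omega> (mi_unit i) u) \<le> 8 * (1 + real CARD('d)) * Hnorm \<Omega> m u"
proof -
  obtain f where f: "\<And>j. test_fun \<Omega> (f j)"
    and lim: "\<And>\<alpha>. mi_ord \<alpha> \<le> 2 \<Longrightarrow> (\<lambda>j::nat. Lpnorm \<Omega> 2 (\<lambda>x. cderiv \<alpha> (f j) x - wd \<Omega> \<alpha> u x)) \<longlonglongrightarrow> 0"
    using Hs0_approx[OF u] by blast
  let ?A = "\<lambda>l. wd \<Omega> (\<lambda>k. mi_unit l k + mi_unit i k) u"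
  note wdu = Hs_wd(1)[OF Hs0_Hs[OF u]]
  have eq: "cderiv (mi_unit i) (f j) = cpartial i (f j)" "cderiv (\<lambda>k. mi_unit l k + mi_unit i k) (f j) = cpartial l (cpartial i (f j))" for l j
    by (simp_all add: cderiv_unit cderiv_unit2 test_fun_smooth[OF f])
  have l1: "(\<lambda>j. Lpnorm \<Omega> 2 (\<lambda>x. cpartial i (f j) x - wd \<Omega> (mi_unit i) u x)) \<longlonglongrightarrow> 0"
    using lim[of "mi_unit i"] by (simp add: mi_ord_unit eq)
  have l2: "(\<lambda>j. Lpnorm \<Omega> 2 (\<lambda>x. cpartial l (cpartial i (f j)) x - ?A l x)) \<longlonglongrightarrow> 0" for l
    using lim[of "\<lambda>k. mi_unit l k + mi_unit i k"] by (simp add: mi_ord_unit mi_ord_add eq)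
  have L: "Lp \<Omega> 2 (wd \<Omega> (mi_unit i) u)" "Lp \<Omega> 2 (?A l)" for l
    by (rule wdu; simp add: mi_ord_unit mi_ord_add)+
  note S = Sobolev_limit[of "\<lambda>j. cpartial i (f j)" "wd \<Omega> (mi_unit i) u" ?A, OF d test_fun_cpartial[OF f] L l1 l2]
  show "Lp \<Omega> 4 (wd \<Omega> (mi_unit i) u)" by (rule S(1))
  assume m: "m \<ge> 2"
  have "Lpnorm \<Omega> 2 (wd \<Omega> (mi_unit i) u) + (\<Sum>l\<in>UNIV. Lpnorm \<Omega> 2 (?A l)) \<le> Hnorm \<Omega> m u + (\<Sum>l\<in>(UNIV::'d set). Hnorm \<Omega> m u)"
    using m by (intro add_mono sum_mono Lpnorm_wd_le_Hnorm) (auto simp: mi_ord_unit mi_ord_add)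
  then show "Lpnorm \<Omega> 4 (wd \<Omega> (mi_unit i) u) \<le> 8 * (1 + real CARD('d)) * Hnorm \<Omega> m u"
    using S(2) by (simp add: algebra_simps)
qed

lemma wgrad_Lp4:
  assumes d: "CARD('d) \<le> 3" and u: "Hs0 \<Omega> 2 u"
  shows "Lp \<Omega> 4 (wgrad \<Omega> u)"
    and "\<exists>C\<ge>0. \<forall>u. Hs0 \<Omega> 2 u \<longrightarrow> Lpnorm \<Omega> 4 (wgrad \<Omega> u) \<le> C * Hnorm \<Omega> 3 u"
proof -
  show "Lp \<Omega> 4 (wgrad \<Omega> u)" unfolding wgrad_def by (rule Lp_vec(1)[OF grad_Lp4(1)[OF d u]]) simp
  let ?d = "real CARD('d)"
  have "Lpnorm \<Omega> 4 (wgrad \<Omega> u) \<le> (?d\<^sup>2 * (\<Sum>i\<in>(UNIV::'d set). 8 * (1 + ?d))) * Hnorm \<Omega> 3 u" if u: "Hs0 \<Omega> 2 u" for u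
  proof -
    have "Lpnorm \<Omega> 4 (wgrad \<Omega> u) \<le> ?d\<^sup>2 * (\<Sum>i\<in>UNIV. Lpnorm \<Omega> 4 (wd \<Omega> (mi_unit i) u))"
      unfolding wgrad_def by (rule Lp_vec(2)[OF grad_Lp4(1)[OF d u]]) simp
    also have "\<dots> \<le> ?d\<^sup>2 * (\<Sum>i\<in>(UNIV::'d set). 8 * (1 + ?d) * Hnorm \<Omega> 3 u)"
      by (intro mult_left_mono sum_mono grad_Lp4(2)[OF d u]) auto
    finally show ?thesis by (simp add: mult.assoc)
  qed
  then show "\<exists>C\<ge>0. \<forall>u. Hs0 \<Omega> 2 u \<longrightarrow> Lpnorm \<Omega> 4 (wgrad \<Omega> u) \<le> C * Hnorm \<Omega> 3 u"
    by (intro exI[of _ "?d\<^sup>2 * (\<Sum>i\<in>(UNIV::'d set). 8 * (1 + ?d))"]) auto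
qed

end

section \<open>Square integrability of the product of gradient and Hessian\<close>

text \<open>The derivative of \<open>u\<^sub>q N / (1 + \<epsilon> N)\<close>, \<open>N = \<Sum> u\<^sub>p\<^sup>2\<close>, is linear in the derivatives of the \<open>u\<^sub>p\<close>, with
  coefficients bounded by \<open>3 / \<epsilon>\<close>.\<close>
definition trunc_coeff :: "real \<Rightarrow> ('q::finite \<Rightarrow> real) \<Rightarrow> 'q \<Rightarrow> 'q \<Rightarrow> real" where
  "trunc_coeff \<epsilon> a q p = (if p = q then (\<Sum>s\<in>UNIV. (a s)\<^sup>2) * inverse (1 + \<epsilon> * (\<Sum>s\<in>UNIV. (a s)\<^sup>2)) else 0)
     + 2 * a q * a p * (inverse (1 + \<epsilon> * (\<Sum>s\<in>UNIV. (a s)\<^sup>2)))\<^sup>2"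

text \<open>With N the sum of squares and J = 1/(1 + \<epsilon> N) one has N J \<le> 1/\<epsilon>,
  which bounds the diagonal part. In the other part 2 |a_q a_p| \<le> 2 N; of the factor J^2, one J
  is spent on N and the other is at most 1.\<close>

lemma trunc_coeff_bound:
  assumes "\<epsilon> > 0"
  shows "\<bar>trunc_coeff \<epsilon> a q p\<bar> \<le> 3 / \<epsilon>"
proof -
  define N where "N = (\<Sum>s\<in>UNIV. (a s)\<^sup>2)"
  define J where "J = inverse (1 + \<epsilon> * N)"
  have N0: "N \<ge> 0" by (simp add: N_def sum_nonneg)
  then have pos: "1 + \<epsilon> * N > 0" using assms by (simp add: add_pos_nonneg)
  have J: "0 < J" "J \<le> 1" using pos N0 assms by (auto simp: J_def inverse_le_1_iff)
  have NJ: "N * J \<le> 1 / \<epsilon>" "0 \<le> N * J" using pos N0 assms J by (auto simp: J_def field_simps)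
  have ap: "(a s)\<^sup>2 \<le> N" for s unfolding N_def by (rule member_le_sum) auto
  have "2 * \<bar>a q * a p\<bar> \<le> (a q)\<^sup>2 + (a p)\<^sup>2"
    using sum_squares_bound[of "\<bar>a q\<bar>" "\<bar>a p\<bar>"] by (simp add: abs_mult)
  also have "\<dots> \<le> 2 * N" using ap[of q] ap[of p] by simp
  finally have "\<bar>2 * a q * a p\<bar> \<le> 2 * N" by (simp add: abs_mult)
  then have "\<bar>2 * a q * a p * J\<^sup>2\<bar> \<le> 2 * N * J\<^sup>2" by (simp add: abs_mult mult_right_mono)
  also have "\<dots> = 2 * (N * J) * J" by (simp add: power2_eq_square)
  also have "\<dots> \<le> 2 * (N * J) * 1" using J NJ by (intro mult_left_mono) auto
  also have "\<dots> \<le> 2 / \<epsilon>" using NJ by simp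
  finally have 1: "\<bar>2 * a q * a p * J\<^sup>2\<bar> \<le> 2 / \<epsilon>" .
  have 2: "\<bar>if p = q then N * J else 0\<bar> \<le> 1 / \<epsilon>" using NJ assms by auto
  have "trunc_coeff \<epsilon> a q p = (if p = q then N * J else 0) + 2 * a q * a p * J\<^sup>2"
    by (simp add: trunc_coeff_def N_def J_def)
  then have "\<bar>trunc_coeff \<epsilon> a q p\<bar> \<le> 1 / \<epsilon> + 2 / \<epsilon>"
    using 1 2 by (metis abs_triangle_ineq add_mono order_trans)
  then show ?thesis by (simp add: add_divide_distrib[symmetric])
qed

lemma trunc_coeff_form:
  assumes "\<epsilon> \<ge> 0"
  shows "(\<Sum>s\<in>UNIV. (a s)\<^sup>2) * inverse (1 + \<epsilon> * (\<Sum>s\<in>UNIV. (a s)\<^sup>2)) * (\<Sum>q\<in>UNIV. (A q)\<^sup>2)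
    \<le> (\<Sum>q\<in>UNIV. \<Sum>p\<in>UNIV. A q * (trunc_coeff \<epsilon> a q p * A p))"
proof -
  define N where "N = (\<Sum>s\<in>UNIV. (a s)\<^sup>2)"
  define J where "J = inverse (1 + \<epsilon> * N)"
  have "(\<Sum>q\<in>UNIV. \<Sum>p\<in>UNIV. A q * (trunc_coeff \<epsilon> a q p * A p))
    = (\<Sum>q\<in>UNIV. \<Sum>p\<in>UNIV. (if p = q then N * J * (A q)\<^sup>2 else 0) + 2 * J\<^sup>2 * ((a q * A q) * (a p * A p)))"
    by (intro sum.cong refl) (simp add: trunc_coeff_def N_def J_def algebra_simps power2_eq_square)
  also have "\<dots> = N * J * (\<Sum>q\<in>UNIV. (A q)\<^sup>2) + 2 * J\<^sup>2 * ((\<Sum>q\<in>UNIV. a q * A q) * (\<Sum>p\<in>UNIV. a p * A p))"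
  proof -
    have "(\<Sum>q\<in>UNIV. \<Sum>p\<in>UNIV. 2 * J\<^sup>2 * ((a q * A q) * (a p * A p))) = 2 * J\<^sup>2 * ((\<Sum>q\<in>UNIV. a q * A q) * (\<Sum>p\<in>UNIV. a p * A p))"
      by (subst sum_product) (simp only: sum_distrib_left)
    moreover have "(\<Sum>q\<in>UNIV. \<Sum>p\<in>UNIV. if p = q then N * J * (A q)\<^sup>2 else 0) = N * J * (\<Sum>q\<in>UNIV. (A q)\<^sup>2)"
      by (simp add: sum_distrib_left)
    ultimately show ?thesis by (simp only: sum.distrib)
  qed
  also have "\<dots> \<ge> N * J * (\<Sum>q\<in>UNIV. (A q)\<^sup>2)" by simp
  finally show ?thesis by (simp add: N_def J_def)
qed

lemma smooth_fun_trunc: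
  assumes u: "\<And>q::'q::finite. smooth_fun (u q)" and "\<epsilon> \<ge> 0"
  shows "smooth_fun (\<lambda>x. (\<Sum>s\<in>UNIV. (u s x)\<^sup>2) * inverse (1 + \<epsilon> * (\<Sum>s\<in>UNIV. (u s x)\<^sup>2)))"
proof -
  have "smooth_fun (\<lambda>x. \<Sum>s\<in>UNIV. (u s x)\<^sup>2)" by (intro smooth_fun_sum smooth_fun_power u) simp
  note N = this
  have "smooth_fun (\<lambda>x. 1 + \<epsilon> * (\<Sum>s\<in>UNIV. (u s x)\<^sup>2))"
    by (rule smooth_fun_add[OF smooth_fun_const smooth_fun_mult[OF smooth_fun_const N]])
  moreover have "1 + \<epsilon> * (\<Sum>s\<in>UNIV. (u s x)\<^sup>2) \<noteq> 0" for x
  proof -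
    have "0 \<le> \<epsilon> * (\<Sum>s\<in>UNIV. (u s x)\<^sup>2)" using assms(2) by (intro mult_nonneg_nonneg sum_nonneg) auto
    then show ?thesis by linarith
  qed
  ultimately show ?thesis by (intro smooth_fun_mult[OF N] smooth_fun_inverse) auto
qed

lemma cpartial_trunc:
  assumes u: "\<And>q::'q::finite. smooth_fun (u q)" and e: "\<epsilon> \<ge> 0"
  shows "cpartial l (\<lambda>x. u q x * ((\<Sum>s\<in>UNIV. (u s x)\<^sup>2) * inverse (1 + \<epsilon> * (\<Sum>s\<in>UNIV. (u s x)\<^sup>2)))) x
    = (\<Sum>p\<in>UNIV. trunc_coeff \<epsilon> (\<lambda>s. u s x) q p * cpartial l (u p) x)"
proof -
  define D where "D s = frechet_derivative (u s) (at x)" for s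
  have uD: "(u s has_derivative D s) (at x)" for s
    unfolding D_def frechet_derivative_works[symmetric] by (rule smooth_fun_differentiable[OF u])
  define N where "N = (\<Sum>s\<in>UNIV. (u s x)\<^sup>2)"
  define J where "J = inverse (1 + \<epsilon> * N)"
  define DN where "DN v = (\<Sum>s\<in>UNIV. 2 * u s x * D s v)" for v
  have ND: "((\<lambda>x. \<Sum>s\<in>UNIV. (u s x)\<^sup>2) has_derivative DN) (at x)"
    unfolding DN_def power2_eq_square by (auto intro!: derivative_eq_intros uD simp: algebra_simps sum.distrib)
  have nz: "1 + \<epsilon> * N \<noteq> 0"
  proof -
    have "0 \<le> \<epsilon> * N" unfolding N_def using e by (intro mult_nonneg_nonneg sum_nonneg) auto
    then show ?thesis by linarith
  qed
  have JD: "((\<lambda>x. inverse (1 + \<epsilon> * (\<Sum>s\<in>UNIV. (u s x)\<^sup>2))) has_derivative (\<lambda>v. - (J * (\<epsilon> * DN v) * J))) (at x)"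
  proof -
    have "((\<lambda>x. 1 + \<epsilon> * (\<Sum>s\<in>UNIV. (u s x)\<^sup>2)) has_derivative (\<lambda>v. 0 + \<epsilon> * DN v)) (at x)"
      by (intro has_derivative_add has_derivative_const has_derivative_mult_right ND)
    from Deriv.has_derivative_inverse[OF _ this] show ?thesis
      using nz by (simp add: J_def N_def)
  qed
  have FD: "((\<lambda>x. (\<Sum>s\<in>UNIV. (u s x)\<^sup>2) * inverse (1 + \<epsilon> * (\<Sum>s\<in>UNIV. (u s x)\<^sup>2))) has_derivative
     (\<lambda>v. N * (- (J * (\<epsilon> * DN v) * J)) + DN v * J)) (at x)"
    using has_derivative_mult[OF ND JD] by (simp add: N_def J_def)
  have "cpartial l (\<lambda>x. u q x * ((\<Sum>s\<in>UNIV. (u s x)\<^sup>2) * inverse (1 + \<epsilon> * (\<Sum>s\<in>UNIV. (u s x)\<^sup>2)))) x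
    = u q x * (N * (- (J * (\<epsilon> * DN (axis l 1)) * J)) + DN (axis l 1) * J) + D q (axis l 1) * (N * J)"
    by (subst cpartial_eqI[OF has_derivative_mult[OF uD FD]]) (simp add: N_def J_def)
  \<comment> \<open>The two terms of the quotient rule merge: J - \<epsilon> N J^2 = J^2, since J (1
    + \<epsilon> N) = 1.\<close>
  also have "N * (- (J * (\<epsilon> * DN (axis l 1)) * J)) + DN (axis l 1) * J = DN (axis l 1) * J\<^sup>2"
  proof -
    have "J = J\<^sup>2 * (1 + \<epsilon> * N)" using nz by (simp add: J_def power2_eq_square)
    then have "DN (axis l 1) * J = DN (axis l 1) * (J\<^sup>2 * (1 + \<epsilon> * N))" by simp
    then show ?thesis by (simp add: power2_eq_square algebra_simps)
  qed
  also have "u q x * (DN (axis l 1) * J\<^sup>2) + D q (axis l 1) * (N * J) =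
     (\<Sum>p\<in>UNIV. (if p = q then N * J * D p (axis l 1) else 0) + 2 * u q x * u p x * J\<^sup>2 * D p (axis l 1))"
    by (simp add: DN_def sum.distrib sum_distrib_left sum_distrib_right ac_simps)
  also have "\<dots> = (\<Sum>p\<in>UNIV. trunc_coeff \<epsilon> (\<lambda>s. u s x) q p * D p (axis l 1))"
    by (intro sum.cong refl) (simp add: trunc_coeff_def N_def J_def algebra_simps)
  finally show ?thesis
    by (simp add: D_def cpartial_frechet(1)[OF smooth_fun_differentiable[OF u]])
qed

text \<open>The damping factor is at most 1, and |a_q| a_p^2 is at most the cube of the larger of
  the two. The bound is free of \<epsilon>, in contrast to the one for the derivative.\<close>

lemma trunc_cube_bound:
  fixes a :: "'q::finite \<Rightarrow> real"
  assumes "\<epsilon> \<ge> 0"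
  shows "\<bar>a q * ((\<Sum>s\<in>UNIV. (a s)\<^sup>2) * inverse (1 + \<epsilon> * (\<Sum>s\<in>UNIV. (a s)\<^sup>2)))\<bar> \<le> (1 + real CARD('q)) * (\<Sum>p\<in>UNIV. \<bar>(a p) ^ 3\<bar>)"
proof -
  define N where "N = (\<Sum>s\<in>UNIV. (a s)\<^sup>2)"
  have N0: "N \<ge> 0" by (simp add: N_def sum_nonneg)
  have "0 \<le> \<epsilon> * N" using N0 assms by simp
  then have J: "0 \<le> inverse (1 + \<epsilon> * N)" "inverse (1 + \<epsilon> * N) \<le> 1" by (simp_all add: inverse_le_1_iff)
  have c: "\<bar>a q\<bar> * (a p)\<^sup>2 \<le> \<bar>a q\<bar> ^ 3 + \<bar>a p\<bar> ^ 3" for p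
  proof (cases "\<bar>a q\<bar> \<le> \<bar>a p\<bar>")
    case True
    then have "\<bar>a q\<bar> * (a p)\<^sup>2 \<le> \<bar>a p\<bar> * (a p)\<^sup>2" by (intro mult_right_mono) auto
    also have "\<dots> = \<bar>a p\<bar> ^ 3" by (simp add: power3_eq_cube power2_eq_square)
    finally show ?thesis by (simp add: add_increasing)
  next
    case False
    then have "(a p)\<^sup>2 \<le> (a q)\<^sup>2" by (simp add: abs_le_square_iff[symmetric])
    then have "\<bar>a q\<bar> * (a p)\<^sup>2 \<le> \<bar>a q\<bar> * (a q)\<^sup>2" by (intro mult_left_mono) auto
    also have "\<dots> = \<bar>a q\<bar> ^ 3" by (simp add: power3_eq_cube power2_eq_square)
    finally show ?thesis by (simp add: add_increasing2)
  qed
  have "\<bar>a q * (N * inverse (1 + \<epsilon> * N))\<bar> = \<bar>a q\<bar> * N * inverse (1 + \<epsilon> * N)"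
    using N0 J by (simp add: abs_mult)
  also have "\<dots> \<le> \<bar>a q\<bar> * N * 1" using N0 J by (intro mult_left_mono) auto
  also have "\<dots> = (\<Sum>p\<in>UNIV. \<bar>a q\<bar> * (a p)\<^sup>2)" by (simp add: N_def sum_distrib_left)
  also have "\<dots> \<le> (\<Sum>p\<in>UNIV. \<bar>a q\<bar> ^ 3 + \<bar>a p\<bar> ^ 3)" by (intro sum_mono c)
  also have "\<dots> = real CARD('q) * \<bar>a q\<bar> ^ 3 + (\<Sum>p\<in>UNIV. \<bar>a p\<bar> ^ 3)" by (simp add: sum.distrib)
  also have "\<dots> \<le> real CARD('q) * (\<Sum>p\<in>UNIV. \<bar>a p\<bar> ^ 3) + (\<Sum>p\<in>UNIV. \<bar>a p\<bar> ^ 3)"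
    by (intro add_mono mult_left_mono member_le_sum) auto
  finally show ?thesis by (simp add: N_def power_abs algebra_simps)
qed

context bounded_open_set
begin

text \<open>Writing bm = b + (bm - b), the first part converges by dominated convergence and the
  second by Cauchy-Schwarz. Both use the uniform bound on the coefficients, which is the reason for
  truncating.\<close>

lemma dint_coeff_tendsto:
  fixes g b :: "real^'d \<Rightarrow> real"
  assumes g: "Lp \<Omega> 2 g" and b: "Lp \<Omega> 2 b" and bm: "\<And>m. Lp \<Omega> 2 (bm m)"
    and lim: "(\<lambda>m::nat. Lpnorm \<Omega> 2 (\<lambda>x. bm m x - b x)) \<longlonglongrightarrow> 0"
    and cm[measurable]: "\<And>m. cm m \<in> borel_measurable M" and c[measurable]: "c \<in> borel_measurable M"
    and bound: "\<And>m x. \<bar>cm m x\<bar> \<le> B" and AE: "AE x in M. (\<lambda>m. cm m x) \<longlonglongrightarrow> c x"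
  shows "(\<lambda>m. dint \<Omega> (\<lambda>x. g x * (cm m x * bm m x))) \<longlonglongrightarrow> dint \<Omega> (\<lambda>x. g x * (c x * b x))"
    and "integrable M (\<lambda>x. g x * (c x * b x))" and "integrable M (\<lambda>x. g x * (cm m x * bm m x))"
proof -
  have [measurable]: "g \<in> borel_measurable M" "b \<in> borel_measurable M" "bm m \<in> borel_measurable M" for m
    using g b bm by (auto intro: Lp_measurable)
  have B0: "B \<ge> 0" using bound[of 0 undefined] by linarith
  have cB: "AE x in M. \<bar>c x\<bar> \<le> B"
    using AE by eventually_elim (rule LIMSEQ_le_const2[OF tendsto_rabs], auto simp: bound)
  have gb: "integrable M (\<lambda>x. g x * b x)" by (rule L2_mult_integrable[OF g b])
  have cgb: "Lp \<Omega> 2 (\<lambda>x. c x * b x)"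
  proof (rule Lp_le(1)[OF b])
    show "AE x in M. norm (c x * b x) \<le> B * norm (b x)"
      using cB by eventually_elim (simp add: abs_mult mult_right_mono)
  qed (use B0 in auto)
  then show "integrable M (\<lambda>x. g x * (c x * b x))" by (rule L2_mult_integrable[OF g])
  have cmL: "Lp \<Omega> 2 (\<lambda>x. cm m x * f x)" "Lpnorm \<Omega> 2 (\<lambda>x. cm m x * f x) \<le> B * Lpnorm \<Omega> 2 f"
    if f: "Lp \<Omega> 2 f" for m and f :: "real^'d \<Rightarrow> real"
  proof -
    have [measurable]: "f \<in> borel_measurable M" using f by (rule Lp_measurable)
    have le: "AE x in M. norm (cm m x * f x) \<le> B * norm (f x)"
      using bound by (auto intro!: AE_I2 mult_right_mono simp: abs_mult)
    show "Lp \<Omega> 2 (\<lambda>x. cm m x * f x)" "Lpnorm \<Omega> 2 (\<lambda>x. cm m x * f x) \<le> B * Lpnorm \<Omega> 2 f"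
      using Lp_le[OF f _ le B0] by auto
  qed
  show "integrable M (\<lambda>x. g x * (cm m x * bm m x))" by (intro L2_mult_integrable g cmL bm)
  have 1: "(\<lambda>m. dint \<Omega> (\<lambda>x. g x * (cm m x * b x))) \<longlonglongrightarrow> dint \<Omega> (\<lambda>x. g x * (c x * b x))"
    unfolding dint_def
  proof (rule integral_dominated_convergence[where w="\<lambda>x. B * norm (g x * b x)"])
    show "integrable M (\<lambda>x. B * norm (g x * b x))" using gb by auto
    show "AE x in M. (\<lambda>m. g x * (cm m x * b x)) \<longlonglongrightarrow> g x * (c x * b x)"
      using AE by eventually_elim (intro tendsto_intros)
    show "AE x in M. norm (g x * (cm m x * b x)) \<le> B * norm (g x * b x)" for m
    proof (rule AE_I2)
      fix x
      have "\<bar>cm m x\<bar> * \<bar>g x * b x\<bar> \<le> B * \<bar>g x * b x\<bar>" by (intro mult_right_mono bound) auto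
      then show "norm (g x * (cm m x * b x)) \<le> B * norm (g x * b x)" by (simp add: abs_mult ac_simps)
    qed
  qed measurable
  have diff: "Lp \<Omega> 2 (\<lambda>x. bm m x - b x)" for m by (rule Lp_diff(1)[OF bm b]) simp
  have 2: "(\<lambda>m. dint \<Omega> (\<lambda>x. g x * (cm m x * (bm m x - b x)))) \<longlonglongrightarrow> 0"
  proof (rule Lim_null_comparison)
    show "\<forall>\<^sub>F m in sequentially. norm (dint \<Omega> (\<lambda>x. g x * (cm m x * (bm m x - b x)))) \<le> Lpnorm \<Omega> 2 g * (B * Lpnorm \<Omega> 2 (\<lambda>x. bm m x - b x))"
    proof (rule always_eventually, rule allI)
      fix m
      have "\<bar>dint \<Omega> (\<lambda>x. g x * (cm m x * (bm m x - b x)))\<bar> \<le> Lpnorm \<Omega> 2 g * Lpnorm \<Omega> 2 (\<lambda>x. cm m x * (bm m x - b x))"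
        by (rule L2_Cauchy_Schwarz_real[OF g cmL(1)[OF diff]])
      also have "\<dots> \<le> Lpnorm \<Omega> 2 g * (B * Lpnorm \<Omega> 2 (\<lambda>x. bm m x - b x))"
        by (intro mult_left_mono cmL(2)[OF diff] Lpnorm_nonneg)
      finally show "norm (dint \<Omega> (\<lambda>x. g x * (cm m x * (bm m x - b x)))) \<le> Lpnorm \<Omega> 2 g * (B * Lpnorm \<Omega> 2 (\<lambda>x. bm m x - b x))" by simp
    qed
    have "(\<lambda>m. Lpnorm \<Omega> 2 g * (B * Lpnorm \<Omega> 2 (\<lambda>x. bm m x - b x))) \<longlonglongrightarrow> Lpnorm \<Omega> 2 g * (B * 0)"
      by (intro tendsto_intros lim)
    then show "(\<lambda>m. Lpnorm \<Omega> 2 g * (B * Lpnorm \<Omega> 2 (\<lambda>x. bm m x - b x))) \<longlonglongrightarrow> 0" by simp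
  qed
  have "dint \<Omega> (\<lambda>x. g x * (cm m x * bm m x)) = dint \<Omega> (\<lambda>x. g x * (cm m x * b x)) + dint \<Omega> (\<lambda>x. g x * (cm m x * (bm m x - b x)))" for m
    unfolding dint_def
      Bochner_Integration.integral_add[OF L2_mult_integrable[OF g cmL(1)[OF b]] L2_mult_integrable[OF g cmL(1)[OF diff]], symmetric]
    by (simp add: algebra_simps)
  then show "(\<lambda>m. dint \<Omega> (\<lambda>x. g x * (cm m x * bm m x))) \<longlonglongrightarrow> dint \<Omega> (\<lambda>x. g x * (c x * b x))"
    using tendsto_add[OF 1 2] by simp
qed

text \<open>Testing the weak derivatives of \<open>\<partial>\<^sub>l v\<^sub>q\<close> with \<open>v\<^sub>q |v|\<^sup>2 / (1 + \<epsilon> |v|\<^sup>2)\<close> bounds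
  \<open>\<integral> |v|\<^sup>2 / (1 + \<epsilon> |v|\<^sup>2) |\<partial>\<^sub>l v|\<^sup>2\<close> by the \<open>L\<^sup>6\<close> norm of \<open>v\<close>, uniformly in \<open>\<epsilon>\<close>: the second term of the
  product rule is a square, hence can be dropped. No regularity of the boundary is needed since \<open>v\<close> vanishes there.\<close>
lemma product_L2:
  fixes u :: "'q::finite \<Rightarrow> nat \<Rightarrow> real^'d \<Rightarrow> real"
  assumes d: "CARD('d) \<le> 3" and u: "\<And>q m. test_fun \<Omega> (u q m)"
    and v: "\<And>q. Lp \<Omega> 2 (v q)" and A: "\<And>q l. Lp \<Omega> 2 (A q l)" and D: "\<And>q l. Lp \<Omega> 2 (D q l)"
    and AD: "\<And>q l. is_weak_deriv \<Omega> (mi_unit l) (A q l) (D q l)"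
    and lim: "\<And>q. (\<lambda>m. Lpnorm \<Omega> 2 (\<lambda>x. u q m x - v q x)) \<longlonglongrightarrow> 0"
    and limd: "\<And>q l. (\<lambda>m. Lpnorm \<Omega> 2 (\<lambda>x. cpartial l (u q m) x - A q l x)) \<longlonglongrightarrow> 0"
  shows "integrable M (\<lambda>x. (\<Sum>s\<in>UNIV. (v s x)\<^sup>2) * (\<Sum>q\<in>UNIV. (A q l x)\<^sup>2))"
proof -
  have uL: "Lp \<Omega> 2 (u q m)" for q m by (rule test_fun_Lp[OF u]) simp
  \<comment> \<open>The coefficients are nonlinear in the functions themselves, so these have to
    converge almost everywhere, simultaneously for all q.\<close>
  obtain r :: "nat \<Rightarrow> nat" where r: "strict_mono r" "AE x in M. \<forall>q. (\<lambda>j. u q (r j) x) \<longlonglongrightarrow> v q x"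
    by (rule L2_AE_subseq[OF uL v lim])
  define w where "w q m = u q (r m)" for q m
  have w: "test_fun \<Omega> (w q m)" for q m by (simp add: w_def u)
  have wlim: "(\<lambda>m. Lpnorm \<Omega> 2 (\<lambda>x. cpartial l (w q m) x - A q l x)) \<longlonglongrightarrow> 0" for q
    using LIMSEQ_subseq_LIMSEQ[OF limd r(1)] by (simp add: w_def comp_def)
  have [measurable]: "v q \<in> borel_measurable M" "A q l \<in> borel_measurable M" "w q m \<in> borel_measurable M" for q m
    by (rule Lp_measurable[OF v], rule Lp_measurable[OF A], rule smooth_fun_measurable_M[OF test_fun_smooth[OF w]])
  have [measurable]: "cpartial l (w q m) \<in> borel_measurable M" for q m
    by (rule smooth_fun_measurable_M[OF test_fun_smooth[OF test_fun_cpartial[OF w]]])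
  have "\<exists>B. \<forall>m. Lpnorm \<Omega> 2 (\<lambda>x. (u q m x) ^ 3) \<le> B" for q
    by (rule Sobolev_limit(3)[OF d u v A lim limd])
  then obtain B where B: "\<And>q m. Lpnorm \<Omega> 2 (\<lambda>x. (u q m x) ^ 3) \<le> B q" by metis
  define n where "n = real CARD('q)"
  \<comment> \<open>Norm of the third derivative times a bound for the test function: 1 + n comes
    from \<open>trunc_cube_bound\<close>, n^2 from \<open>Lp_dominated\<close>, and B q bounds the
    cubes. There is no \<epsilon> in it.\<close>
  define K1 where "K1 = (\<Sum>q\<in>(UNIV::'q set). Lpnorm \<Omega> 2 (D q l) * ((1 + n) * n\<^sup>2 * (\<Sum>q\<in>UNIV. B q)))"
  define F where "F \<epsilon> x = (\<Sum>s\<in>UNIV. (v s x)\<^sup>2) * inverse (1 + \<epsilon> * (\<Sum>s\<in>UNIV. (v s x)\<^sup>2))" for \<epsilon> x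
  have N0: "0 \<le> (\<Sum>s\<in>UNIV. (v s x)\<^sup>2)" for x by (simp add: sum_nonneg)
  have F0: "0 \<le> F \<epsilon> x" if "\<epsilon> \<ge> 0" for \<epsilon> x
    unfolding F_def using N0[of x] that by (intro mult_nonneg_nonneg) (auto intro!: add_nonneg_nonneg)
  have key: "(\<integral>\<^sup>+x. ennreal (F \<epsilon> x * (\<Sum>q\<in>UNIV. (A q l x)\<^sup>2)) \<partial>M) \<le> ennreal K1" if e: "\<epsilon> > 0" for \<epsilon>
  proof -
    define c where "c q p x = trunc_coeff \<epsilon> (\<lambda>s. v s x) q p" for q p x
    define cm where "cm q p m x = trunc_coeff \<epsilon> (\<lambda>s. w s m x) q p" for q p m x
    \<comment> \<open>Built from the approximants rather than from v: for each \<epsilon> this is a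
      genuine test function, so the weak derivative identity applies directly and only its left-hand
      side has to pass to the limit.\<close>
    define \<phi> where "\<phi> q m x = w q m x * ((\<Sum>s\<in>UNIV. (w s m x)\<^sup>2) * inverse (1 + \<epsilon> * (\<Sum>s\<in>UNIV. (w s m x)\<^sup>2)))" for q m x
    have \<phi>: "test_fun \<Omega> (\<phi> q m)" for q m
      unfolding \<phi>_def by (rule test_fun_mult[OF w smooth_fun_trunc[OF test_fun_smooth[OF w]]]) (use e in simp)
    have \<phi>L: "Lp \<Omega> 2 (\<phi> q m)" for q m by (rule test_fun_Lp[OF \<phi>]) simp
    have \<phi>': "cpartial l (\<phi> q m) x = (\<Sum>p\<in>UNIV. cm q p m x * cpartial l (w p m) x)" for q m x
      unfolding \<phi>_def cm_def
      by (rule cpartial_trunc[of "\<lambda>q. w q m" \<epsilon> l q x, OF test_fun_smooth[OF w]]) (use e in simp)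
    have cmm: "cm q p m \<in> borel_measurable M" for q p m unfolding cm_def trunc_coeff_def by measurable
    have cmeas: "c q p \<in> borel_measurable M" for q p unfolding c_def trunc_coeff_def by measurable
    have cb: "\<bar>cm q p m x\<bar> \<le> 3 / \<epsilon>" for q p m x unfolding cm_def by (rule trunc_coeff_bound[OF e])
    have cl: "AE x in M. (\<lambda>m. cm q p m x) \<longlonglongrightarrow> c q p x" for q p
      using r(2)
    proof eventually_elim
      case (elim x)
      then have wl: "(\<lambda>m. w s m x) \<longlonglongrightarrow> v s x" for s by (simp add: w_def)
      have nz: "1 + \<epsilon> * (\<Sum>s\<in>UNIV. (v s x)\<^sup>2) \<noteq> 0"
        using N0[of x] e by (metis add_nonneg_eq_0_iff less_imp_le mult_nonneg_nonneg zero_le_one zero_neq_one)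
      show ?case unfolding cm_def c_def trunc_coeff_def
        by (cases "p = q") (auto intro!: tendsto_intros wl nz)
    qed
    have wdL: "Lp \<Omega> 2 (cpartial l (w p m))" for p m by (rule test_fun_Lp[OF test_fun_cpartial[OF w]]) simp
    note T = dint_coeff_tendsto[OF A A wdL wlim cmm cmeas cb cl]
    let ?L = "\<lambda>m. \<Sum>q\<in>UNIV. \<Sum>p\<in>UNIV. dint \<Omega> (\<lambda>x. A q l x * (cm q p m x * cpartial l (w p m) x))"
    have Llim: "?L \<longlonglongrightarrow> (\<Sum>q\<in>UNIV. \<Sum>p\<in>UNIV. dint \<Omega> (\<lambda>x. A q l x * (c q p x * A p l x)))"
      by (intro tendsto_sum T(1))
    have Lle: "?L m \<le> K1" for m
    proof -
      have "(\<Sum>p\<in>UNIV. dint \<Omega> (\<lambda>x. A q l x * (cm q p m x * cpartial l (w p m) x))) \<le> Lpnorm \<Omega> 2 (D q l) * ((1 + n) * n\<^sup>2 * (\<Sum>q\<in>UNIV. B q))" for q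
      proof -
        have "(\<Sum>p\<in>UNIV. dint \<Omega> (\<lambda>x. A q l x * (cm q p m x * cpartial l (w p m) x))) = dint \<Omega> (\<lambda>x. A q l x * cpartial l (\<phi> q m) x)"
          unfolding \<phi>' dint_def sum_distrib_left
          by (rule Bochner_Integration.integral_sum[symmetric]) (rule T(3))
        also have "\<dots> = - dint \<Omega> (\<lambda>x. D q l x * \<phi> q m x)"
          using is_weak_derivD[OF AD[of l q] \<phi>[of q m]] by (simp add: mi_ord_unit cderiv_unit test_fun_smooth[OF \<phi>])
        also have "\<dots> \<le> Lpnorm \<Omega> 2 (D q l) * Lpnorm \<Omega> 2 (\<phi> q m)"
          using L2_Cauchy_Schwarz_real[OF D[of q l] \<phi>L[of q m]] by linarith
        also have "Lpnorm \<Omega> 2 (\<phi> q m) \<le> (1 + n) * n\<^sup>2 * (\<Sum>p\<in>UNIV. Lpnorm \<Omega> 2 (\<lambda>x. (w p m x) ^ 3))"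
          unfolding n_def
        proof (rule Lp_dominated(2))
          show "AE x in M. norm (\<phi> q m x) \<le> (1 + real CARD('q)) * (\<Sum>p\<in>UNIV. norm ((w p m x) ^ 3))"
            unfolding \<phi>_def real_norm_def using e by (intro AE_I2 trunc_cube_bound) simp
        qed (auto intro!: test_fun_Lp test_fun_power w Lp_measurable[OF \<phi>L])
        also have "\<dots> \<le> (1 + n) * n\<^sup>2 * (\<Sum>p\<in>UNIV. B p)"
          by (intro mult_left_mono sum_mono) (auto simp: w_def B n_def)
        finally show ?thesis by (simp add: mult_left_mono Lpnorm_nonneg)
      qed
      then show ?thesis unfolding K1_def by (intro sum_mono)
    qed
    have le: "(\<Sum>q\<in>UNIV. \<Sum>p\<in>UNIV. dint \<Omega> (\<lambda>x. A q l x * (c q p x * A p l x))) \<le> K1"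
      by (rule LIMSEQ_le_const2[OF Llim]) (use Lle in blast)
    let ?G = "\<lambda>x. \<Sum>q\<in>UNIV. \<Sum>p\<in>UNIV. A q l x * (c q p x * A p l x)"
    have ci: "integrable M (\<lambda>x. A q l x * (c q p x * A p l x))" for q p by (rule T(2))
    then have iG: "integrable M ?G" by (intro Bochner_Integration.integrable_sum)
    have "integral\<^sup>L M ?G = (\<Sum>q\<in>UNIV. \<Sum>p\<in>UNIV. dint \<Omega> (\<lambda>x. A q l x * (c q p x * A p l x)))"
      unfolding dint_def using ci by (simp add: Bochner_Integration.integral_sum Bochner_Integration.integrable_sum)
    then have leG: "integral\<^sup>L M ?G \<le> K1" using le by simp
    have FG: "F \<epsilon> x * (\<Sum>q\<in>UNIV. (A q l x)\<^sup>2) \<le> ?G x" for x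
      unfolding F_def c_def by (rule trunc_coeff_form) (use e in simp)
    have G0: "0 \<le> ?G x" for x
      using FG[of x] F0[of \<epsilon> x] e by (meson less_imp_le mult_nonneg_nonneg order_trans sum_nonneg zero_le_power2)
    have "(\<integral>\<^sup>+x. ennreal (F \<epsilon> x * (\<Sum>q\<in>UNIV. (A q l x)\<^sup>2)) \<partial>M) \<le> (\<integral>\<^sup>+x. ennreal (?G x) \<partial>M)"
      by (intro nn_integral_mono ennreal_leI FG)
    also have "\<dots> = ennreal (integral\<^sup>L M ?G)" by (rule nn_integral_eq_integral[OF iG]) (use G0 in simp)
    also have "\<dots> \<le> ennreal K1" by (rule ennreal_leI[OF leG])
    finally show ?thesis .
  qed
  \<comment> \<open>The truncation is removed by Fatou's lemma along \<epsilon> = 1/(k + 1),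
    possible because K1 is uniform in \<epsilon>.\<close>
  have "(\<integral>\<^sup>+x. ennreal ((\<Sum>s\<in>UNIV. (v s x)\<^sup>2) * (\<Sum>q\<in>UNIV. (A q l x)\<^sup>2)) \<partial>M)
     = (\<integral>\<^sup>+x. liminf (\<lambda>k. ennreal (F (1 / real (Suc k)) x * (\<Sum>q\<in>UNIV. (A q l x)\<^sup>2))) \<partial>M)"
  proof (rule nn_integral_cong)
    fix x
    have "(\<lambda>k. 1 / real (Suc k)) \<longlonglongrightarrow> 0"
      using LIMSEQ_inverse_real_of_nat by (simp add: inverse_eq_divide)
    then have "(\<lambda>k. F (1 / real (Suc k)) x * (\<Sum>q\<in>UNIV. (A q l x)\<^sup>2)) \<longlonglongrightarrow>
      (\<Sum>s\<in>UNIV. (v s x)\<^sup>2) * inverse (1 + 0 * (\<Sum>s\<in>UNIV. (v s x)\<^sup>2)) * (\<Sum>q\<in>UNIV. (A q l x)\<^sup>2)"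
      unfolding F_def by (intro tendsto_mult tendsto_const tendsto_inverse tendsto_add) auto
    then have "(\<lambda>k. ennreal (F (1 / real (Suc k)) x * (\<Sum>q\<in>UNIV. (A q l x)\<^sup>2))) \<longlonglongrightarrow>
      ennreal ((\<Sum>s\<in>UNIV. (v s x)\<^sup>2) * (\<Sum>q\<in>UNIV. (A q l x)\<^sup>2))" by (intro tendsto_ennrealI) simp
    then show "ennreal ((\<Sum>s\<in>UNIV. (v s x)\<^sup>2) * (\<Sum>q\<in>UNIV. (A q l x)\<^sup>2)) =
        liminf (\<lambda>k. ennreal (F (1 / real (Suc k)) x * (\<Sum>q\<in>UNIV. (A q l x)\<^sup>2)))"
      by (intro lim_imp_Liminf[symmetric]) auto
  qed
  also have "\<dots> \<le> liminf (\<lambda>k. \<integral>\<^sup>+x. ennreal (F (1 / real (Suc k)) x * (\<Sum>q\<in>UNIV. (A q l x)\<^sup>2)) \<partial>M)"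
    unfolding F_def by (rule nn_integral_liminf) measurable
  also have "\<dots> \<le> liminf (\<lambda>k. ennreal K1)"
    by (intro Liminf_mono always_eventually allI key) simp
  also have "\<dots> = ennreal K1" by (simp add: Liminf_const)
  finally have fin: "(\<integral>\<^sup>+x. ennreal ((\<Sum>s\<in>UNIV. (v s x)\<^sup>2) * (\<Sum>q\<in>UNIV. (A q l x)\<^sup>2)) \<partial>M) \<le> ennreal K1" .
  show ?thesis
  proof (rule integrableI_bounded)
    have "norm ((\<Sum>s\<in>UNIV. (v s x)\<^sup>2) * (\<Sum>q\<in>UNIV. (A q l x)\<^sup>2)) = (\<Sum>s\<in>UNIV. (v s x)\<^sup>2) * (\<Sum>q\<in>UNIV. (A q l x)\<^sup>2)" for x
      by (simp add: sum_nonneg abs_mult)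
    then show "(\<integral>\<^sup>+x. ennreal (norm ((\<Sum>s\<in>UNIV. (v s x)\<^sup>2) * (\<Sum>q\<in>UNIV. (A q l x)\<^sup>2))) \<partial>M) < \<infinity>"
      using fin by (simp add: le_less_trans)
  qed measurable
qed

end

section \<open>Norms on the discrete space\<close>

context bounded_open_set
begin

text \<open>The index q runs over pairs of a component of \<Psi> and a direction, so v lists all
  first derivatives at once. Each second derivative is tested in its own direction l, hence only
  third derivatives with l repeated occur. Summation over l recovers the full Hessian.\<close>

lemma hess_grad_L2:
  fixes \<Psi> :: "'k::finite \<Rightarrow> real^'d \<Rightarrow> real"
  assumes d: "CARD('d) \<le> 3" and H3: "\<And>\<kappa>. Hs \<Omega> 3 (\<Psi> \<kappa>)" and H20: "\<And>\<kappa>. Hs0 \<Omega> 2 (\<Psi> \<kappa>)"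
  shows "Lp \<Omega> 2 (\<lambda>x. norm (vhess \<Omega> \<Psi> x) * norm (vgrad \<Omega> \<Psi> x))"
proof -
  have "\<forall>\<kappa>. \<exists>f. (\<forall>j. test_fun \<Omega> (f j)) \<and> (\<forall>\<alpha>. mi_ord \<alpha> \<le> 2 \<longrightarrow>
    (\<lambda>j::nat. Lpnorm \<Omega> 2 (\<lambda>x. cderiv \<alpha> (f j) x - wd \<Omega> \<alpha> (\<Psi> \<kappa>) x)) \<longlonglongrightarrow> 0)"
    by (rule allI, rule Hs0_approx[OF H20]) blast
  from choice[OF this] obtain f where f: "\<And>\<kappa> j. test_fun \<Omega> (f \<kappa> j)"
    and lim: "\<And>\<kappa> \<alpha>. mi_ord \<alpha> \<le> 2 \<Longrightarrow> (\<lambda>j::nat. Lpnorm \<Omega> 2 (\<lambda>x. cderiv \<alpha> (f \<kappa> j) x - wd \<Omega> \<alpha> (\<Psi> \<kappa>) x)) \<longlonglongrightarrow> 0"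
    by blast
  define v where "v q = wd \<Omega> (mi_unit (snd q)) (\<Psi> (fst q))" for q :: "'k \<times> 'd"
  define A where "A q l = wd \<Omega> (\<lambda>k. mi_unit l k + mi_unit (snd q) k) (\<Psi> (fst q))" for q :: "'k \<times> 'd" and l
  define D where "D q l = wd \<Omega> (\<lambda>k. (mi_unit l k + mi_unit (snd q) k) + mi_unit l k) (\<Psi> (fst q))" for q :: "'k \<times> 'd" and l
  define u where "u q j = cpartial (snd q) (f (fst q) j)" for q :: "'k \<times> 'd" and j
  note ord = mi_ord_unit mi_ord_add
  have "integrable M (\<lambda>x. (\<Sum>s\<in>UNIV. (v s x)\<^sup>2) * (\<Sum>q\<in>UNIV. (A q l x)\<^sup>2))" for l
  proof (rule product_L2[OF d])
    show "test_fun \<Omega> (u q m)" for q m unfolding u_def by (rule test_fun_cpartial[OF f])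
    show "Lp \<Omega> 2 (v q)" "Lp \<Omega> 2 (A q l)" "Lp \<Omega> 2 (D q l)" for q l
      unfolding v_def A_def D_def by (rule Hs_wd(1)[OF H3]; simp add: ord)+
    show "is_weak_deriv \<Omega> (mi_unit l) (A q l) (D q l)" for q l
      unfolding A_def D_def by (rule is_weak_deriv_trans[OF Hs_wd(2)[OF H3] Hs_wd(2)[OF H3]]) (simp_all add: ord)
    show "(\<lambda>m. Lpnorm \<Omega> 2 (\<lambda>x. u q m x - v q x)) \<longlonglongrightarrow> 0" for q
      using lim[of "mi_unit (snd q)" "fst q"] by (simp add: ord u_def v_def cderiv_unit[OF test_fun_smooth[OF f]])
    show "(\<lambda>m. Lpnorm \<Omega> 2 (\<lambda>x. cpartial l (u q m) x - A q l x)) \<longlonglongrightarrow> 0" for q l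
      using lim[of "\<lambda>k. mi_unit l k + mi_unit (snd q) k" "fst q"]
      by (simp add: ord u_def A_def cderiv_unit2[OF test_fun_smooth[OF f]])
  qed
  then have int: "integrable M (\<lambda>x. \<Sum>l\<in>UNIV. (\<Sum>s\<in>UNIV. (v s x)\<^sup>2) * (\<Sum>q\<in>UNIV. (A q l x)\<^sup>2))"
    by (intro Bochner_Integration.integrable_sum)
  have g: "(norm (vgrad \<Omega> \<Psi> x))\<^sup>2 = (\<Sum>s\<in>UNIV. (v s x)\<^sup>2)" for x
    unfolding power2_norm_eq_inner vgrad_def wgrad_def inner_vec_def v_def
    by (simp add: sum.cartesian_product split_def power2_eq_square flip: UNIV_Times_UNIV)
  have h: "(norm (vhess \<Omega> \<Psi> x))\<^sup>2 = (\<Sum>l\<in>UNIV. \<Sum>q\<in>UNIV. (A q l x)\<^sup>2)" for x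
  proof -
    have "(norm (vhess \<Omega> \<Psi> x))\<^sup>2 = (\<Sum>\<kappa>\<in>UNIV. \<Sum>l\<in>UNIV. \<Sum>i\<in>UNIV. (A (\<kappa>, i) l x)\<^sup>2)"
      unfolding power2_norm_eq_inner vhess_def whess_def inner_vec_def A_def by (simp add: power2_eq_square)
    also have "\<dots> = (\<Sum>l\<in>UNIV. \<Sum>\<kappa>\<in>UNIV. \<Sum>i\<in>UNIV. (A (\<kappa>, i) l x)\<^sup>2)" by (rule sum.swap)
    also have "\<dots> = (\<Sum>l\<in>UNIV. \<Sum>q\<in>UNIV. (A q l x)\<^sup>2)"
      by (simp add: sum.cartesian_product split_def flip: UNIV_Times_UNIV)
    finally show ?thesis .
  qed
  have "(norm (norm (vhess \<Omega> \<Psi> x) * norm (vgrad \<Omega> \<Psi> x)))\<^sup>2 = (\<Sum>l\<in>UNIV. (\<Sum>s\<in>UNIV. (v s x)\<^sup>2) * (\<Sum>q\<in>UNIV. (A q l x)\<^sup>2))" for x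
    by (simp add: power_mult_distrib g h sum_distrib_left mult.commute)
  moreover have "vhess \<Omega> \<Psi> \<in> borel_measurable M" "vgrad \<Omega> \<Psi> \<in> borel_measurable M"
    unfolding vhess_def vgrad_def
    by (rule Lp_measurable[OF Lp_vec(1)[OF Lp_whess[OF H3]]] Lp_measurable[OF Lp_vec(1)[OF Lp_wgrad[OF H3]]], simp_all)+
  ultimately show ?thesis using int by (simp add: Lp2_iff)
qed

section \<open>Weak derivatives of finite linear combinations\<close>

lemma Hs_lin:
  assumes u: "Hs \<Omega> m u" and v: "Hs \<Omega> m v"
  shows "Hs \<Omega> m (\<lambda>x. a * u x + b * v x)"
  unfolding Hs_def
proof (intro conjI allI impI)
  show "Lp \<Omega> 2 (\<lambda>x. a * u x + b * v x)" using Lp_lin(1)[OF Hs_Lp[OF u] Hs_Lp[OF v], of a b] by simp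
  fix \<alpha> :: "'d \<Rightarrow> nat" assume \<alpha>: "mi_ord \<alpha> \<le> m"
  show "\<exists>g. Lp \<Omega> 2 g \<and> is_weak_deriv \<Omega> \<alpha> (\<lambda>x. a * u x + b * v x) g"
    using Lp_lin(1)[OF Hs_wd(1)[OF u \<alpha>] Hs_wd(1)[OF v \<alpha>], of a b]
      is_weak_deriv_lin[OF Hs_Lp[OF u] Hs_Lp[OF v] Hs_wd(1)[OF u \<alpha>] Hs_wd(1)[OF v \<alpha>] Hs_wd(2)[OF u \<alpha>] Hs_wd(2)[OF v \<alpha>], of a b]
    by auto
qed

lemma is_weak_deriv_zero_fun: "is_weak_deriv \<Omega> \<alpha> (\<lambda>x. 0) (\<lambda>x. 0)"
  by (simp add: is_weak_deriv_def dint_def)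

lemma wd_sum:
  assumes "finite S" "\<And>i. i \<in> S \<Longrightarrow> Hs \<Omega> m (u i)" and \<alpha>: "mi_ord \<alpha> \<le> m"
  shows "Hs \<Omega> m (\<lambda>x. \<Sum>i\<in>S. c i * u i x) \<and>
    (AE x in M. wd \<Omega> \<alpha> (\<lambda>x. \<Sum>i\<in>S. c i * u i x) x = (\<Sum>i\<in>S. c i * wd \<Omega> \<alpha> (u i) x))"
  using assms(1,2)
proof (induction S)
  case empty
  have "Hs \<Omega> m (\<lambda>x. 0)" unfolding Hs_def using Lp_zero(1) is_weak_deriv_zero_fun by blast
  moreover have "AE x in M. wd \<Omega> \<alpha> (\<lambda>x. 0) x = 0" by (rule wd_props(3)[OF Lp_zero(1) is_weak_deriv_zero_fun])
  ultimately show ?case by simp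
next
  case (insert i S)
  then have IH: "Hs \<Omega> m (\<lambda>x. \<Sum>i\<in>S. c i * u i x)"
    "AE x in M. wd \<Omega> \<alpha> (\<lambda>x. \<Sum>i\<in>S. c i * u i x) x = (\<Sum>i\<in>S. c i * wd \<Omega> \<alpha> (u i) x)" and ui: "Hs \<Omega> m (u i)" by auto
  have "Hs \<Omega> m (\<lambda>x. c i * u i x + 1 * (\<Sum>i\<in>S. c i * u i x))" by (rule Hs_lin[OF ui IH(1)])
  moreover have "AE x in M. wd \<Omega> \<alpha> (\<lambda>x. c i * u i x + 1 * (\<Sum>i\<in>S. c i * u i x)) x = c i * wd \<Omega> \<alpha> (u i) x + (\<Sum>i\<in>S. c i * wd \<Omega> \<alpha> (u i) x)"
    using wd_lin[OF ui IH(1) \<alpha>, of "c i" 1] IH(2) by eventually_elim simp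
  ultimately show ?case using insert(1,2) by simp
qed

end

section \<open>Coordinates on the discrete space and equivalence of norms\<close>

definition unit_seq :: "nat \<Rightarrow> nat \<Rightarrow> real" where
  "unit_seq i = (\<lambda>j. if j = i then 1 else 0)"

lemma unit_seq_XD: "i < n \<Longrightarrow> unit_seq i \<in> XD n"
  by (auto simp: unit_seq_def XD_def)

lemma XD_zero: "(\<lambda>_. 0) \<in> XD n"
  by (simp add: XD_def)

lemma lin_onD:
  "lin_on n F \<Longrightarrow> v \<in> XD n \<Longrightarrow> w \<in> XD n \<Longrightarrow> F (\<lambda>i. a * v i + b * w i) = (\<lambda>x. a *\<^sub>R F v x + b *\<^sub>R F w x)"
  by (simp add: lin_on_def)

lemma lin_on_zero: "lin_on n F \<Longrightarrow> F (\<lambda>_. 0) = (\<lambda>x. 0)"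
proof -
  assume F: "lin_on n F"
  show ?thesis using lin_onD[OF F XD_zero XD_zero, of 0 0] by simp
qed

lemma lin_on_expand:
  assumes F: "lin_on n F" and w: "w \<in> XD n"
  shows "F w = (\<lambda>x. \<Sum>i<n. w i *\<^sub>R F (unit_seq i) x)"
proof -
  have "F (\<lambda>j. if j \<in> S then w j else 0) = (\<lambda>x. \<Sum>i\<in>S. w i *\<^sub>R F (unit_seq i) x)" if "finite S" "S \<subseteq> {..<n}" for S
    using that
  proof (induction S)
    case empty
    show ?case by (simp add: lin_on_zero[OF F])
  next
    case (insert i S)
    have "(\<lambda>j. if j \<in> insert i S then w j else 0) = (\<lambda>j. w i * unit_seq i j + 1 * (if j \<in> S then w j else 0))"
      using insert(2) by (auto simp: unit_seq_def)
    moreover have "(\<lambda>j. if j \<in> S then w j else 0) \<in> XD n" using w by (auto simp: XD_def)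
    ultimately have "F (\<lambda>j. if j \<in> insert i S then w j else 0) = (\<lambda>x. w i *\<^sub>R F (unit_seq i) x + 1 *\<^sub>R F (\<lambda>j. if j \<in> S then w j else 0) x)"
      using lin_onD[OF F unit_seq_XD[of i], of "\<lambda>j. if j \<in> S then w j else 0" "w i" 1] insert(4) by simp
    then show ?case using insert by simp
  qed
  from this[of "{..<n}"] have "F (\<lambda>j. if j \<in> {..<n} then w j else 0) = (\<lambda>x. \<Sum>i<n. w i *\<^sub>R F (unit_seq i) x)" by simp
  moreover have "(\<lambda>j. if j \<in> {..<n} then w j else 0) = w" using w by (auto simp: XD_def)
  ultimately show ?thesis by simp
qed

text \<open>The expansion is required only almost everywhere: composed with the chosen weak
  derivatives, the companion is linear only up to null sets.\<close>

lemma Lpnorm_expand_bound: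
  fixes F :: "(nat \<Rightarrow> real) \<Rightarrow> real^'d \<Rightarrow> 'a::euclidean_space"
  assumes L: "\<And>w. w \<in> XD n \<Longrightarrow> Lp \<Omega> p (F w)" and p: "p \<ge> 1"
    and ex: "\<And>w. w \<in> XD n \<Longrightarrow> AE x in lebesgue_on \<Omega>. F w x = (\<Sum>i<n. w i *\<^sub>R F (unit_seq i) x)"
  shows "\<exists>C\<ge>0. \<forall>w\<in>XD n. Lpnorm \<Omega> p (F w) \<le> C * (\<Sum>i<n. \<bar>w i\<bar>)"
proof (intro exI conjI ballI)
  let ?C = "(\<Sum>i<n. Lpnorm \<Omega> p (F (unit_seq i)))"
  show "0 \<le> (real n)\<^sup>2 * ?C" by (intro mult_nonneg_nonneg sum_nonneg Lpnorm_nonneg) simp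
  fix w assume w: "w \<in> XD n"
  have Li: "Lp \<Omega> p (\<lambda>x. w i *\<^sub>R F (unit_seq i) x)" "Lpnorm \<Omega> p (\<lambda>x. w i *\<^sub>R F (unit_seq i) x) \<le> \<bar>w i\<bar> * Lpnorm \<Omega> p (F (unit_seq i))"
    if "i \<in> {..<n}" for i
  proof -
    have Lu: "Lp \<Omega> p (F (unit_seq i))" using that by (intro L unit_seq_XD) simp
    have m: "(\<lambda>x. w i *\<^sub>R F (unit_seq i) x) \<in> borel_measurable (lebesgue_on \<Omega>)"
      using Lp_measurable[OF Lu] by measurable
    show "Lp \<Omega> p (\<lambda>x. w i *\<^sub>R F (unit_seq i) x)" "Lpnorm \<Omega> p (\<lambda>x. w i *\<^sub>R F (unit_seq i) x) \<le> \<bar>w i\<bar> * Lpnorm \<Omega> p (F (unit_seq i))"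
      using Lp_le[OF Lu m, of "\<bar>w i\<bar>"] p by auto
  qed
  have Ls: "Lp \<Omega> p (\<lambda>x. \<Sum>i<n. w i *\<^sub>R F (unit_seq i) x)" by (rule Lp_sum(1)) (use Li p in auto)
  have "Lpnorm \<Omega> p (F w) = Lpnorm \<Omega> p (\<lambda>x. \<Sum>i<n. w i *\<^sub>R F (unit_seq i) x)"
    by (rule Lpnorm_cong_AE[OF ex[OF w] Lp_measurable[OF L[OF w]] Lp_measurable[OF Ls]])
  also have "\<dots> \<le> (real (card {..<n}))\<^sup>2 * (\<Sum>i<n. Lpnorm \<Omega> p (\<lambda>x. w i *\<^sub>R F (unit_seq i) x))"
    by (rule Lp_sum(2)) (use Li p in auto)
  also have "\<dots> \<le> (real n)\<^sup>2 * (\<Sum>i<n. \<bar>w i\<bar> * ?C)"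
    unfolding card_lessThan
  proof (intro mult_left_mono sum_mono)
    fix i assume i: "i \<in> {..<n}"
    have "Lpnorm \<Omega> p (F (unit_seq i)) \<le> ?C" by (rule member_le_sum) (use i Lpnorm_nonneg in auto)
    then show "Lpnorm \<Omega> p (\<lambda>x. w i *\<^sub>R F (unit_seq i) x) \<le> \<bar>w i\<bar> * ?C"
      using Li(2)[OF i] by (meson abs_ge_zero mult_left_mono order_trans)
  qed simp
  also have "\<dots> = (real n)\<^sup>2 * ?C * (\<Sum>i<n. \<bar>w i\<bar>)" by (simp add: sum_distrib_right[symmetric])
  finally show "Lpnorm \<Omega> p (F w) \<le> (real n)\<^sup>2 * ?C * (\<Sum>i<n. \<bar>w i\<bar>)" .
qed

text \<open>The squared norm is a quadratic form in the coordinates, given by the Gram matrix of the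
  images of the unit vectors, hence continuous. On the compact unit sphere of the l^1 norm it
  attains a minimum, which injectivity makes positive; homogeneity does the rest.\<close>

lemma coordinates_le_norm:
  fixes F :: "(nat \<Rightarrow> real) \<Rightarrow> real^'d \<Rightarrow> 'a::euclidean_space"
  assumes F: "lin_on n F" and L: "\<And>w. w \<in> XD n \<Longrightarrow> Lp \<Omega> 2 (F w)"
    and inj: "\<And>w. w \<in> XD n \<Longrightarrow> Lpnorm \<Omega> 2 (F w) = 0 \<Longrightarrow> w = (\<lambda>_. 0)"
  shows "\<exists>C\<ge>0. \<forall>w\<in>XD n. (\<Sum>i<n. \<bar>w i\<bar>) \<le> C * Lpnorm \<Omega> 2 (F w)"
proof -
  define g where "g w = (\<Sum>i<n. \<Sum>j<n. w i * w j * dint \<Omega> (\<lambda>x. F (unit_seq i) x \<bullet> F (unit_seq j) x))" for w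
  have g: "g w = (Lpnorm \<Omega> 2 (F w))\<^sup>2" if w: "w \<in> XD n" for w
  proof -
    have i: "integrable (lebesgue_on \<Omega>) (\<lambda>x. F (unit_seq i) x \<bullet> F (unit_seq j) x)" if "i < n" "j < n" for i j
      by (intro L2_inner_integrable L unit_seq_XD that)
    have "(Lpnorm \<Omega> 2 (F w))\<^sup>2 = dint \<Omega> (\<lambda>x. \<Sum>i<n. \<Sum>j<n. w i * w j * (F (unit_seq i) x \<bullet> F (unit_seq j) x))"
      unfolding Lpnorm2_sq power2_norm_eq_inner lin_on_expand[OF F w]
      by (simp add: inner_sum_left inner_sum_right sum_distrib_left mult_ac inner_commute)
    also have "\<dots> = g w"
    proof -
      have ij: "integrable (lebesgue_on \<Omega>) (\<lambda>x. w i * w j * (F (unit_seq i) x \<bullet> F (unit_seq j) x))"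
        if "i \<in> {..<n}" "j \<in> {..<n}" for i j
        using i[of i j] that by (intro integrable_mult_right) auto
      have inner: "integral\<^sup>L (lebesgue_on \<Omega>) (\<lambda>x. \<Sum>j<n. w i * w j * (F (unit_seq i) x \<bullet> F (unit_seq j) x))
        = (\<Sum>j<n. w i * w j * dint \<Omega> (\<lambda>x. F (unit_seq i) x \<bullet> F (unit_seq j) x))" if "i \<in> {..<n}" for i
        unfolding dint_def by (subst Bochner_Integration.integral_sum[OF ij[OF that]]) simp_all
      show ?thesis
        unfolding g_def dint_def[of \<Omega> "\<lambda>x. \<Sum>i<n. \<Sum>j<n. w i * w j * (F (unit_seq i) x \<bullet> F (unit_seq j) x)"]
        by (subst Bochner_Integration.integral_sum[OF Bochner_Integration.integrable_sum[OF ij]])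
          (auto intro!: sum.cong inner)
    qed
    finally show ?thesis by simp
  qed
  \<comment> \<open>Coordinates from n on are pinned to zero, so B is a product of compact sets and
    compact by Tychonoff's theorem.\<close>
  define B where "B = (Pi\<^sub>E UNIV (\<lambda>i. if i < n then {-1..1} else {0}) :: (nat \<Rightarrow> real) set)"
  define K where "K = B \<inter> {w. (\<Sum>i<n. \<bar>w i\<bar>) = 1}"
  have "compactin (product_topology (\<lambda>i. euclidean) UNIV) B"
    unfolding B_def compactin_PiE by (auto simp: compactin_euclidean_iff)
  then have "compact B" by (simp add: euclidean_product_topology compactin_euclidean_iff)
  moreover have "closed {w::nat \<Rightarrow> real. (\<Sum>i<n. \<bar>w i\<bar>) = 1}"
    by (intro closed_Collect_eq continuous_intros continuous_on_product_coordinates)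
  ultimately have K: "compact K" unfolding K_def by (rule compact_Int_closed)
  have gc: "continuous_on K g"
    unfolding g_def by (intro continuous_intros continuous_on_subset[OF continuous_on_product_coordinates]) auto
  have KX: "K \<subseteq> XD n" by (auto simp: K_def B_def XD_def PiE_iff split: if_splits)
  show ?thesis
  proof (cases "K = {}")
    case False
    obtain w0 where w0: "w0 \<in> K" "\<And>w. w \<in> K \<Longrightarrow> g w0 \<le> g w" using continuous_attains_inf[OF K False gc] by blast
    have "w0 \<noteq> (\<lambda>_. 0)" using w0(1) by (auto simp: K_def)
    then have "Lpnorm \<Omega> 2 (F w0) \<noteq> 0" using inj w0(1) KX by blast
    then have m: "g w0 > 0" using g w0(1) KX by auto
    have "(\<Sum>i<n. \<bar>w i\<bar>) \<le> 1 / sqrt (g w0) * Lpnorm \<Omega> 2 (F w)" if w: "w \<in> XD n" for w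
    proof -
      define s where "s = (\<Sum>i<n. \<bar>w i\<bar>)"
      show ?thesis
      proof (cases "s = 0")
        case True
        then show ?thesis using m by (simp add: s_def[symmetric] Lpnorm_nonneg)
      next
        case False
        then have s: "s > 0" by (simp add: s_def less_le sum_nonneg)
        define w' where "w' i = w i / s" for i
        have s1: "(\<Sum>i<n. \<bar>w' i\<bar>) = 1" using s by (simp add: w'_def abs_divide s_def[symmetric] flip: sum_divide_distrib)
        have "\<bar>w' i\<bar> \<le> 1" if "i < n" for i
          using member_le_sum[of i "{..<n}" "\<lambda>i. \<bar>w' i\<bar>"] that s1 by simp
        then have "- 1 \<le> w' i \<and> w' i \<le> 1" if "i < n" for i using that by (meson abs_le_D1 abs_le_D2 minus_le_iff)
        moreover have "w' i = 0" if "\<not> i < n" for i using w that by (simp add: XD_def w'_def)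
        ultimately have "w' \<in> K" using s1 by (simp add: K_def B_def PiE_iff)
        then have "g w0 \<le> g w'" by (rule w0(2))
        also have "g w' = g w / s\<^sup>2"
          unfolding g_def w'_def by (simp add: sum_divide_distrib power2_eq_square)
        finally have "g w0 * s\<^sup>2 \<le> (Lpnorm \<Omega> 2 (F w))\<^sup>2" using s g[OF w] by (simp add: field_simps)
        then have "sqrt (g w0 * s\<^sup>2) \<le> sqrt ((Lpnorm \<Omega> 2 (F w))\<^sup>2)" by (rule real_sqrt_le_mono)
        then have "sqrt (g w0) * s \<le> Lpnorm \<Omega> 2 (F w)" using s by (simp add: real_sqrt_mult Lpnorm_nonneg)
        then show ?thesis using m by (simp add: s_def[symmetric] field_simps)
      qed
    qed
    then show ?thesis using m by (intro exI[of _ "1 / sqrt (g w0)"]) auto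
  next
    \<comment> \<open>The sphere is empty only for n = 0, since otherwise it contains the first unit
      vector; then the coordinate sum is empty.\<close>
    case True
    have "(\<Sum>i<n. \<bar>w i\<bar>) = 0" if w: "w \<in> XD n" for w
    proof (cases "n = 0")
      case False
      have "unit_seq 0 \<in> K" using False
        by (auto simp: K_def B_def PiE_iff unit_seq_def if_distrib[of abs] cong: if_cong)
      then show ?thesis using True by simp
    qed simp
    then show ?thesis by (intro exI[of _ 0]) simp
  qed
qed

section \<open>The approximation quantities\<close>

context bounded_open_set
begin

lemma Lpnorm_le_Hnorm:
  assumes "Hs \<Omega> m u"
  shows "Lpnorm \<Omega> 2 u \<le> Hnorm \<Omega> m u"
proof -
  note L = Hs_Lp[OF assms]
  have "Lp \<Omega> 2 (wd \<Omega> (\<lambda>_. 0) u)" by (rule Hs_wd(1)[OF assms]) (simp add: mi_ord_zero)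
  then have "Lpnorm \<Omega> 2 (wd \<Omega> (\<lambda>_. 0) u) = Lpnorm \<Omega> 2 u"
    by (intro Lpnorm_cong_AE[OF wd_zero[OF L]] Lp_measurable[OF L]) (rule Lp_measurable)
  then show ?thesis using Lpnorm_wd_le_Hnorm[of "\<lambda>_. 0" m \<Omega> u] by (simp add: mi_ord_zero)
qed

text \<open>Serves to show that the quotients defining \<open>alphaD\<close> are bounded above, so
  the size of the constant is irrelevant.\<close>

lemma whess_le_Hnorm:
  "\<exists>C\<ge>0. \<forall>u. Hs \<Omega> 3 u \<longrightarrow> Lpnorm \<Omega> 2 (whess \<Omega> u) \<le> C * Hnorm \<Omega> 3 u"
proof (intro exI conjI allI impI)
  let ?d = "real CARD('d)"
  show "0 \<le> ?d\<^sup>2 * (\<Sum>i\<in>(UNIV::'d set). ?d\<^sup>2 * (\<Sum>j\<in>(UNIV::'d set). 1))" by simp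
  fix u assume u: "Hs \<Omega> 3 u"
  have L: "Lp \<Omega> 2 (wd \<Omega> (\<lambda>l. mi_unit i l + mi_unit j l) u)" for i j
    by (rule Hs_wd(1)[OF u]) (simp add: mi_ord_add mi_ord_unit)
  have 1: "Lpnorm \<Omega> 2 (\<lambda>x. \<chi> j. wd \<Omega> (\<lambda>l. mi_unit i l + mi_unit j l) u x) \<le> ?d\<^sup>2 * (\<Sum>j\<in>(UNIV::'d set). 1) * Hnorm \<Omega> 3 u" for i
  proof -
    have "Lpnorm \<Omega> 2 (\<lambda>x. \<chi> j. wd \<Omega> (\<lambda>l. mi_unit i l + mi_unit j l) u x) \<le> ?d\<^sup>2 * (\<Sum>j\<in>UNIV. Lpnorm \<Omega> 2 (wd \<Omega> (\<lambda>l. mi_unit i l + mi_unit j l) u))"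
      by (rule Lp_vec(2)[OF L]) simp
    also have "\<dots> \<le> ?d\<^sup>2 * (\<Sum>j\<in>(UNIV::'d set). Hnorm \<Omega> 3 u)"
      by (intro mult_left_mono sum_mono Lpnorm_wd_le_Hnorm) (auto simp: mi_ord_add mi_ord_unit)
    finally show ?thesis by simp
  qed
  have "Lpnorm \<Omega> 2 (whess \<Omega> u) \<le> ?d\<^sup>2 * (\<Sum>i\<in>UNIV. Lpnorm \<Omega> 2 (\<lambda>x. \<chi> j. wd \<Omega> (\<lambda>l. mi_unit i l + mi_unit j l) u x))"
    unfolding whess_def by (rule Lp_vec(2)[OF Lp_vec(1)[OF L]]) simp_all
  also have "\<dots> \<le> ?d\<^sup>2 * (\<Sum>i\<in>(UNIV::'d set). ?d\<^sup>2 * (\<Sum>j\<in>(UNIV::'d set). 1) * Hnorm \<Omega> 3 u)"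
    by (intro mult_left_mono sum_mono 1) auto
  finally show "Lpnorm \<Omega> 2 (whess \<Omega> u) \<le> ?d\<^sup>2 * (\<Sum>i\<in>(UNIV::'d set). ?d\<^sup>2 * (\<Sum>j\<in>(UNIV::'d set). 1)) * Hnorm \<Omega> 3 u"
    by (simp add: sum_distrib_right mult.assoc)
qed

lemma mHnorm1_nonneg: "0 \<le> mHnorm1 \<Omega> \<xi>"
  unfolding mHnorm1_def by (simp add: sum_nonneg)

lemma Hnorm_le_mHnorm1: "Hnorm \<Omega> 1 (\<lambda>x. \<xi> x $ i $ j) \<le> mHnorm1 \<Omega> \<xi>"
proof -
  have "(Hnorm \<Omega> 1 (\<lambda>x. \<xi> x $ i $ j))\<^sup>2 \<le> (\<Sum>j\<in>UNIV. (Hnorm \<Omega> 1 (\<lambda>x. \<xi> x $ i $ j))\<^sup>2)"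
    by (rule member_le_sum) auto
  also have "\<dots> \<le> (\<Sum>i\<in>UNIV. \<Sum>j\<in>UNIV. (Hnorm \<Omega> 1 (\<lambda>x. \<xi> x $ i $ j))\<^sup>2)"
    by (rule member_le_sum[of i UNIV "\<lambda>i. \<Sum>j\<in>UNIV. (Hnorm \<Omega> 1 (\<lambda>x. \<xi> x $ i $ j))\<^sup>2"]) (auto intro: sum_nonneg)
  finally show ?thesis unfolding mHnorm1_def by (rule real_le_rsqrt)
qed

text \<open>The constant is common to all fields \<xi>; this uniformity makes the supremum in
  \<open>gammaD\<close> finite.\<close>

lemma matrix_field_bounds:
  "\<exists>C\<ge>0. \<forall>\<xi>. (\<forall>i j. Hs \<Omega> 1 (\<lambda>x. \<xi> x $ i $ j)) \<longrightarrow>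
    Lp \<Omega> 2 \<xi> \<and> Lpnorm \<Omega> 2 \<xi> \<le> C * mHnorm1 \<Omega> \<xi> \<and> Lpnorm \<Omega> 2 (wdiv \<Omega> \<xi>) \<le> C * mHnorm1 \<Omega> \<xi>"
proof (intro exI conjI allI impI)
  let ?d = "real CARD('d)"
  let ?C = "?d\<^sup>2 * (\<Sum>i\<in>(UNIV::'d set). ?d\<^sup>2 * (\<Sum>j\<in>(UNIV::'d set). 1))"
  show "0 \<le> ?C" by simp
  fix \<xi> :: "real^'d \<Rightarrow> real^'d^'d" assume H: "\<forall>i j. Hs \<Omega> 1 (\<lambda>x. \<xi> x $ i $ j)"
  then have Hij: "Hs \<Omega> 1 (\<lambda>x. \<xi> x $ i $ j)" for i j by blast
  have L: "Lp \<Omega> 2 (\<lambda>x. \<xi> x $ i $ j)" for i j by (rule Hs_Lp[OF Hij])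
  have Ld: "Lp \<Omega> 2 (wd \<Omega> (mi_unit j) (\<lambda>x. \<xi> x $ i $ j))" for i j
    by (rule Hs_wd(1)[OF Hij]) (simp add: mi_ord_unit)
  have eta: "\<xi> = (\<lambda>x. \<chi> i. \<chi> j. \<xi> x $ i $ j)" by (simp add: vec_eq_iff)
  show "Lp \<Omega> 2 \<xi>" by (subst eta) (intro Lp_vec L, simp_all)
  have row: "Lpnorm \<Omega> 2 (\<lambda>x. \<chi> j. \<xi> x $ i $ j) \<le> ?d\<^sup>2 * (\<Sum>j\<in>(UNIV::'d set). 1) * mHnorm1 \<Omega> \<xi>" for i
  proof -
    have "Lpnorm \<Omega> 2 (\<lambda>x. \<chi> j. \<xi> x $ i $ j) \<le> ?d\<^sup>2 * (\<Sum>j\<in>UNIV. Lpnorm \<Omega> 2 (\<lambda>x. \<xi> x $ i $ j))"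
      by (rule Lp_vec(2)[OF L]) simp
    also have "\<dots> \<le> ?d\<^sup>2 * (\<Sum>j\<in>(UNIV::'d set). mHnorm1 \<Omega> \<xi>)"
      by (intro mult_left_mono sum_mono order_trans[OF Lpnorm_le_Hnorm[OF Hij] Hnorm_le_mHnorm1]) simp
    finally show ?thesis by simp
  qed
  have "Lpnorm \<Omega> 2 \<xi> \<le> ?d\<^sup>2 * (\<Sum>i\<in>UNIV. Lpnorm \<Omega> 2 (\<lambda>x. \<chi> j. \<xi> x $ i $ j))"
    by (subst eta, rule Lp_vec(2)) (intro Lp_vec L, simp_all)
  also have "\<dots> \<le> ?d\<^sup>2 * (\<Sum>i\<in>(UNIV::'d set). ?d\<^sup>2 * (\<Sum>j\<in>(UNIV::'d set). 1) * mHnorm1 \<Omega> \<xi>)"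
    by (intro mult_left_mono sum_mono row) simp
  finally show "Lpnorm \<Omega> 2 \<xi> \<le> ?C * mHnorm1 \<Omega> \<xi>" by (simp add: sum_distrib_right mult.assoc)
  have drow: "Lpnorm \<Omega> 2 (\<lambda>x. \<Sum>j\<in>UNIV. wd \<Omega> (mi_unit j) (\<lambda>x. \<xi> x $ i $ j) x) \<le> ?d\<^sup>2 * (\<Sum>j\<in>(UNIV::'d set). 1) * mHnorm1 \<Omega> \<xi>" for i
  proof -
    have "Lpnorm \<Omega> 2 (\<lambda>x. \<Sum>j\<in>UNIV. wd \<Omega> (mi_unit j) (\<lambda>x. \<xi> x $ i $ j) x) \<le> ?d\<^sup>2 * (\<Sum>j\<in>UNIV. Lpnorm \<Omega> 2 (wd \<Omega> (mi_unit j) (\<lambda>x. \<xi> x $ i $ j)))"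
      by (rule Lp_sum(2)) (use Ld in auto)
    also have "\<dots> \<le> ?d\<^sup>2 * (\<Sum>j\<in>(UNIV::'d set). mHnorm1 \<Omega> \<xi>)"
      by (intro mult_left_mono sum_mono order_trans[OF Lpnorm_wd_le_Hnorm Hnorm_le_mHnorm1]) (auto simp: mi_ord_unit)
    finally show ?thesis by simp
  qed
  have "Lpnorm \<Omega> 2 (wdiv \<Omega> \<xi>) \<le> ?d\<^sup>2 * (\<Sum>i\<in>UNIV. Lpnorm \<Omega> 2 (\<lambda>x. \<Sum>j\<in>UNIV. wd \<Omega> (mi_unit j) (\<lambda>x. \<xi> x $ i $ j) x))"
    unfolding wdiv_def by (rule Lp_vec(2)) (intro Lp_sum(1) Ld, simp_all)
  also have "\<dots> \<le> ?d\<^sup>2 * (\<Sum>i\<in>(UNIV::'d set). ?d\<^sup>2 * (\<Sum>j\<in>(UNIV::'d set). 1) * mHnorm1 \<Omega> \<xi>)"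
    by (intro mult_left_mono sum_mono drow) simp
  finally show "Lpnorm \<Omega> 2 (wdiv \<Omega> \<xi>) \<le> ?C * mHnorm1 \<Omega> \<xi>" by (simp add: sum_distrib_right mult.assoc)
qed

end

section \<open>The discrete quantities as actual bounds\<close>

locale hessian_scheme = bounded_open_set \<Omega> for \<Omega> :: "(real^'d::finite) set" +
  fixes n :: nat and PiD gD HD E
  assumes dim3: "CARD('d) \<le> 3"
    and disc: "hessian_disc \<Omega> n PiD gD HD"
    and comp: "companion \<Omega> n E"
begin

lemma lin_on_D: "lin_on n PiD" "lin_on n gD" "lin_on n HD" "lin_on n E"
  using disc comp by (auto simp: hessian_disc_def companion_def)

lemma Lp_D: "w \<in> XD n \<Longrightarrow> Lp \<Omega> 2 (PiD w)" "w \<in> XD n \<Longrightarrow> Lp \<Omega> 4 (gD w)" "w \<in> XD n \<Longrightarrow> Lp \<Omega> 2 (HD w)"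
  using disc by (auto simp: hessian_disc_def)

lemma Lp2_gD: "w \<in> XD n \<Longrightarrow> Lp \<Omega> 2 (gD w)"
  by (rule Lp4_imp_Lp2[OF \<Omega>_lmeasurable Lp_D(2)])

lemma Hs0_E: "w \<in> XD n \<Longrightarrow> Hs0 \<Omega> 2 (E w)"
  using comp by (simp add: companion_def)

lemma Dnorm_zero: "Dnorm \<Omega> HD (\<lambda>_. 0) = 0"
  by (simp add: Dnorm_def lin_on_zero[OF lin_on_D(3)] Lp_zero)

lemma Dnorm_pos: "w \<in> XD n \<Longrightarrow> w \<noteq> (\<lambda>_. 0) \<Longrightarrow> Dnorm \<Omega> HD w > 0"
  using disc Lpnorm_nonneg[of \<Omega> 2 "HD w"] by (force simp: hessian_disc_def Dnorm_def less_le)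

lemma Dnorm_nonneg: "Dnorm \<Omega> HD w \<ge> 0"
  by (simp add: Dnorm_def Lpnorm_nonneg)

text \<open>A real supremum is a meaningful bound only if the set is bounded above, hence the first hypothesis.\<close>
lemma Sup_Dnorm_bound:
  fixes f :: "(nat \<Rightarrow> real) \<Rightarrow> real"
  assumes le: "\<And>w. w \<in> XD n \<Longrightarrow> f w \<le> C * Dnorm \<Omega> HD w" and w: "w \<in> XD n"
  shows "f w \<le> Sup {f w / Dnorm \<Omega> HD w | w. w \<in> XD n \<and> w \<noteq> (\<lambda>_. 0)} * Dnorm \<Omega> HD w"
proof (cases "w = (\<lambda>_. 0)")
  case True
  then show ?thesis using le[OF w] Dnorm_zero by simp
next
  case False
  have "bdd_above {f w / Dnorm \<Omega> HD w | w. w \<in> XD n \<and> w \<noteq> (\<lambda>_. 0)}"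
    using le Dnorm_pos by (auto intro!: bdd_aboveI[of _ C] simp: divide_le_eq)
  then have "f w / Dnorm \<Omega> HD w \<le> Sup {f w / Dnorm \<Omega> HD w | w. w \<in> XD n \<and> w \<noteq> (\<lambda>_. 0)}"
    using w False by (intro cSup_upper) auto
  then show ?thesis using Dnorm_pos[OF w False] by (simp add: divide_le_eq)
qed

text \<open>Both norms are compared with the l^1 norm of the coordinates. The constant depends on
  the discretisation, which is harmless: it only certifies that suprema are finite.\<close>

lemma Dnorm_dominates:
  fixes F :: "(nat \<Rightarrow> real) \<Rightarrow> real^'d \<Rightarrow> 'a::euclidean_space"
  assumes L: "\<And>w. w \<in> XD n \<Longrightarrow> Lp \<Omega> p (F w)" and p: "p \<ge> 1"
    and ex: "\<And>w. w \<in> XD n \<Longrightarrow> AE x in M. F w x = (\<Sum>i<n. w i *\<^sub>R F (unit_seq i) x)"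
  shows "\<exists>C\<ge>0. \<forall>w\<in>XD n. Lpnorm \<Omega> p (F w) \<le> C * Dnorm \<Omega> HD w"
proof -
  obtain C1 where C1: "C1 \<ge> 0" "\<And>w. w \<in> XD n \<Longrightarrow> Lpnorm \<Omega> p (F w) \<le> C1 * (\<Sum>i<n. \<bar>w i\<bar>)"
    using Lpnorm_expand_bound[of n \<Omega> p F, OF L p ex] by blast
  have inj: "w = (\<lambda>_. 0)" if "w \<in> XD n" "Lpnorm \<Omega> 2 (HD w) = 0" for w
    using disc that by (auto simp: hessian_disc_def)
  obtain C2 where C2: "C2 \<ge> 0" "\<And>w. w \<in> XD n \<Longrightarrow> (\<Sum>i<n. \<bar>w i\<bar>) \<le> C2 * Dnorm \<Omega> HD w"
    using coordinates_le_norm[OF lin_on_D(3) Lp_D(3) inj] unfolding Dnorm_def by blast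
  have "Lpnorm \<Omega> p (F w) \<le> (C1 * C2) * Dnorm \<Omega> HD w" if "w \<in> XD n" for w
    using C1(2)[OF that] mult_left_mono[OF C2(2)[OF that] C1(1)] by (simp add: mult.assoc)
  then show ?thesis using C1(1) C2(1) by (intro exI[of _ "C1 * C2"]) simp
qed

lemma wgrad_E_expand:
  assumes w: "w \<in> XD n"
  shows "AE x in M. wgrad \<Omega> (E w) x = (\<Sum>i<n. w i *\<^sub>R wgrad \<Omega> (E (unit_seq i)) x)"
proof -
  have E: "E w = (\<lambda>x. \<Sum>i<n. w i * E (unit_seq i) x)"
    using lin_on_expand[OF lin_on_D(4) w] by simp
  have "AE x in M. wd \<Omega> (mi_unit l) (E w) x = (\<Sum>i<n. w i * wd \<Omega> (mi_unit l) (E (unit_seq i)) x)" for l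
    unfolding E
    by (rule wd_sum[of "{..<n}" 2, THEN conjunct2]) (auto intro!: Hs0_Hs Hs0_E unit_seq_XD simp: mi_ord_unit)
  then have "AE x in M. \<forall>l. wd \<Omega> (mi_unit l) (E w) x = (\<Sum>i<n. w i * wd \<Omega> (mi_unit l) (E (unit_seq i)) x)"
    by (simp add: AE_all_countable)
  then show ?thesis by eventually_elim (simp add: vec_eq_iff wgrad_def)
qed

lemma Lp_wgrad_E: "w \<in> XD n \<Longrightarrow> Lp \<Omega> 2 (wgrad \<Omega> (E w))"
  by (rule Lp_wgrad[OF Hs0_Hs[OF Hs0_E]]) simp_all

lemma omegaE_bound:
  assumes w: "w \<in> XD n"
  shows "Lpnorm \<Omega> 2 (\<lambda>x. gD w x - wgrad \<Omega> (E w) x) \<le> omegaE \<Omega> n gD HD E * Dnorm \<Omega> HD w"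
proof -
  have L: "Lp \<Omega> 2 (\<lambda>x. gD w x - wgrad \<Omega> (E w) x)" if "w \<in> XD n" for w
    by (rule Lp_diff(1)[OF Lp2_gD[OF that] Lp_wgrad_E[OF that]]) simp
  have ex: "AE x in M. gD w x - wgrad \<Omega> (E w) x = (\<Sum>i<n. w i *\<^sub>R (gD (unit_seq i) x - wgrad \<Omega> (E (unit_seq i)) x))"
    if "w \<in> XD n" for w
    using wgrad_E_expand[OF that]
    by eventually_elim (simp add: lin_on_expand[OF lin_on_D(2) that] scaleR_diff_right sum_subtractf)
  obtain C where "\<And>w. w \<in> XD n \<Longrightarrow> Lpnorm \<Omega> 2 (\<lambda>x. gD w x - wgrad \<Omega> (E w) x) \<le> C * Dnorm \<Omega> HD w"
    using Dnorm_dominates[of 2 "\<lambda>w x. gD w x - wgrad \<Omega> (E w) x", OF L _ ex] by auto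
  then show ?thesis unfolding omegaE_def
    by (rule Sup_Dnorm_bound[where f="\<lambda>w. Lpnorm \<Omega> 2 (\<lambda>x. gD w x - wgrad \<Omega> (E w) x)", OF _ w])
qed

lemma D_dominated:
  "\<exists>C\<ge>0. \<forall>w\<in>XD n. Lpnorm \<Omega> 4 (gD w) \<le> C * Dnorm \<Omega> HD w \<and> Lpnorm \<Omega> 2 (gD w) \<le> C * Dnorm \<Omega> HD w
    \<and> Lpnorm \<Omega> 2 (PiD w) \<le> C * Dnorm \<Omega> HD w"
proof -
  have e: "AE x in M. gD w x = (\<Sum>i<n. w i *\<^sub>R gD (unit_seq i) x)" "AE x in M. PiD w x = (\<Sum>i<n. w i *\<^sub>R PiD (unit_seq i) x)"
    if "w \<in> XD n" for w
    by (subst lin_on_expand[OF lin_on_D(2) that], simp, subst lin_on_expand[OF lin_on_D(1) that], simp)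
  obtain A where A: "A \<ge> 0" "\<And>w. w \<in> XD n \<Longrightarrow> Lpnorm \<Omega> 4 (gD w) \<le> A * Dnorm \<Omega> HD w"
    using Dnorm_dominates[of 4 gD, OF Lp_D(2) _ e(1)] by auto
  obtain B where B: "B \<ge> 0" "\<And>w. w \<in> XD n \<Longrightarrow> Lpnorm \<Omega> 2 (gD w) \<le> B * Dnorm \<Omega> HD w"
    using Dnorm_dominates[of 2 gD, OF Lp2_gD _ e(1)] by auto
  obtain D where D: "D \<ge> 0" "\<And>w. w \<in> XD n \<Longrightarrow> Lpnorm \<Omega> 2 (PiD w) \<le> D * Dnorm \<Omega> HD w"
    using Dnorm_dominates[of 2 PiD, OF Lp_D(1) _ e(2)] by auto
  have up: "x \<le> (A + B + D) * Dnorm \<Omega> HD w" if "x \<le> c * Dnorm \<Omega> HD w" "c \<le> A + B + D" for x c w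
    using that mult_right_mono[OF that(2) Dnorm_nonneg[of w]] by linarith
  have "Lpnorm \<Omega> 4 (gD w) \<le> (A + B + D) * Dnorm \<Omega> HD w \<and> Lpnorm \<Omega> 2 (gD w) \<le> (A + B + D) * Dnorm \<Omega> HD w
    \<and> Lpnorm \<Omega> 2 (PiD w) \<le> (A + B + D) * Dnorm \<Omega> HD w" if w: "w \<in> XD n" for w
    using up[OF A(2)[OF w]] up[OF B(2)[OF w]] up[OF D(2)[OF w]] A(1) B(1) D(1) by simp
  then show ?thesis using A(1) B(1) D(1) by (intro exI[of _ "A + B + D"]) simp
qed

lemma CD_bound:
  assumes w: "w \<in> XD n"
  shows "Lpnorm \<Omega> 4 (gD w) \<le> CD \<Omega> n PiD gD HD * Dnorm \<Omega> HD w"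
proof -
  obtain C where "\<And>w. w \<in> XD n \<Longrightarrow> max (Lpnorm \<Omega> 2 (PiD w)) (Lpnorm \<Omega> 4 (gD w)) \<le> C * Dnorm \<Omega> HD w"
    using D_dominated by (metis max.bounded_iff)
  from Sup_Dnorm_bound[where f="\<lambda>w. max (Lpnorm \<Omega> 2 (PiD w)) (Lpnorm \<Omega> 4 (gD w))", OF this w]
  show ?thesis unfolding CD_def by simp
qed

text \<open>The competitor w = 0 bounds the quotients defining \<open>alphaD\<close>, so the
  supremum is a genuine upper bound; the gradient term uses the L^4 Sobolev estimate. A \<phi> with
  vanishing H^3 norm is excluded from the supremum, but the same estimate gives \<open>SD\<close>
  \<le> 0 for it.\<close>

lemma SD_bound:
  assumes \<phi>: "Hs \<Omega> 3 \<phi>" "Hs0 \<Omega> 2 \<phi>"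
  shows "SD \<Omega> n PiD gD HD \<phi> \<le> alphaD \<Omega> n PiD gD HD * Hnorm \<Omega> 3 \<phi>"
proof -
  obtain C1 where C1: "C1 \<ge> 0" "\<And>u. Hs0 \<Omega> 2 u \<Longrightarrow> Lpnorm \<Omega> 4 (wgrad \<Omega> u) \<le> C1 * Hnorm \<Omega> 3 u"
    using wgrad_Lp4(2)[OF dim3 \<phi>(2)] by blast
  obtain C2 where C2: "C2 \<ge> 0" "\<And>u. Hs \<Omega> 3 u \<Longrightarrow> Lpnorm \<Omega> 2 (whess \<Omega> u) \<le> C2 * Hnorm \<Omega> 3 u"
    using whess_le_Hnorm by blast
  have le: "SD \<Omega> n PiD gD HD \<phi> \<le> (1 + C1 + C2) * Hnorm \<Omega> 3 \<phi>" if \<phi>: "Hs \<Omega> 3 \<phi>" "Hs0 \<Omega> 2 \<phi>" for \<phi>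
  proof -
    have "bdd_below {SD_err \<Omega> PiD gD HD \<phi> w |w. w \<in> XD n}"
      by (auto intro!: bdd_belowI[of _ 0] add_nonneg_nonneg Lpnorm_nonneg simp: SD_err_def)
    then have "SD \<Omega> n PiD gD HD \<phi> \<le> SD_err \<Omega> PiD gD HD \<phi> (\<lambda>_. 0)"
      unfolding SD_def using XD_zero by (intro cInf_lower) auto
    also have "\<dots> = Lpnorm \<Omega> 2 \<phi> + Lpnorm \<Omega> 4 (wgrad \<Omega> \<phi>) + Lpnorm \<Omega> 2 (whess \<Omega> \<phi>)"
      by (simp add: SD_err_def lin_on_zero[OF lin_on_D(1)] lin_on_zero[OF lin_on_D(2)] lin_on_zero[OF lin_on_D(3)] Lpnorm_def)
    also have "\<dots> \<le> Hnorm \<Omega> 3 \<phi> + C1 * Hnorm \<Omega> 3 \<phi> + C2 * Hnorm \<Omega> 3 \<phi>"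
      by (intro add_mono Lpnorm_le_Hnorm C1 C2 that)
    finally show ?thesis by (simp add: algebra_simps)
  qed
  show ?thesis
  proof (cases "Hnorm \<Omega> 3 \<phi> = 0")
    case True
    then show ?thesis using le[OF \<phi>] by simp
  next
    case False
    then have pos: "Hnorm \<Omega> 3 \<phi> > 0" using Hnorm_nonneg[of \<Omega> 3 \<phi>] by simp
    have "SD \<Omega> n PiD gD HD \<phi> / Hnorm \<Omega> 3 \<phi> \<le> alphaD \<Omega> n PiD gD HD"
      unfolding alphaD_def
    proof (rule cSup_upper)
      show "bdd_above {SD \<Omega> n PiD gD HD \<phi> / Hnorm \<Omega> 3 \<phi> | \<phi>. Hs \<Omega> 3 \<phi> \<and> Hs0 \<Omega> 2 \<phi> \<and> Hnorm \<Omega> 3 \<phi> \<noteq> 0}"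
        using le by (auto intro!: bdd_aboveI[of _ "1 + C1 + C2"] simp: divide_le_eq Hnorm_nonneg less_le)
    qed (use \<phi> False in blast)
    then show ?thesis using pos by (simp add: divide_le_eq)
  qed
qed

text \<open>Two nested suprema have to be shown bounded: over w for fixed \<xi>, by equivalence of
  norms on the discrete space, and over \<xi>, by a constant K common to all of them. The degenerate
  cases follow from the a priori bound with K.\<close>

lemma WD_bound:
  assumes \<xi>: "\<And>i j. Hs \<Omega> 1 (\<lambda>x. \<xi> x $ i $ j)" and w: "w \<in> XD n"
  shows "\<bar>dint \<Omega> (\<lambda>x. \<xi> x \<bullet> HD w x + wdiv \<Omega> \<xi> x \<bullet> gD w x)\<bar> \<le> gammaD \<Omega> n gD HD * mHnorm1 \<Omega> \<xi> * Dnorm \<Omega> HD w"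
proof -
  obtain C where C: "C \<ge> 0" "\<And>\<xi>. (\<And>i j. Hs \<Omega> 1 (\<lambda>x. \<xi> x $ i $ j)) \<Longrightarrow>
    Lp \<Omega> 2 \<xi> \<and> Lpnorm \<Omega> 2 \<xi> \<le> C * mHnorm1 \<Omega> \<xi> \<and> Lpnorm \<Omega> 2 (wdiv \<Omega> \<xi>) \<le> C * mHnorm1 \<Omega> \<xi>"
    using matrix_field_bounds by blast
  obtain G where G: "G \<ge> 0" "\<And>w. w \<in> XD n \<Longrightarrow> Lpnorm \<Omega> 2 (gD w) \<le> G * Dnorm \<Omega> HD w"
    using D_dominated by blast
  define K where "K = C + C * G"
  have le: "\<bar>dint \<Omega> (\<lambda>x. \<xi> x \<bullet> HD w x + wdiv \<Omega> \<xi> x \<bullet> gD w x)\<bar> \<le> K * mHnorm1 \<Omega> \<xi> * Dnorm \<Omega> HD w"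
    if \<xi>: "\<And>i j. Hs \<Omega> 1 (\<lambda>x. \<xi> x $ i $ j)" and w: "w \<in> XD n" for \<xi> w
  proof -
    have b: "Lp \<Omega> 2 \<xi>" "Lpnorm \<Omega> 2 \<xi> \<le> C * mHnorm1 \<Omega> \<xi>" "Lpnorm \<Omega> 2 (wdiv \<Omega> \<xi>) \<le> C * mHnorm1 \<Omega> \<xi>"
      using C(2)[OF \<xi>] by auto
    note Ld = Lp_wdiv[OF \<xi>]
    have "dint \<Omega> (\<lambda>x. \<xi> x \<bullet> HD w x + wdiv \<Omega> \<xi> x \<bullet> gD w x) = dint \<Omega> (\<lambda>x. \<xi> x \<bullet> HD w x) + dint \<Omega> (\<lambda>x. wdiv \<Omega> \<xi> x \<bullet> gD w x)"
      unfolding dint_def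
      by (rule Bochner_Integration.integral_add[OF L2_inner_integrable[OF b(1) Lp_D(3)[OF w]] L2_inner_integrable[OF Ld Lp2_gD[OF w]]])
    also have "\<bar>\<dots>\<bar> \<le> Lpnorm \<Omega> 2 \<xi> * Lpnorm \<Omega> 2 (HD w) + Lpnorm \<Omega> 2 (wdiv \<Omega> \<xi>) * Lpnorm \<Omega> 2 (gD w)"
      using L2_Cauchy_Schwarz(2)[OF b(1) Lp_D(3)[OF w]] L2_Cauchy_Schwarz(2)[OF Ld Lp2_gD[OF w]] by linarith
    also have "\<dots> \<le> (C * mHnorm1 \<Omega> \<xi>) * Dnorm \<Omega> HD w + (C * mHnorm1 \<Omega> \<xi>) * (G * Dnorm \<Omega> HD w)"
      unfolding Dnorm_def[symmetric]
      by (intro add_mono mult_mono b G w order_refl mult_nonneg_nonneg C Dnorm_nonneg Lpnorm_nonneg mHnorm1_nonneg)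
    finally show ?thesis by (simp add: K_def algebra_simps)
  qed
  show ?thesis
  proof (cases "w = (\<lambda>_. 0) \<or> mHnorm1 \<Omega> \<xi> = 0")
    case True
    then show ?thesis using le[OF \<xi> w] Dnorm_zero by auto
  next
    case False
    have WD: "\<bar>dint \<Omega> (\<lambda>x. \<xi> x \<bullet> HD w x + wdiv \<Omega> \<xi> x \<bullet> gD w x)\<bar> \<le> WD \<Omega> n gD HD \<xi> * Dnorm \<Omega> HD w"
      unfolding WD_def by (rule Sup_Dnorm_bound[where f="\<lambda>w. \<bar>dint \<Omega> (\<lambda>x. \<xi> x \<bullet> HD w x + wdiv \<Omega> \<xi> x \<bullet> gD w x)\<bar>", OF le[OF \<xi>] w])
    have WDle: "WD \<Omega> n gD HD \<xi> \<le> K * mHnorm1 \<Omega> \<xi>" if \<xi>: "\<And>i j. Hs \<Omega> 1 (\<lambda>x. \<xi> x $ i $ j)" for \<xi>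
      unfolding WD_def
    proof (rule cSup_least)
      \<comment> \<open>Nonemptiness is needed to bound a real supremum from above; the given
        nonzero w provides an element for every \<xi>.\<close>
      show "{\<bar>dint \<Omega> (\<lambda>x. \<xi> x \<bullet> HD w x + wdiv \<Omega> \<xi> x \<bullet> gD w x)\<bar> / Dnorm \<Omega> HD w | w. w \<in> XD n \<and> w \<noteq> (\<lambda>_. 0)} \<noteq> {}"
        using w False by blast
    next
      fix x assume "x \<in> {\<bar>dint \<Omega> (\<lambda>x. \<xi> x \<bullet> HD w x + wdiv \<Omega> \<xi> x \<bullet> gD w x)\<bar> / Dnorm \<Omega> HD w | w. w \<in> XD n \<and> w \<noteq> (\<lambda>_. 0)}"
      then show "x \<le> K * mHnorm1 \<Omega> \<xi>" using le[OF \<xi>] Dnorm_pos by (auto simp: divide_le_eq)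
    qed
    have pos: "mHnorm1 \<Omega> \<xi> > 0" using False mHnorm1_nonneg[of \<xi>] by simp
    have "WD \<Omega> n gD HD \<xi> / mHnorm1 \<Omega> \<xi> \<le> gammaD \<Omega> n gD HD"
      unfolding gammaD_def
    proof (rule cSup_upper)
      show "bdd_above {WD \<Omega> n gD HD \<xi> / mHnorm1 \<Omega> \<xi> | \<xi>. (\<forall>i j. Hs \<Omega> 1 (\<lambda>x. \<xi> x $ i $ j)) \<and> mHnorm1 \<Omega> \<xi> \<noteq> 0}"
        using WDle by (auto intro!: bdd_aboveI[of _ K] simp: divide_le_eq mHnorm1_nonneg less_le)
    qed (use \<xi> False in blast)
    then have "WD \<Omega> n gD HD \<xi> \<le> gammaD \<Omega> n gD HD * mHnorm1 \<Omega> \<xi>" using pos by (simp add: divide_le_eq)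
    then show ?thesis using WD mult_right_mono[OF _ Dnorm_nonneg[of w]] by (meson order_trans)
  qed
qed

end

section \<open>Consistency and the fixed point map\<close>

context bounded_open_set
begin

lemma formA_sum:
  fixes f g :: "'k::finite \<Rightarrow> real^'d \<Rightarrow> real^'d^'d"
  assumes "\<And>\<kappa>. Lp \<Omega> 2 (f \<kappa>)" "\<And>\<kappa>. Lp \<Omega> 2 (g \<kappa>)"
  shows "formA \<Omega> (\<lambda>x. \<chi> \<kappa>. f \<kappa> x) (\<lambda>x. \<chi> \<kappa>. g \<kappa> x) = (\<Sum>\<kappa>\<in>UNIV. dint \<Omega> (\<lambda>x. f \<kappa> x \<bullet> g \<kappa> x))"
proof -
  have "(\<chi> \<kappa>. f \<kappa> x) \<bullet> (\<chi> \<kappa>. g \<kappa> x) = (\<Sum>\<kappa>\<in>UNIV. f \<kappa> x \<bullet> g \<kappa> x)" for x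
    by (subst inner_vec_def) simp
  then show ?thesis
    unfolding formA_def dint_def
    by (simp add: Bochner_Integration.integral_sum[OF L2_inner_integrable[OF assms]])
qed

lemma formA_diff:
  fixes F F' G :: "real^'d \<Rightarrow> real^'d^'d^'k::finite"
  assumes "Lp \<Omega> 2 F" "Lp \<Omega> 2 F'" "Lp \<Omega> 2 G"
  shows "formA \<Omega> (\<lambda>x. F x - F' x) G = formA \<Omega> F G - formA \<Omega> F' G"
  unfolding formA_def dint_def inner_diff_left
  by (rule Bochner_Integration.integral_diff[OF L2_inner_integrable[OF assms(1,3)] L2_inner_integrable[OF assms(2,3)]])

end

section \<open>Integrability and additivity of the trilinear form\<close>

locale bilinear_form = bounded_open_set \<Omega> for \<Omega> :: "(real^'d::finite) set" +
  fixes h :: "real^'d^'k \<Rightarrow> real^'d^'k \<Rightarrow> real^'d^'d^'k::finite"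
  assumes h_bilin: "bilinear h"
begin

abbreviation intB where "intB \<Phi> \<Theta> \<Xi> \<equiv> integrable M (\<lambda>x. \<Phi> x \<bullet> h (\<Theta> x) (\<Xi> x))"

lemma h_measurable:
  assumes "\<Theta> \<in> borel_measurable M" "\<Xi> \<in> borel_measurable M"
  shows "(\<lambda>x. h (\<Theta> x) (\<Xi> x)) \<in> borel_measurable M"
proof (rule borel_measurable_continuous_Pair[OF assms])
  show "continuous_on UNIV (\<lambda>x. h (fst x) (snd x))"
    by (rule bounded_bilinear.continuous_on[OF h_bilin[unfolded bilinear_conv_bounded_bilinear]])
      (auto intro: continuous_intros)
qed

lemma h_bound: "\<exists>C\<ge>0. \<forall>x y. norm (h x y) \<le> C * norm x * norm y"
  using bilinear_bounded_pos[OF h_bilin] by (metis less_imp_le)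

text \<open>The estimate for a third argument that is merely square integrable, as the gradient
  error of the companion is. The price is that the product of the norms of the first two arguments
  be in L^2; the pointwise bound on h replaces continuity of the form.\<close>

lemma formB_L2_bound:
  assumes "C \<ge> 0" "\<And>x y. norm (h x y) \<le> C * norm x * norm y"
    and m: "\<Phi> \<in> borel_measurable M" "\<Theta> \<in> borel_measurable M"
    and L: "Lp \<Omega> 2 (\<lambda>x. norm (\<Phi> x) * norm (\<Theta> x))" "Lp \<Omega> 2 \<Xi>"
  shows "intB \<Phi> \<Theta> \<Xi>"
    and "\<bar>formB \<Omega> h \<Phi> \<Theta> \<Xi>\<bar> \<le> C * Lpnorm \<Omega> 2 (\<lambda>x. norm (\<Phi> x) * norm (\<Theta> x)) * Lpnorm \<Omega> 2 \<Xi>"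
proof -
  let ?G = "\<lambda>x. (norm (\<Phi> x) * norm (\<Theta> x)) * norm (\<Xi> x)"
  have nX: "Lp \<Omega> 2 (\<lambda>x. norm (\<Xi> x))" using L(2) by (auto simp: Lp2_iff)
  have G: "integrable M ?G" by (rule L2_mult_integrable[OF L(1) nX])
  have le: "\<bar>\<Phi> x \<bullet> h (\<Theta> x) (\<Xi> x)\<bar> \<le> C * ?G x" for x
  proof -
    have "\<bar>\<Phi> x \<bullet> h (\<Theta> x) (\<Xi> x)\<bar> \<le> norm (\<Phi> x) * norm (h (\<Theta> x) (\<Xi> x))" by (rule Cauchy_Schwarz_ineq2)
    also have "\<dots> \<le> norm (\<Phi> x) * (C * norm (\<Theta> x) * norm (\<Xi> x))" by (intro mult_left_mono assms(2)) simp
    finally show ?thesis by (simp add: mult_ac)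
  qed
  show i: "intB \<Phi> \<Theta> \<Xi>"
  proof (rule Bochner_Integration.integrable_bound)
    show "integrable M (\<lambda>x. C * ?G x)" using G by (rule integrable_mult_right)
    show "(\<lambda>x. \<Phi> x \<bullet> h (\<Theta> x) (\<Xi> x)) \<in> borel_measurable M"
      using m(1) h_measurable[OF m(2) Lp_measurable[OF L(2)]] by measurable
    show "AE x in M. norm (\<Phi> x \<bullet> h (\<Theta> x) (\<Xi> x)) \<le> norm (C * ?G x)"
      using le by (auto intro!: AE_I2 intro: order_trans[OF _ abs_ge_self])
  qed
  have "\<bar>formB \<Omega> h \<Phi> \<Theta> \<Xi>\<bar> \<le> integral\<^sup>L M (\<lambda>x. \<bar>\<Phi> x \<bullet> h (\<Theta> x) (\<Xi> x)\<bar>)"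
    unfolding formB_def dint_def by (rule integral_abs_bound)
  also have "\<dots> \<le> integral\<^sup>L M (\<lambda>x. C * ?G x)"
    by (intro integral_mono integrable_abs i integrable_mult_right G le)
  also have "\<dots> = C * dint \<Omega> ?G" by (simp add: dint_def)
  also have "\<dots> \<le> C * (Lpnorm \<Omega> 2 (\<lambda>x. norm (\<Phi> x) * norm (\<Theta> x)) * Lpnorm \<Omega> 2 \<Xi>)"
  proof (rule mult_left_mono[OF _ assms(1)])
    have "dint \<Omega> ?G \<le> Lpnorm \<Omega> 2 (\<lambda>x. norm (\<Phi> x) * norm (\<Theta> x)) * Lpnorm \<Omega> 2 (\<lambda>x. norm (\<Xi> x))"
      using L2_Cauchy_Schwarz_real[OF L(1) nX] by linarith
    then show "dint \<Omega> ?G \<le> Lpnorm \<Omega> 2 (\<lambda>x. norm (\<Phi> x) * norm (\<Theta> x)) * Lpnorm \<Omega> 2 \<Xi>"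
      by (simp add: Lpnorm_def)
  qed
  finally show "\<bar>formB \<Omega> h \<Phi> \<Theta> \<Xi>\<bar> \<le> C * Lpnorm \<Omega> 2 (\<lambda>x. norm (\<Phi> x) * norm (\<Theta> x)) * Lpnorm \<Omega> 2 \<Xi>"
    by (simp add: mult.assoc)
qed

text \<open>Continuity of the form does not yield this: the integral of a non-integrable function is
  0 by convention and satisfies any bound. Integrability is what makes the form additive in each
  argument.\<close>

lemma intB_244:
  assumes \<Phi>: "Lp \<Omega> 2 \<Phi>" and \<Theta>: "Lp \<Omega> 4 \<Theta>" and \<Xi>: "Lp \<Omega> 4 \<Xi>"
  shows "intB \<Phi> \<Theta> \<Xi>"
proof -
  obtain C where C: "C \<ge> 0" "\<And>x y. norm (h x y) \<le> C * norm x * norm y" using h_bound by blast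
  have nP: "Lp \<Omega> 2 (\<lambda>x. norm (\<Phi> x))" using \<Phi> by (auto simp: Lp2_iff)
  have G: "integrable M (\<lambda>x. norm (\<Phi> x) * (norm (\<Theta> x) * norm (\<Xi> x)))"
    by (rule L2_mult_integrable[OF nP L4_mult_L2[OF \<Theta> \<Xi>]])
  show ?thesis
  proof (rule Bochner_Integration.integrable_bound)
    show "integrable M (\<lambda>x. C * (norm (\<Phi> x) * (norm (\<Theta> x) * norm (\<Xi> x))))" using G by (rule integrable_mult_right)
    show "(\<lambda>x. \<Phi> x \<bullet> h (\<Theta> x) (\<Xi> x)) \<in> borel_measurable M"
      using Lp_measurable[OF \<Phi>] h_measurable[OF Lp_measurable[OF \<Theta>] Lp_measurable[OF \<Xi>]] by measurable
    show "AE x in M. norm (\<Phi> x \<bullet> h (\<Theta> x) (\<Xi> x)) \<le> norm (C * (norm (\<Phi> x) * (norm (\<Theta> x) * norm (\<Xi> x))))"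
    proof (rule AE_I2)
      fix x
      have "\<bar>\<Phi> x \<bullet> h (\<Theta> x) (\<Xi> x)\<bar> \<le> norm (\<Phi> x) * norm (h (\<Theta> x) (\<Xi> x))" by (rule Cauchy_Schwarz_ineq2)
      also have "\<dots> \<le> norm (\<Phi> x) * (C * norm (\<Theta> x) * norm (\<Xi> x))" by (intro mult_left_mono C) simp
      finally show "norm (\<Phi> x \<bullet> h (\<Theta> x) (\<Xi> x)) \<le> norm (C * (norm (\<Phi> x) * (norm (\<Theta> x) * norm (\<Xi> x))))"
        using C(1) by (simp add: mult_ac)
    qed
  qed
qed

lemma formB_diff1: "intB \<Phi> \<Theta> \<Xi> \<Longrightarrow> intB \<Phi>' \<Theta> \<Xi> \<Longrightarrow>
    formB \<Omega> h (\<lambda>x. \<Phi> x - \<Phi>' x) \<Theta> \<Xi> = formB \<Omega> h \<Phi> \<Theta> \<Xi> - formB \<Omega> h \<Phi>' \<Theta> \<Xi>"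
  by (simp add: formB_def dint_def inner_diff_left)

lemma formB_diff2: "intB \<Phi> \<Theta> \<Xi> \<Longrightarrow> intB \<Phi> \<Theta>' \<Xi> \<Longrightarrow>
    formB \<Omega> h \<Phi> (\<lambda>x. \<Theta> x - \<Theta>' x) \<Xi> = formB \<Omega> h \<Phi> \<Theta> \<Xi> - formB \<Omega> h \<Phi> \<Theta>' \<Xi>"
  by (simp add: formB_def dint_def bilinear_lsub[OF h_bilin] inner_diff_right)

lemma formB_diff3: "intB \<Phi> \<Theta> \<Xi> \<Longrightarrow> intB \<Phi> \<Theta> \<Xi>' \<Longrightarrow>
    formB \<Omega> h \<Phi> \<Theta> (\<lambda>x. \<Xi> x - \<Xi>' x) = formB \<Omega> h \<Phi> \<Theta> \<Xi> - formB \<Omega> h \<Phi> \<Theta> \<Xi>'"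
  by (simp add: formB_def dint_def bilinear_rsub[OF h_bilin] inner_diff_right)

end

section \<open>Vector-valued discrete functions and consistency of the leading form\<close>

context hessian_scheme
begin

lemma vXD_nth: "\<Phi> \<in> vXD n \<Longrightarrow> \<Phi> \<kappa> \<in> XD n"
  by (simp add: vXD_def)

lemma vsub_vXD: "\<Phi> \<in> vXD n \<Longrightarrow> \<Theta> \<in> vXD n \<Longrightarrow> vsub \<Phi> \<Theta> \<in> vXD n"
  by (simp add: vXD_def XD_def vsub_def)

lemma vHD_vsub:
  assumes "\<Phi> \<in> vXD n" "\<Theta> \<in> vXD n"
  shows "vHD HD (vsub \<Phi> \<Theta>) = (\<lambda>x. vHD HD \<Phi> x - vHD HD \<Theta> x)" "vgD gD (vsub \<Phi> \<Theta>) = (\<lambda>x. vgD gD \<Phi> x - vgD gD \<Theta> x)"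
proof -
  have "HD (vsub \<Phi> \<Theta> \<kappa>) = (\<lambda>x. HD (\<Phi> \<kappa>) x - HD (\<Theta> \<kappa>) x)" "gD (vsub \<Phi> \<Theta> \<kappa>) = (\<lambda>x. gD (\<Phi> \<kappa>) x - gD (\<Theta> \<kappa>) x)" for \<kappa>
    using lin_onD[where a=1 and b="-1", OF lin_on_D(3) vXD_nth[OF assms(1), of \<kappa>] vXD_nth[OF assms(2), of \<kappa>]]
      lin_onD[where a=1 and b="-1", OF lin_on_D(2) vXD_nth[OF assms(1), of \<kappa>] vXD_nth[OF assms(2), of \<kappa>]]
    by (simp_all add: vsub_def)
  then show "vHD HD (vsub \<Phi> \<Theta>) = (\<lambda>x. vHD HD \<Phi> x - vHD HD \<Theta> x)" "vgD gD (vsub \<Phi> \<Theta>) = (\<lambda>x. vgD gD \<Phi> x - vgD gD \<Theta> x)"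
    by (simp_all add: vHD_def vgD_def vec_eq_iff fun_eq_iff)
qed

lemma Lp_vHD: "\<Phi> \<in> vXD n \<Longrightarrow> Lp \<Omega> 2 (vHD HD \<Phi>)"
  unfolding vHD_def by (intro Lp_vec(1) Lp_D(3) vXD_nth) simp_all

lemma Lp_vgD: "\<Phi> \<in> vXD n \<Longrightarrow> Lp \<Omega> 4 (vgD gD \<Phi>)"
  unfolding vgD_def by (intro Lp_vec(1) Lp_D(2) vXD_nth) simp_all

lemma Dnorm_le_vDnorm:
  assumes "\<Phi> \<in> vXD n"
  shows "Dnorm \<Omega> HD (\<Phi> \<kappa>) \<le> vDnorm \<Omega> HD \<Phi>"
  using Lp_nth(2)[OF Lp_vHD[OF assms], of \<kappa>] by (simp add: Dnorm_def vDnorm_def vHD_def)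

lemma vDnorm_pos:
  assumes "\<Phi> \<in> vXD n" "\<Phi> \<noteq> (\<lambda>_ _. 0)"
  shows "vDnorm \<Omega> HD \<Phi> > 0"
proof -
  obtain \<kappa> where "\<Phi> \<kappa> \<noteq> (\<lambda>_. 0)" using assms(2) by (metis ext)
  then show ?thesis using Dnorm_pos[OF vXD_nth[OF assms(1)]] Dnorm_le_vDnorm[OF assms(1), of \<kappa>] by (meson less_le_trans)
qed

text \<open>Of the factor k^3, with k the number of components, two powers come from assembling the
  components by \<open>Lp_vec\<close> and one from bounding each of them by the full norm.\<close>

lemma vgD_bound:
  fixes \<Phi> :: "'k::finite \<Rightarrow> nat \<Rightarrow> real"
  assumes \<Phi>: "\<Phi> \<in> vXD n" and CD: "CD \<Omega> n PiD gD HD \<le> \<Gamma>" and \<Gamma>: "\<Gamma> \<ge> 0"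
  shows "Lpnorm \<Omega> 4 (vgD gD \<Phi>) \<le> (real CARD('k)) ^ 3 * \<Gamma> * vDnorm \<Omega> HD \<Phi>"
proof -
  have "Lpnorm \<Omega> 4 (vgD gD \<Phi>) \<le> (real CARD('k))\<^sup>2 * (\<Sum>\<kappa>\<in>UNIV. Lpnorm \<Omega> 4 (gD (\<Phi> \<kappa>)))"
    unfolding vgD_def by (rule Lp_vec(2)[OF Lp_D(2)[OF vXD_nth[OF \<Phi>]]]) simp
  also have "\<dots> \<le> (real CARD('k))\<^sup>2 * (\<Sum>\<kappa>\<in>(UNIV::'k set). \<Gamma> * vDnorm \<Omega> HD \<Phi>)"
  proof (intro mult_left_mono sum_mono)
    fix \<kappa>
    have "Lpnorm \<Omega> 4 (gD (\<Phi> \<kappa>)) \<le> CD \<Omega> n PiD gD HD * Dnorm \<Omega> HD (\<Phi> \<kappa>)" by (rule CD_bound[OF vXD_nth[OF \<Phi>]])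
    also have "\<dots> \<le> \<Gamma> * Dnorm \<Omega> HD (\<Phi> \<kappa>)" by (intro mult_right_mono CD Dnorm_nonneg)
    also have "\<dots> \<le> \<Gamma> * vDnorm \<Omega> HD \<Phi>" by (intro mult_left_mono Dnorm_le_vDnorm \<Phi> \<Gamma>)
    finally show "Lpnorm \<Omega> 4 (gD (\<Phi> \<kappa>)) \<le> \<Gamma> * vDnorm \<Omega> HD \<Phi>" .
  qed simp
  finally show ?thesis by (simp add: power2_eq_square power3_eq_cube mult_ac)
qed

lemma consistency_A:
  fixes \<Psi> :: "'k::finite \<Rightarrow> real^'d \<Rightarrow> real"
  assumes \<Psi>: "\<And>\<kappa>. Hs \<Omega> 3 (\<Psi> \<kappa>)" and P: "P \<in> vXD n" and \<Phi>: "\<Phi> \<in> vXD n"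
    and om: "omegaE \<Omega> n gD HD E \<le> \<rho>" and ga: "gammaD \<Omega> n gD HD \<le> \<rho>"
    and HP: "\<And>\<kappa>. Lpnorm \<Omega> 2 (\<lambda>x. whess \<Omega> (\<Psi> \<kappa>) x - HD (P \<kappa>) x) \<le> \<rho> * Hnorm \<Omega> 3 (\<Psi> \<kappa>)"
    and \<rho>: "\<rho> > 0"
  shows "\<bar>formA \<Omega> (vhess \<Omega> \<Psi>) (vhess \<Omega> (\<lambda>\<kappa>. E (\<Phi> \<kappa>))) - formA \<Omega> (vHD HD P) (vHD HD \<Phi>)\<bar>
    \<le> (\<Sum>\<kappa>\<in>UNIV. Lpnorm \<Omega> 2 (wdiv \<Omega> (whess \<Omega> (\<Psi> \<kappa>))) + mHnorm1 \<Omega> (whess \<Omega> (\<Psi> \<kappa>)) + Hnorm \<Omega> 3 (\<Psi> \<kappa>)) * \<rho> * vDnorm \<Omega> HD \<Phi>"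
proof -
  let ?V = "vDnorm \<Omega> HD \<Phi>"
  have one: "\<bar>dint \<Omega> (\<lambda>x. whess \<Omega> (\<Psi> \<kappa>) x \<bullet> whess \<Omega> (E (\<Phi> \<kappa>)) x) - dint \<Omega> (\<lambda>x. HD (P \<kappa>) x \<bullet> HD (\<Phi> \<kappa>) x)\<bar>
    \<le> (Lpnorm \<Omega> 2 (wdiv \<Omega> (whess \<Omega> (\<Psi> \<kappa>))) + mHnorm1 \<Omega> (whess \<Omega> (\<Psi> \<kappa>)) + Hnorm \<Omega> 3 (\<Psi> \<kappa>)) * \<rho> * ?V" for \<kappa>
  proof -
    let ?\<xi> = "whess \<Omega> (\<Psi> \<kappa>)" and ?w = "\<Phi> \<kappa>"
    have w: "?w \<in> XD n" and p: "P \<kappa> \<in> XD n" using \<Phi> P by (simp_all add: vXD_nth)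
    note H1 = Hs_whess_nth[OF \<Psi>[of \<kappa>]]
    have L\<xi>: "Lp \<Omega> 2 ?\<xi>" by (rule Lp_whess[OF \<Psi>]) simp
    note Ld = Lp_wdiv[OF H1] and Lg = Lp2_gD[OF w] and LE = Lp_wgrad_E[OF w] and LH = Lp_D(3)[OF w] and LHP = Lp_D(3)[OF p]
    have DV: "Dnorm \<Omega> HD ?w \<le> ?V" by (rule Dnorm_le_vDnorm[OF \<Phi>])
    let ?T = "dint \<Omega> (\<lambda>x. wdiv \<Omega> ?\<xi> x \<bullet> (gD ?w x - wgrad \<Omega> (E ?w) x))"
    let ?W = "dint \<Omega> (\<lambda>x. ?\<xi> x \<bullet> HD ?w x + wdiv \<Omega> ?\<xi> x \<bullet> gD ?w x)"
    let ?Z = "dint \<Omega> (\<lambda>x. (?\<xi> x - HD (P \<kappa>) x) \<bullet> HD ?w x)"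
    have "?T = dint \<Omega> (\<lambda>x. wdiv \<Omega> ?\<xi> x \<bullet> gD ?w x) - dint \<Omega> (\<lambda>x. wdiv \<Omega> ?\<xi> x \<bullet> wgrad \<Omega> (E ?w) x)"
      unfolding dint_def inner_diff_right
      by (rule Bochner_Integration.integral_diff[OF L2_inner_integrable[OF Ld Lg] L2_inner_integrable[OF Ld LE]])
    moreover have "?W = dint \<Omega> (\<lambda>x. ?\<xi> x \<bullet> HD ?w x) + dint \<Omega> (\<lambda>x. wdiv \<Omega> ?\<xi> x \<bullet> gD ?w x)"
      unfolding dint_def
      by (rule Bochner_Integration.integral_add[OF L2_inner_integrable[OF L\<xi> LH] L2_inner_integrable[OF Ld Lg]])
    moreover have "?Z = dint \<Omega> (\<lambda>x. ?\<xi> x \<bullet> HD ?w x) - dint \<Omega> (\<lambda>x. HD (P \<kappa>) x \<bullet> HD ?w x)"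
      unfolding dint_def inner_diff_left
      by (rule Bochner_Integration.integral_diff[OF L2_inner_integrable[OF L\<xi> LH] L2_inner_integrable[OF LHP LH]])
    moreover have "dint \<Omega> (\<lambda>x. ?\<xi> x \<bullet> whess \<Omega> (E ?w) x) = - dint \<Omega> (\<lambda>x. wdiv \<Omega> ?\<xi> x \<bullet> wgrad \<Omega> (E ?w) x)"
      by (rule whess_integral_by_parts[OF \<Psi> Hs0_E[OF w]])
    \<comment> \<open>Integration by parts turns the companion's Hessian into its gradient. The
      difference is then the companion error ?T, minus the conformity defect ?W, plus the
      interpolation error ?Z; the integrals of \<xi> against \<open>HD\<close> and of its divergence
      against \<open>gD\<close> cancel.\<close>
    ultimately have eq: "dint \<Omega> (\<lambda>x. ?\<xi> x \<bullet> whess \<Omega> (E ?w) x) - dint \<Omega> (\<lambda>x. HD (P \<kappa>) x \<bullet> HD ?w x) = ?T - ?W + ?Z"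
      by linarith
    have "\<bar>?T\<bar> \<le> Lpnorm \<Omega> 2 (wdiv \<Omega> ?\<xi>) * Lpnorm \<Omega> 2 (\<lambda>x. gD ?w x - wgrad \<Omega> (E ?w) x)"
      by (rule L2_Cauchy_Schwarz(2)[OF Ld Lp_diff(1)[OF Lg LE]]) simp
    also have "\<dots> \<le> Lpnorm \<Omega> 2 (wdiv \<Omega> ?\<xi>) * (\<rho> * ?V)"
      using omegaE_bound[OF w] mult_mono[OF om DV _ Dnorm_nonneg] \<rho> by (intro mult_left_mono Lpnorm_nonneg) linarith
    finally have T: "\<bar>?T\<bar> \<le> Lpnorm \<Omega> 2 (wdiv \<Omega> ?\<xi>) * (\<rho> * ?V)" .
    have "\<bar>?W\<bar> \<le> gammaD \<Omega> n gD HD * mHnorm1 \<Omega> ?\<xi> * Dnorm \<Omega> HD ?w" by (rule WD_bound[OF H1 w])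
    also have "\<dots> \<le> \<rho> * mHnorm1 \<Omega> ?\<xi> * ?V"
      using \<rho> by (intro mult_mono ga DV mult_nonneg_nonneg mHnorm1_nonneg Dnorm_nonneg order_refl) simp_all
    finally have W: "\<bar>?W\<bar> \<le> mHnorm1 \<Omega> ?\<xi> * (\<rho> * ?V)" by (simp add: mult_ac)
    have "\<bar>?Z\<bar> \<le> Lpnorm \<Omega> 2 (\<lambda>x. ?\<xi> x - HD (P \<kappa>) x) * Dnorm \<Omega> HD ?w"
      unfolding Dnorm_def by (rule L2_Cauchy_Schwarz(2)[OF Lp_diff(1)[OF L\<xi> LHP] LH]) simp
    also have "\<dots> \<le> (\<rho> * Hnorm \<Omega> 3 (\<Psi> \<kappa>)) * ?V"
      using \<rho> by (intro mult_mono HP DV mult_nonneg_nonneg Hnorm_nonneg Dnorm_nonneg) simp_all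
    finally have "\<bar>?Z\<bar> \<le> Hnorm \<Omega> 3 (\<Psi> \<kappa>) * (\<rho> * ?V)" by (simp add: mult_ac)
    then show ?thesis unfolding eq using T W by (simp add: algebra_simps)
  qed
  have "formA \<Omega> (vhess \<Omega> \<Psi>) (vhess \<Omega> (\<lambda>\<kappa>. E (\<Phi> \<kappa>))) - formA \<Omega> (vHD HD P) (vHD HD \<Phi>)
    = (\<Sum>\<kappa>\<in>UNIV. dint \<Omega> (\<lambda>x. whess \<Omega> (\<Psi> \<kappa>) x \<bullet> whess \<Omega> (E (\<Phi> \<kappa>)) x) - dint \<Omega> (\<lambda>x. HD (P \<kappa>) x \<bullet> HD (\<Phi> \<kappa>) x))"
    unfolding vhess_def vHD_def sum_subtractf
    by (subst (1 2) formA_sum)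
      (auto intro!: Lp_whess[OF \<Psi>] Lp_whess[OF Hs0_Hs[OF Hs0_E]] Lp_D(3) vXD_nth P \<Phi>)
  also have "\<bar>\<dots>\<bar> \<le> (\<Sum>\<kappa>\<in>UNIV. (Lpnorm \<Omega> 2 (wdiv \<Omega> (whess \<Omega> (\<Psi> \<kappa>))) + mHnorm1 \<Omega> (whess \<Omega> (\<Psi> \<kappa>)) + Hnorm \<Omega> 3 (\<Psi> \<kappa>)) * \<rho> * ?V)"
    by (rule order_trans[OF sum_abs sum_mono]) (rule one)
  finally show ?thesis by (simp add: sum_distrib_right)
qed

end

lemma Lpnorm_minus_commute: "Lpnorm \<Omega> p (\<lambda>x. u x - v x) = Lpnorm \<Omega> p (\<lambda>x. v x - u x)"
  by (simp add: Lpnorm_def norm_minus_commute)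

section \<open>Consistency of the nonlinear form and the estimate for the ball\<close>

locale hessian_scheme_bilinear = hessian_scheme \<Omega> n PiD gD HD E + bilinear_form \<Omega> h
  for \<Omega> :: "(real^'d::finite) set" and n PiD gD HD E and h :: "real^'d^'k \<Rightarrow> real^'d^'k \<Rightarrow> real^'d^'d^'k::finite" +
  fixes cB :: real
  assumes cB0: "cB \<ge> 0"
    and cB: "\<And>\<Phi> \<Theta> \<Xi>. Lp \<Omega> 2 \<Phi> \<Longrightarrow> Lp \<Omega> 4 \<Theta> \<Longrightarrow> Lp \<Omega> 4 \<Xi> \<Longrightarrow>
        \<bar>formB \<Omega> h \<Phi> \<Theta> \<Xi>\<bar> \<le> cB * Lpnorm \<Omega> 2 \<Phi> * Lpnorm \<Omega> 4 \<Theta> * Lpnorm \<Omega> 4 \<Xi>"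
begin

lemma cB_mono:
  assumes "Lp \<Omega> 2 \<Phi>" "Lp \<Omega> 4 \<Theta>" "Lp \<Omega> 4 \<Xi>"
    and "Lpnorm \<Omega> 2 \<Phi> \<le> a" "Lpnorm \<Omega> 4 \<Theta> \<le> b" "Lpnorm \<Omega> 4 \<Xi> \<le> c"
  shows "\<bar>formB \<Omega> h \<Phi> \<Theta> \<Xi>\<bar> \<le> cB * a * b * c"
proof -
  have "0 \<le> a" "0 \<le> b" using assms(4,5) Lpnorm_nonneg order_trans by blast+
  then have "cB * Lpnorm \<Omega> 2 \<Phi> * Lpnorm \<Omega> 4 \<Theta> * Lpnorm \<Omega> 4 \<Xi> \<le> cB * a * b * c"
    using cB0 assms(4-6) by (intro mult_mono mult_nonneg_nonneg Lpnorm_nonneg order_refl)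
  then show ?thesis using cB[OF assms(1-3)] by linarith
qed

lemma frakA_vsub:
  assumes M: "M' \<in> vXD n" and P: "P \<in> vXD n" and \<Phi>: "\<Phi> \<in> vXD n"
  shows "frakA \<Omega> h gD HD P (vsub M' P) \<Phi> = frakA \<Omega> h gD HD P M' \<Phi> - frakA \<Omega> h gD HD P P \<Phi>"
proof -
  note L = Lp_vHD[OF M] Lp_vHD[OF P] Lp_vHD[OF \<Phi>] and G = Lp_vgD[OF M] Lp_vgD[OF P] Lp_vgD[OF \<Phi>]
  show ?thesis
    unfolding frakA_def vHD_vsub[OF M P] formA_diff[OF L(1-3)]
      formB_diff2[OF intB_244[OF L(2) G(1) G(3)] intB_244[OF L(2) G(2) G(3)]]
      formB_diff1[OF intB_244[OF L(1) G(2) G(3)] intB_244[OF L(2) G(2) G(3)]]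
    by simp
qed

lemma formB_vsub_vsub:
  assumes T: "\<Theta> \<in> vXD n" and P: "P \<in> vXD n" and \<Phi>: "\<Phi> \<in> vXD n"
  shows "formB \<Omega> h (vHD HD (vsub \<Theta> P)) (vgD gD (vsub \<Theta> P)) (vgD gD \<Phi>)
    = formB \<Omega> h (vHD HD \<Theta>) (vgD gD \<Theta>) (vgD gD \<Phi>) - formB \<Omega> h (vHD HD \<Theta>) (vgD gD P) (vgD gD \<Phi>)
      - formB \<Omega> h (vHD HD P) (vgD gD \<Theta>) (vgD gD \<Phi>) + formB \<Omega> h (vHD HD P) (vgD gD P) (vgD gD \<Phi>)"
proof -
  note L = Lp_vHD[OF T] Lp_vHD[OF P] and G = Lp_vgD[OF T] Lp_vgD[OF P] Lp_vgD[OF \<Phi>]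
  have D: "Lp \<Omega> 4 (\<lambda>x. vgD gD \<Theta> x - vgD gD P x)" by (rule Lp_diff(1)[OF G(1,2)]) simp
  show ?thesis
    unfolding vHD_vsub[OF T P]
      formB_diff1[OF intB_244[OF L(1) D G(3)] intB_244[OF L(2) D G(3)]]
      formB_diff2[OF intB_244[OF L(1) G(1) G(3)] intB_244[OF L(1) G(2) G(3)]]
      formB_diff2[OF intB_244[OF L(2) G(1) G(3)] intB_244[OF L(2) G(2) G(3)]]
    by simp
qed

text \<open>The factor in front of \<rho> must not see the discretisation, so the Hessian of the
  interpolant is traded for the continuous one plus an error, and discrete gradients are controlled
  through \<Gamma>.\<close>

lemma consistency_B:
  fixes \<Psi> :: "'k \<Rightarrow> real^'d \<Rightarrow> real"
  defines "k \<equiv> real CARD('k)"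
  defines "sH \<equiv> k\<^sup>2 * (\<Sum>\<kappa>\<in>UNIV. Hnorm \<Omega> 3 (\<Psi> \<kappa>))"
  assumes \<Psi>: "\<And>\<kappa>. Hs \<Omega> 3 (\<Psi> \<kappa>)" and \<Psi>0: "\<And>\<kappa>. Hs0 \<Omega> 2 (\<Psi> \<kappa>)" and P: "P \<in> vXD n" and \<Phi>: "\<Phi> \<in> vXD n"
    and C: "C \<ge> 0" "\<And>x y. norm (h x y) \<le> C * norm x * norm y"
    and om: "omegaE \<Omega> n gD HD E \<le> \<rho>" and CD: "CD \<Omega> n PiD gD HD \<le> \<Gamma>" and \<Gamma>: "\<Gamma> \<ge> 0"
    and HP: "\<And>\<kappa>. Lpnorm \<Omega> 2 (\<lambda>x. whess \<Omega> (\<Psi> \<kappa>) x - HD (P \<kappa>) x) \<le> \<rho> * Hnorm \<Omega> 3 (\<Psi> \<kappa>)"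
    and GP: "\<And>\<kappa>. Lpnorm \<Omega> 4 (\<lambda>x. wgrad \<Omega> (\<Psi> \<kappa>) x - gD (P \<kappa>) x) \<le> \<rho> * Hnorm \<Omega> 3 (\<Psi> \<kappa>)"
    and \<rho>: "0 < \<rho>" "\<rho> \<le> 1"
  shows "\<bar>formB \<Omega> h (vhess \<Omega> \<Psi>) (vgrad \<Omega> \<Psi>) (vgrad \<Omega> (\<lambda>\<kappa>. E (\<Phi> \<kappa>))) - formB \<Omega> h (vHD HD P) (vgD gD P) (vgD gD \<Phi>)\<bar>
    \<le> (C * Lpnorm \<Omega> 2 (\<lambda>x. norm (vhess \<Omega> \<Psi> x) * norm (vgrad \<Omega> \<Psi> x)) * k ^ 3
       + cB * sH * Lpnorm \<Omega> 4 (vgrad \<Omega> \<Psi>) * (k ^ 3 * \<Gamma>)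
       + cB * (4 * (sH + Lpnorm \<Omega> 2 (vhess \<Omega> \<Psi>))) * sH * (k ^ 3 * \<Gamma>)) * \<rho> * vDnorm \<Omega> HD \<Phi>"
proof -
  let ?V = "vDnorm \<Omega> HD \<Phi>"
  let ?H = "vhess \<Omega> \<Psi>" and ?G = "vgrad \<Omega> \<Psi>" and ?GE = "vgrad \<Omega> (\<lambda>\<kappa>. E (\<Phi> \<kappa>))"
    and ?HP = "vHD HD P" and ?GP = "vgD gD P" and ?GF = "vgD gD \<Phi>"
  have V0: "?V \<ge> 0" by (simp add: vDnorm_def Lpnorm_nonneg)
  have k0: "k \<ge> 0" by (simp add: k_def)
  have sH0: "sH \<ge> 0" unfolding sH_def by (intro mult_nonneg_nonneg sum_nonneg Hnorm_nonneg) simp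
  have LH: "Lp \<Omega> 2 ?H" unfolding vhess_def by (rule Lp_vec(1)[OF Lp_whess[OF \<Psi>]]) simp_all
  have LG: "Lp \<Omega> 4 ?G" unfolding vgrad_def by (rule Lp_vec(1)[OF wgrad_Lp4(1)[OF dim3 \<Psi>0]]) simp
  have LHG: "Lp \<Omega> 2 (\<lambda>x. norm (?H x) * norm (?G x))" by (rule hess_grad_L2[OF dim3 \<Psi> \<Psi>0])
  have LGE: "Lp \<Omega> 2 ?GE" unfolding vgrad_def by (intro Lp_vec(1) Lp_wgrad_E vXD_nth \<Phi>) simp
  note LHP = Lp_vHD[OF P] and LGP = Lp_vgD[OF P] and LGF = Lp_vgD[OF \<Phi>]
  have LGF2: "Lp \<Omega> 2 ?GF" by (rule Lp4_imp_Lp2[OF \<Omega>_lmeasurable LGF])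
  have dH: "Lp \<Omega> 2 (\<lambda>x. ?H x - ?HP x)" by (rule Lp_diff(1)[OF LH LHP]) simp
  have dG: "Lp \<Omega> 4 (\<lambda>x. ?G x - ?GP x)" by (rule Lp_diff(1)[OF LG LGP]) simp
  have dE: "Lp \<Omega> 2 (\<lambda>x. ?GE x - ?GF x)" by (rule Lp_diff(1)[OF LGE LGF2]) simp
  note B1 = formB_L2_bound[OF C Lp_measurable[OF LH] Lp_measurable[OF LG] LHG]
  \<comment> \<open>The third argument is exchanged first, while the other two are still the
    continuous fields: for these the product of norms is known to be in L^2, as the square
    integrable gradient error requires. The remaining exchanges act against \<open>?GF\<close>,
    which is in L^4.\<close>
  have eq: "formB \<Omega> h ?H ?G ?GE - formB \<Omega> h ?HP ?GP ?GF =
    formB \<Omega> h ?H ?G (\<lambda>x. ?GE x - ?GF x) + formB \<Omega> h (\<lambda>x. ?H x - ?HP x) ?G ?GF + formB \<Omega> h ?HP (\<lambda>x. ?G x - ?GP x) ?GF"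
    using formB_diff3[OF B1(1)[OF LGE] B1(1)[OF LGF2]]
      formB_diff1[OF intB_244[OF LH LG LGF] intB_244[OF LHP LG LGF]]
      formB_diff2[OF intB_244[OF LHP LG LGF] intB_244[OF LHP LGP LGF]] by simp
  have nH: "Lpnorm \<Omega> 2 (\<lambda>x. ?H x - ?HP x) \<le> \<rho> * sH"
  proof -
    have "(\<lambda>x. ?H x - ?HP x) = (\<lambda>x. \<chi> \<kappa>. whess \<Omega> (\<Psi> \<kappa>) x - HD (P \<kappa>) x)"
      by (simp add: vhess_def vHD_def vec_eq_iff fun_eq_iff)
    then have "Lpnorm \<Omega> 2 (\<lambda>x. ?H x - ?HP x) \<le> k\<^sup>2 * (\<Sum>\<kappa>\<in>UNIV. Lpnorm \<Omega> 2 (\<lambda>x. whess \<Omega> (\<Psi> \<kappa>) x - HD (P \<kappa>) x))"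
      unfolding k_def by (simp only:) (intro Lp_vec(2) Lp_diff(1) Lp_whess[OF \<Psi>] Lp_D(3) vXD_nth P, simp_all)
    also have "\<dots> \<le> k\<^sup>2 * (\<Sum>\<kappa>\<in>UNIV. \<rho> * Hnorm \<Omega> 3 (\<Psi> \<kappa>))" by (intro mult_left_mono sum_mono HP) simp
    finally show ?thesis by (simp add: sH_def sum_distrib_left mult_ac)
  qed
  have nG: "Lpnorm \<Omega> 4 (\<lambda>x. ?G x - ?GP x) \<le> \<rho> * sH"
  proof -
    have "(\<lambda>x. ?G x - ?GP x) = (\<lambda>x. \<chi> \<kappa>. wgrad \<Omega> (\<Psi> \<kappa>) x - gD (P \<kappa>) x)"
      by (simp add: vgrad_def vgD_def vec_eq_iff fun_eq_iff)
    then have "Lpnorm \<Omega> 4 (\<lambda>x. ?G x - ?GP x) \<le> k\<^sup>2 * (\<Sum>\<kappa>\<in>UNIV. Lpnorm \<Omega> 4 (\<lambda>x. wgrad \<Omega> (\<Psi> \<kappa>) x - gD (P \<kappa>) x))"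
      unfolding k_def by (simp only:) (intro Lp_vec(2) Lp_diff(1) wgrad_Lp4(1)[OF dim3 \<Psi>0] Lp_D(2) vXD_nth P, simp_all)
    also have "\<dots> \<le> k\<^sup>2 * (\<Sum>\<kappa>\<in>UNIV. \<rho> * Hnorm \<Omega> 3 (\<Psi> \<kappa>))" by (intro mult_left_mono sum_mono GP) simp
    finally show ?thesis by (simp add: sH_def sum_distrib_left mult_ac)
  qed
  have nE: "Lpnorm \<Omega> 2 (\<lambda>x. ?GE x - ?GF x) \<le> k ^ 3 * \<rho> * ?V"
  proof -
    have "(\<lambda>x. ?GE x - ?GF x) = (\<lambda>x. \<chi> \<kappa>. wgrad \<Omega> (E (\<Phi> \<kappa>)) x - gD (\<Phi> \<kappa>) x)"
      by (simp add: vgrad_def vgD_def vec_eq_iff fun_eq_iff)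
    then have "Lpnorm \<Omega> 2 (\<lambda>x. ?GE x - ?GF x) \<le> k\<^sup>2 * (\<Sum>\<kappa>\<in>UNIV. Lpnorm \<Omega> 2 (\<lambda>x. wgrad \<Omega> (E (\<Phi> \<kappa>)) x - gD (\<Phi> \<kappa>) x))"
      unfolding k_def by (simp only:) (intro Lp_vec(2) Lp_diff(1) Lp_wgrad_E Lp2_gD vXD_nth \<Phi>, simp_all)
    also have "\<dots> \<le> k\<^sup>2 * (\<Sum>\<kappa>\<in>(UNIV::'k set). \<rho> * ?V)"
    proof (intro mult_left_mono sum_mono)
      fix \<kappa>
      have "Lpnorm \<Omega> 2 (\<lambda>x. wgrad \<Omega> (E (\<Phi> \<kappa>)) x - gD (\<Phi> \<kappa>) x) \<le> omegaE \<Omega> n gD HD E * Dnorm \<Omega> HD (\<Phi> \<kappa>)"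
        using omegaE_bound[OF vXD_nth[OF \<Phi>, of \<kappa>]] by (subst Lpnorm_minus_commute)
      also have "\<dots> \<le> \<rho> * ?V" using \<rho> by (intro mult_mono om Dnorm_le_vDnorm \<Phi> Dnorm_nonneg) simp
      finally show "Lpnorm \<Omega> 2 (\<lambda>x. wgrad \<Omega> (E (\<Phi> \<kappa>)) x - gD (\<Phi> \<kappa>) x) \<le> \<rho> * ?V" .
    qed simp
    finally show ?thesis by (simp add: k_def power2_eq_square power3_eq_cube mult_ac)
  qed
  have nF: "Lpnorm \<Omega> 4 ?GF \<le> k ^ 3 * \<Gamma> * ?V" unfolding k_def by (rule vgD_bound[OF \<Phi> CD \<Gamma>])
  \<comment> \<open>\<rho> \<le> 1 replaces the interpolation error by sH, so that this factor is
    free of \<rho>.\<close>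
  have nHP: "Lpnorm \<Omega> 2 ?HP \<le> 4 * (sH + Lpnorm \<Omega> 2 ?H)"
  proof -
    have "Lpnorm \<Omega> 2 ?HP = Lpnorm \<Omega> 2 (\<lambda>x. ?H x - (?H x - ?HP x))" by simp
    also have "\<dots> \<le> 4 * (Lpnorm \<Omega> 2 ?H + Lpnorm \<Omega> 2 (\<lambda>x. ?H x - ?HP x))" by (rule Lp_diff(2)[OF LH dH]) simp
    also have "Lpnorm \<Omega> 2 (\<lambda>x. ?H x - ?HP x) \<le> 1 * sH"
      using nH mult_right_mono[OF \<rho>(2) sH0] by linarith
    finally show ?thesis by simp
  qed
  have 1: "\<bar>formB \<Omega> h ?H ?G (\<lambda>x. ?GE x - ?GF x)\<bar> \<le> C * Lpnorm \<Omega> 2 (\<lambda>x. norm (?H x) * norm (?G x)) * (k ^ 3 * \<rho> * ?V)"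
    by (rule order_trans[OF B1(2)[OF dE]]) (intro mult_left_mono nE mult_nonneg_nonneg C Lpnorm_nonneg)
  have 2: "\<bar>formB \<Omega> h (\<lambda>x. ?H x - ?HP x) ?G ?GF\<bar> \<le> cB * (\<rho> * sH) * Lpnorm \<Omega> 4 ?G * (k ^ 3 * \<Gamma> * ?V)"
    by (rule cB_mono[OF dH LG LGF nH order_refl nF])
  have 3: "\<bar>formB \<Omega> h ?HP (\<lambda>x. ?G x - ?GP x) ?GF\<bar> \<le> cB * (4 * (sH + Lpnorm \<Omega> 2 ?H)) * (\<rho> * sH) * (k ^ 3 * \<Gamma> * ?V)"
    by (rule cB_mono[OF LHP dG LGF nHP nG nF])
  have "\<bar>formB \<Omega> h ?H ?G ?GE - formB \<Omega> h ?HP ?GP ?GF\<bar> \<le> C * Lpnorm \<Omega> 2 (\<lambda>x. norm (?H x) * norm (?G x)) * (k ^ 3 * \<rho> * ?V)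
     + cB * (\<rho> * sH) * Lpnorm \<Omega> 4 ?G * (k ^ 3 * \<Gamma> * ?V) + cB * (4 * (sH + Lpnorm \<Omega> 2 ?H)) * (\<rho> * sH) * (k ^ 3 * \<Gamma> * ?V)"
    unfolding eq using 1 2 3 by linarith
  moreover have "a * (k ^ 3 * r * v) + cB * (r * s) * l * (k ^ 3 * g * v) + cB * t * (r * s) * (k ^ 3 * g * v)
    = (a * k ^ 3 + cB * s * l * (k ^ 3 * g) + cB * t * s * (k ^ 3 * g)) * r * v" for a r v s l g t
    by (simp add: algebra_simps)
  ultimately show ?thesis by simp
qed

text \<open>C1 carries no sign assumption, whence \<open>max 0\<close>: it covers M' = P, where the
  inf-sup hypothesis, stated for nonzero functions, says nothing.\<close>

lemma fixed_point_map_bound: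
  assumes T: "\<Theta> \<in> vXD n" and P: "P \<in> vXD n" and M': "M' \<in> vXD n"
    and CD: "CD \<Omega> n PiD gD HD \<le> \<Gamma>" and \<Gamma>: "\<Gamma> \<ge> 0" and bh: "bh > 0"
    and TP: "vDnorm \<Omega> HD (vsub \<Theta> P) \<le> R"
    and cons: "\<And>\<Phi>. \<Phi> \<in> vXD n \<Longrightarrow> \<bar>L (\<lambda>\<kappa>. E (\<Phi> \<kappa>)) - formA \<Omega> (vHD HD P) (vHD HD \<Phi>) - formB \<Omega> h (vHD HD P) (vgD gD P) (vgD gD \<Phi>)\<bar>
      \<le> C1 * vDnorm \<Omega> HD \<Phi>"
    and infsup: "\<And>\<Theta>. \<Theta> \<in> vXD n \<Longrightarrow> \<Theta> \<noteq> (\<lambda>_ _. 0) \<Longrightarrow> bh / 2 * vDnorm \<Omega> HD \<Theta> \<le>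
        Sup {frakA \<Omega> h gD HD P \<Theta> \<Phi> / vDnorm \<Omega> HD \<Phi> | \<Phi>. \<Phi> \<in> vXD n \<and> \<Phi> \<noteq> (\<lambda>_ _. 0)}"
    and eqn: "\<And>\<Phi>. \<Phi> \<in> vXD n \<Longrightarrow> frakA \<Omega> h gD HD P M' \<Phi> = L (\<lambda>\<kappa>. E (\<Phi> \<kappa>))
        + formB \<Omega> h (vHD HD P) (vgD gD \<Theta>) (vgD gD \<Phi>) + formB \<Omega> h (vHD HD \<Theta>) (vgD gD P) (vgD gD \<Phi>)
        - formB \<Omega> h (vHD HD \<Theta>) (vgD gD \<Theta>) (vgD gD \<Phi>)"
  shows "bh / 2 * vDnorm \<Omega> HD (vsub M' P) \<le> max 0 (C1 + cB * (real CARD('k) ^ 3 * \<Gamma>)\<^sup>2 * R\<^sup>2)"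
proof (cases "vsub M' P = (\<lambda>_ _. 0)")
  case True
  have "vHD HD (vsub M' P) = (\<lambda>x. 0)"
    unfolding True vHD_def lin_on_zero[OF lin_on_D(3)] by (simp add: vec_eq_iff fun_eq_iff)
  then show ?thesis by (simp add: vDnorm_def Lp_zero)
next
  case False
  let ?g = "real CARD('k) ^ 3 * \<Gamma>"
  note D = vsub_vXD[OF M' P] and DT = vsub_vXD[OF T P]
  have R0: "R \<ge> 0" using TP Lpnorm_nonneg[of \<Omega> 2 "vHD HD (vsub \<Theta> P)"] by (simp add: vDnorm_def)
  have g0: "?g \<ge> 0" using \<Gamma> by simp
  have le: "frakA \<Omega> h gD HD P (vsub M' P) \<Phi> \<le> (C1 + cB * ?g\<^sup>2 * R\<^sup>2) * vDnorm \<Omega> HD \<Phi>" if \<Phi>: "\<Phi> \<in> vXD n" for \<Phi>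
  proof -
    \<comment> \<open>The map is a Newton step with the derivative frozen at P, so the terms linear
      in \<Theta> cancel; the residual of P and the quadratic remainder are left.\<close>
    have eq: "frakA \<Omega> h gD HD P (vsub M' P) \<Phi> =
      (L (\<lambda>\<kappa>. E (\<Phi> \<kappa>)) - formA \<Omega> (vHD HD P) (vHD HD \<Phi>) - formB \<Omega> h (vHD HD P) (vgD gD P) (vgD gD \<Phi>))
      - formB \<Omega> h (vHD HD (vsub \<Theta> P)) (vgD gD (vsub \<Theta> P)) (vgD gD \<Phi>)"
      using frakA_vsub[OF M' P \<Phi>] eqn[OF \<Phi>] formB_vsub_vsub[OF T P \<Phi>] frakA_def[of \<Omega> h gD HD P P \<Phi>] by linarith
    have gR: "Lpnorm \<Omega> 4 (vgD gD (vsub \<Theta> P)) \<le> ?g * R"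
      by (rule order_trans[OF vgD_bound[OF DT CD \<Gamma>] mult_left_mono[OF TP g0]])
    have "\<bar>formB \<Omega> h (vHD HD (vsub \<Theta> P)) (vgD gD (vsub \<Theta> P)) (vgD gD \<Phi>)\<bar> \<le> cB * R * (?g * R) * (?g * vDnorm \<Omega> HD \<Phi>)"
      by (rule cB_mono[OF Lp_vHD[OF DT] Lp_vgD[OF DT] Lp_vgD[OF \<Phi>] TP[unfolded vDnorm_def] gR vgD_bound[OF \<Phi> CD \<Gamma>]])
    also have "\<dots> = cB * ?g\<^sup>2 * R\<^sup>2 * vDnorm \<Omega> HD \<Phi>" by (simp add: power2_eq_square mult_ac)
    finally show ?thesis unfolding eq using cons[OF \<Phi>] by (simp add: algebra_simps)
  qed
  have "bh / 2 * vDnorm \<Omega> HD (vsub M' P) \<le> Sup {frakA \<Omega> h gD HD P (vsub M' P) \<Phi> / vDnorm \<Omega> HD \<Phi> | \<Phi>. \<Phi> \<in> vXD n \<and> \<Phi> \<noteq> (\<lambda>_ _. 0)}"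
    by (rule infsup[OF D False])
  also have "\<dots> \<le> C1 + cB * ?g\<^sup>2 * R\<^sup>2"
  proof (rule cSup_least)
    show "{frakA \<Omega> h gD HD P (vsub M' P) \<Phi> / vDnorm \<Omega> HD \<Phi> | \<Phi>. \<Phi> \<in> vXD n \<and> \<Phi> \<noteq> (\<lambda>_ _. 0)} \<noteq> {}"
      using D False by blast
  next
    fix x assume "x \<in> {frakA \<Omega> h gD HD P (vsub M' P) \<Phi> / vDnorm \<Omega> HD \<Phi> | \<Phi>. \<Phi> \<in> vXD n \<and> \<Phi> \<noteq> (\<lambda>_ _. 0)}"
    then obtain \<Phi> where \<Phi>: "\<Phi> \<in> vXD n" "\<Phi> \<noteq> (\<lambda>_ _. 0)" "x = frakA \<Omega> h gD HD P (vsub M' P) \<Phi> / vDnorm \<Omega> HD \<Phi>" by blast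
    then show "x \<le> C1 + cB * ?g\<^sup>2 * R\<^sup>2" using le[OF \<Phi>(1)] vDnorm_pos[OF \<Phi>(1,2)] by (simp add: divide_le_eq)
  qed
  finally show ?thesis by (rule order_trans) simp
qed

end

theorem theorem4p8:
  fixes \<Omega> :: "(real^'d::finite) set"
    and h :: "real^'d^'k \<Rightarrow> real^'d^'k \<Rightarrow> real^'d^'d^'k::finite"
    and L :: "('k \<Rightarrow> real^'d \<Rightarrow> real) \<Rightarrow> real"
    and \<Psi> :: "'k \<Rightarrow> real^'d \<Rightarrow> real"
    and \<beta> :: real
  assumes dim: "CARD('d) \<le> 3"
    and dom: "open \<Omega>" "bounded \<Omega>" "convex \<Omega>" "\<Omega> \<noteq> {}" "\<Omega> \<noteq> UNIV"
    and h_bilin: "bilinear h"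
    and B_cont: "\<exists>c. \<forall>\<Phi> \<Theta> \<Xi>. Lp \<Omega> 2 \<Phi> \<longrightarrow> Lp \<Omega> 4 \<Theta> \<longrightarrow> Lp \<Omega> 4 \<Xi> \<longrightarrow>
        \<bar>formB \<Omega> h \<Phi> \<Theta> \<Xi>\<bar> \<le> c * Lpnorm \<Omega> 2 \<Phi> * Lpnorm \<Omega> 4 \<Theta> * Lpnorm \<Omega> 4 \<Xi>"
    and B_skew: "\<And>\<Xi> \<Theta>. Lp \<Omega> 2 \<Xi> \<Longrightarrow> Lp \<Omega> 4 \<Theta> \<Longrightarrow> formB \<Omega> h \<Xi> \<Theta> \<Theta> = 0"
    and L_dual: "is_Hminus1 \<Omega> L"
    and Psi_reg: "\<And>\<kappa>. Hs \<Omega> 3 (\<Psi> \<kappa>)" "vX \<Omega> \<Psi>"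
    and Psi_sol: "\<And>\<Phi>. vX \<Omega> \<Phi> \<Longrightarrow>
        formA \<Omega> (vhess \<Omega> \<Psi>) (vhess \<Omega> \<Phi>) + formB \<Omega> h (vhess \<Omega> \<Psi>) (vgrad \<Omega> \<Psi>) (vgrad \<Omega> \<Phi>)
          = L \<Phi>"
    and beta_pos: "\<beta> > 0"
    and inf_sup: "\<And>\<Theta>. vX \<Omega> \<Theta> \<Longrightarrow> Lpnorm \<Omega> 2 (vhess \<Omega> \<Theta>) \<noteq> 0 \<Longrightarrow>
        \<beta> * Lpnorm \<Omega> 2 (vhess \<Omega> \<Theta>) \<le>
          Sup {formAA \<Omega> h \<Psi> \<Theta> \<Phi> / Lpnorm \<Omega> 2 (vhess \<Omega> \<Phi>) | \<Phi>.
                 vX \<Omega> \<Phi> \<and> Lpnorm \<Omega> 2 (vhess \<Omega> \<Phi>) \<noteq> 0}"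
  shows "\<forall>\<Gamma>::real. \<forall>\<beta>h::real. \<Gamma> \<ge> 0 \<longrightarrow> \<beta>h > 0 \<longrightarrow>
    (\<exists>K>0. \<exists>\<rho>0>0. \<forall>\<rho>. 0 < \<rho> \<longrightarrow> \<rho> \<le> \<rho>0 \<longrightarrow>
      (\<forall>n PiD gD HD E P.
         hessian_disc \<Omega> n PiD gD HD
       \<longrightarrow> companion \<Omega> n E
       \<longrightarrow> (\<forall>\<kappa>. P \<kappa> \<in> XD n \<and> SD_err \<Omega> PiD gD HD (\<Psi> \<kappa>) (P \<kappa>) = SD \<Omega> n PiD gD HD (\<Psi> \<kappa>))
       \<longrightarrow> CD \<Omega> n PiD gD HD \<le> \<Gamma>
       \<longrightarrow> GammaE \<Omega> n HD E \<le> \<Gamma>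
       \<longrightarrow> omegaE \<Omega> n gD HD E \<le> \<rho>
       \<longrightarrow> alphaD \<Omega> n PiD gD HD \<le> \<rho>
       \<longrightarrow> gammaD \<Omega> n gD HD \<le> \<rho>
       \<longrightarrow> \<rho> * vHnorm \<Omega> 3 \<Psi> * (2 * Bnorm \<Omega> h * CD \<Omega> n PiD gD HD * (1 + CD \<Omega> n PiD gD HD)) \<le> \<beta>h
       \<longrightarrow> (\<forall>\<Theta>\<in>vXD n. \<Theta> \<noteq> (\<lambda>_ _. 0) \<longrightarrow>
             \<beta>h / 2 * vDnorm \<Omega> HD \<Theta> \<le>
               Sup {frakA \<Omega> h gD HD P \<Theta> \<Phi> / vDnorm \<Omega> HD \<Phi> | \<Phi>.
                      \<Phi> \<in> vXD n \<and> \<Phi> \<noteq> (\<lambda>_ _. 0)})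
       \<longrightarrow> (\<forall>\<Theta>\<in>vXD n. vDnorm \<Omega> HD (vsub \<Theta> P) \<le> K * \<rho> \<longrightarrow>
             (\<forall>M\<in>vXD n.
                (\<forall>\<Phi>\<in>vXD n. frakA \<Omega> h gD HD P M \<Phi> =
                    L (\<lambda>\<kappa>. E (\<Phi> \<kappa>))
                    + formB \<Omega> h (vHD HD P) (vgD gD \<Theta>) (vgD gD \<Phi>)
                    + formB \<Omega> h (vHD HD \<Theta>) (vgD gD P) (vgD gD \<Phi>)
                    - formB \<Omega> h (vHD HD \<Theta>) (vgD gD \<Theta>) (vgD gD \<Phi>))
                \<longrightarrow> vDnorm \<Omega> HD (vsub M P) \<le> K * \<rho>))))"
proof (intro allI impI)
  fix \<Gamma> bh :: real assume \<Gamma>: "\<Gamma> \<ge> 0" and bh: "bh > 0"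
  interpret bilinear_form \<Omega> h by unfold_locales (rule dom h_bilin)+
  have \<Psi>0: "Hs0 \<Omega> 2 (\<Psi> \<kappa>)" for \<kappa> using Psi_reg(2) by (simp add: vX_def)
  obtain c where c: "\<And>\<Phi> \<Theta> \<Xi>. Lp \<Omega> 2 \<Phi> \<Longrightarrow> Lp \<Omega> 4 \<Theta> \<Longrightarrow> Lp \<Omega> 4 \<Xi> \<Longrightarrow>
        \<bar>formB \<Omega> h \<Phi> \<Theta> \<Xi>\<bar> \<le> c * Lpnorm \<Omega> 2 \<Phi> * Lpnorm \<Omega> 4 \<Theta> * Lpnorm \<Omega> 4 \<Xi>"
    using B_cont by blast
  \<comment> \<open>No sign is known for c, and monotone estimates need a nonnegative factor. Fixing
    it here, before any discretisation is given, keeps K uniform.\<close>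
  define cB where "cB = \<bar>c\<bar>"
  have cB: "\<bar>formB \<Omega> h \<Phi> \<Theta> \<Xi>\<bar> \<le> cB * Lpnorm \<Omega> 2 \<Phi> * Lpnorm \<Omega> 4 \<Theta> * Lpnorm \<Omega> 4 \<Xi>"
    if "Lp \<Omega> 2 \<Phi>" "Lp \<Omega> 4 \<Theta>" "Lp \<Omega> 4 \<Xi>" for \<Phi> \<Theta> \<Xi>
  proof -
    have "c * Lpnorm \<Omega> 2 \<Phi> * Lpnorm \<Omega> 4 \<Theta> * Lpnorm \<Omega> 4 \<Xi> \<le> cB * Lpnorm \<Omega> 2 \<Phi> * Lpnorm \<Omega> 4 \<Theta> * Lpnorm \<Omega> 4 \<Xi>"
      unfolding cB_def by (intro mult_right_mono Lpnorm_nonneg) simp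
    then show ?thesis using c[OF that] by linarith
  qed
  obtain C where C: "C \<ge> 0" "\<And>x y. norm (h x y) \<le> C * norm x * norm y" using h_bound by blast
  define k where "k = real CARD('k)"
  define sH where "sH = k\<^sup>2 * (\<Sum>\<kappa>\<in>UNIV. Hnorm \<Omega> 3 (\<Psi> \<kappa>))"
  \<comment> \<open>The factors of the two consistency estimates added up; they are built from the
    continuous data and \<Gamma>, so K below involves neither \<rho> nor the discretisation.\<close>
  define C1 where "C1 = (\<Sum>\<kappa>\<in>UNIV. Lpnorm \<Omega> 2 (wdiv \<Omega> (whess \<Omega> (\<Psi> \<kappa>))) + mHnorm1 \<Omega> (whess \<Omega> (\<Psi> \<kappa>)) + Hnorm \<Omega> 3 (\<Psi> \<kappa>))
    + (C * Lpnorm \<Omega> 2 (\<lambda>x. norm (vhess \<Omega> \<Psi> x) * norm (vgrad \<Omega> \<Psi> x)) * k ^ 3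
       + cB * sH * Lpnorm \<Omega> 4 (vgrad \<Omega> \<Psi>) * (k ^ 3 * \<Gamma>)
       + cB * (4 * (sH + Lpnorm \<Omega> 2 (vhess \<Omega> \<Psi>))) * sH * (k ^ 3 * \<Gamma>))"
  define Q where "Q = cB * (k ^ 3 * \<Gamma>)\<^sup>2"
  \<comment> \<open>Ensures 4 C1 \<le> bh K, so that the consistency error uses at most half of the
    available bh/2 times K \<rho>. The summand 1 keeps K positive when C1 = 0.\<close>
  define K where "K = 4 * \<bar>C1\<bar> / bh + 1"
  \<comment> \<open>The second entry leaves the other half to the quadratic term, since it gives Q K
    \<rho> \<le> bh/4; Q + 1 avoids a division by zero. The entry 1 is required by the consistency
    estimate for the nonlinear form.\<close>
  define \<rho>0 where "\<rho>0 = min 1 (bh / (4 * (Q + 1) * K))"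
  have Q0: "Q \<ge> 0" by (simp add: Q_def cB_def)
  have K0: "K > 0" unfolding K_def using bh by (intro add_nonneg_pos divide_nonneg_pos) auto
  have K1: "4 * C1 \<le> bh * K"
  proof -
    have "bh * K = 4 * \<bar>C1\<bar> + bh" using bh by (simp add: K_def distrib_left)
    then show ?thesis using bh by simp
  qed
  have \<rho>00: "\<rho>0 > 0" unfolding \<rho>0_def using bh Q0 K0 by simp
  have small: "C1 * \<rho> + Q * (K * \<rho>)\<^sup>2 \<le> bh / 2 * (K * \<rho>)" if \<rho>: "0 < \<rho>" "\<rho> \<le> \<rho>0" for \<rho>
  proof -
    have "\<rho> \<le> bh / (4 * (Q + 1) * K)" using \<rho> by (simp add: \<rho>0_def)
    then have "4 * ((Q + 1) * K * \<rho>) \<le> bh" using Q0 K0 by (simp add: pos_le_divide_eq mult_ac)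
    moreover have "Q * K * \<rho> \<le> (Q + 1) * K * \<rho>" using \<rho> K0 by (intro mult_right_mono) auto
    ultimately have "4 * (Q * K * \<rho>) \<le> bh" by linarith
    then have "4 * (Q * K * \<rho>) * (K * \<rho>) \<le> bh * (K * \<rho>)" using K0 \<rho> by (intro mult_right_mono) auto
    moreover have "4 * C1 * \<rho> \<le> bh * K * \<rho>" using K1 \<rho> by (intro mult_right_mono) auto
    ultimately show ?thesis by (simp add: power2_eq_square mult_ac)
  qed
  show "\<exists>K>0. \<exists>\<rho>0>0. \<forall>\<rho>. 0 < \<rho> \<longrightarrow> \<rho> \<le> \<rho>0 \<longrightarrow>
      (\<forall>n PiD gD HD E P.
         hessian_disc \<Omega> n PiD gD HD
       \<longrightarrow> companion \<Omega> n E
       \<longrightarrow> (\<forall>\<kappa>. P \<kappa> \<in> XD n \<and> SD_err \<Omega> PiD gD HD (\<Psi> \<kappa>) (P \<kappa>) = SD \<Omega> n PiD gD HD (\<Psi> \<kappa>))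
       \<longrightarrow> CD \<Omega> n PiD gD HD \<le> \<Gamma>
       \<longrightarrow> GammaE \<Omega> n HD E \<le> \<Gamma>
       \<longrightarrow> omegaE \<Omega> n gD HD E \<le> \<rho>
       \<longrightarrow> alphaD \<Omega> n PiD gD HD \<le> \<rho>
       \<longrightarrow> gammaD \<Omega> n gD HD \<le> \<rho>
       \<longrightarrow> \<rho> * vHnorm \<Omega> 3 \<Psi> * (2 * Bnorm \<Omega> h * CD \<Omega> n PiD gD HD * (1 + CD \<Omega> n PiD gD HD)) \<le> bh
       \<longrightarrow> (\<forall>\<Theta>\<in>vXD n. \<Theta> \<noteq> (\<lambda>_ _. 0) \<longrightarrow>
             bh / 2 * vDnorm \<Omega> HD \<Theta> \<le>
               Sup {frakA \<Omega> h gD HD P \<Theta> \<Phi> / vDnorm \<Omega> HD \<Phi> | \<Phi>.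
                      \<Phi> \<in> vXD n \<and> \<Phi> \<noteq> (\<lambda>_ _. 0)})
       \<longrightarrow> (\<forall>\<Theta>\<in>vXD n. vDnorm \<Omega> HD (vsub \<Theta> P) \<le> K * \<rho> \<longrightarrow>
             (\<forall>M\<in>vXD n.
                (\<forall>\<Phi>\<in>vXD n. frakA \<Omega> h gD HD P M \<Phi> =
                    L (\<lambda>\<kappa>. E (\<Phi> \<kappa>))
                    + formB \<Omega> h (vHD HD P) (vgD gD \<Theta>) (vgD gD \<Phi>)
                    + formB \<Omega> h (vHD HD \<Theta>) (vgD gD P) (vgD gD \<Phi>)
                    - formB \<Omega> h (vHD HD \<Theta>) (vgD gD \<Theta>) (vgD gD \<Phi>))
                \<longrightarrow> vDnorm \<Omega> HD (vsub M P) \<le> K * \<rho>)))"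
  proof (rule exI[of _ K], rule conjI[OF K0], rule exI[of _ \<rho>0], rule conjI[OF \<rho>00], intro allI impI ballI)
    \<comment> \<open>The image of \<Theta> enters as any solution M' of its defining
      equation.\<close>
    fix \<rho> n PiD gD HD E P \<Theta> M'
    assume \<rho>: "0 < \<rho>" "\<rho> \<le> \<rho>0" and disc: "hessian_disc \<Omega> n PiD gD HD" and comp: "companion \<Omega> n E"
      and Pmin: "\<forall>\<kappa>. P \<kappa> \<in> XD n \<and> SD_err \<Omega> PiD gD HD (\<Psi> \<kappa>) (P \<kappa>) = SD \<Omega> n PiD gD HD (\<Psi> \<kappa>)"
      and CD: "CD \<Omega> n PiD gD HD \<le> \<Gamma>" and om: "omegaE \<Omega> n gD HD E \<le> \<rho>"
      and al: "alphaD \<Omega> n PiD gD HD \<le> \<rho>" and ga: "gammaD \<Omega> n gD HD \<le> \<rho>"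
      and infsup: "\<forall>\<Theta>\<in>vXD n. \<Theta> \<noteq> (\<lambda>_ _. 0) \<longrightarrow> bh / 2 * vDnorm \<Omega> HD \<Theta> \<le>
               Sup {frakA \<Omega> h gD HD P \<Theta> \<Phi> / vDnorm \<Omega> HD \<Phi> | \<Phi>. \<Phi> \<in> vXD n \<and> \<Phi> \<noteq> (\<lambda>_ _. 0)}"
      and T: "\<Theta> \<in> vXD n" and TP: "vDnorm \<Omega> HD (vsub \<Theta> P) \<le> K * \<rho>" and M': "M' \<in> vXD n"
      and eqn: "\<forall>\<Phi>\<in>vXD n. frakA \<Omega> h gD HD P M' \<Phi> = L (\<lambda>\<kappa>. E (\<Phi> \<kappa>))
                    + formB \<Omega> h (vHD HD P) (vgD gD \<Theta>) (vgD gD \<Phi>)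
                    + formB \<Omega> h (vHD HD \<Theta>) (vgD gD P) (vgD gD \<Phi>)
                    - formB \<Omega> h (vHD HD \<Theta>) (vgD gD \<Theta>) (vgD gD \<Phi>)"
    interpret S: hessian_scheme_bilinear \<Omega> n PiD gD HD E h cB
      using dim disc comp cB by unfold_locales (auto simp: cB_def)
    have \<rho>1: "\<rho> \<le> 1" using \<rho> by (simp add: \<rho>0_def)
    have P: "P \<in> vXD n" using Pmin by (simp add: vXD_def)
    \<comment> \<open>P is a minimiser, so its error equals \<open>SD\<close>, which \<alpha> \<le>
      \<rho> bounds; each of the three norms in the error is then bounded by the same
      quantity.\<close>
    have err: "SD_err \<Omega> PiD gD HD (\<Psi> \<kappa>) (P \<kappa>) \<le> \<rho> * Hnorm \<Omega> 3 (\<Psi> \<kappa>)" for \<kappa>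
      using Pmin S.SD_bound[OF Psi_reg(1) \<Psi>0, of \<kappa>] mult_right_mono[OF al Hnorm_nonneg[of \<Omega> 3 "\<Psi> \<kappa>"]] by simp
    have HP: "Lpnorm \<Omega> 2 (\<lambda>x. whess \<Omega> (\<Psi> \<kappa>) x - HD (P \<kappa>) x) \<le> \<rho> * Hnorm \<Omega> 3 (\<Psi> \<kappa>)"
      and GP: "Lpnorm \<Omega> 4 (\<lambda>x. wgrad \<Omega> (\<Psi> \<kappa>) x - gD (P \<kappa>) x) \<le> \<rho> * Hnorm \<Omega> 3 (\<Psi> \<kappa>)" for \<kappa>
      using err[of \<kappa>] Lpnorm_nonneg[of \<Omega> 2 "\<lambda>x. PiD (P \<kappa>) x - \<Psi> \<kappa> x"]
        Lpnorm_nonneg[of \<Omega> 4 "\<lambda>x. gD (P \<kappa>) x - wgrad \<Omega> (\<Psi> \<kappa>) x"] Lpnorm_nonneg[of \<Omega> 2 "\<lambda>x. HD (P \<kappa>) x - whess \<Omega> (\<Psi> \<kappa>) x"]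
        Lpnorm_minus_commute[of \<Omega> 2 "whess \<Omega> (\<Psi> \<kappa>)" "HD (P \<kappa>)"] Lpnorm_minus_commute[of \<Omega> 4 "wgrad \<Omega> (\<Psi> \<kappa>)" "gD (P \<kappa>)"]
      unfolding SD_err_def by linarith+
    have cons: "\<bar>L (\<lambda>\<kappa>. E (\<Phi> \<kappa>)) - formA \<Omega> (vHD HD P) (vHD HD \<Phi>) - formB \<Omega> h (vHD HD P) (vgD gD P) (vgD gD \<Phi>)\<bar>
      \<le> (C1 * \<rho>) * vDnorm \<Omega> HD \<Phi>" if \<Phi>: "\<Phi> \<in> vXD n" for \<Phi>
    proof -
      have "vX \<Omega> (\<lambda>\<kappa>. E (\<Phi> \<kappa>))" unfolding vX_def using S.Hs0_E[OF S.vXD_nth[OF \<Phi>]] by blast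
      note sol = Psi_sol[OF this]
      note A = S.consistency_A[OF Psi_reg(1) P \<Phi> om ga HP \<rho>(1)]
      note B = S.consistency_B[OF Psi_reg(1) \<Psi>0 P \<Phi> C om CD \<Gamma> HP GP \<rho>(1) \<rho>1, folded k_def, folded sH_def]
      have "\<bar>L (\<lambda>\<kappa>. E (\<Phi> \<kappa>)) - formA \<Omega> (vHD HD P) (vHD HD \<Phi>) - formB \<Omega> h (vHD HD P) (vgD gD P) (vgD gD \<Phi>)\<bar>
        \<le> \<bar>formA \<Omega> (vhess \<Omega> \<Psi>) (vhess \<Omega> (\<lambda>\<kappa>. E (\<Phi> \<kappa>))) - formA \<Omega> (vHD HD P) (vHD HD \<Phi>)\<bar>
          + \<bar>formB \<Omega> h (vhess \<Omega> \<Psi>) (vgrad \<Omega> \<Psi>) (vgrad \<Omega> (\<lambda>\<kappa>. E (\<Phi> \<kappa>))) - formB \<Omega> h (vHD HD P) (vgD gD P) (vgD gD \<Phi>)\<bar>"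
        unfolding sol[symmetric] by linarith
      also note add_mono[OF A B]
      finally show ?thesis unfolding C1_def distrib_right[of _ _ \<rho>] distrib_right[of _ _ "vDnorm \<Omega> HD \<Phi>"] .
    qed
    have "bh / 2 * vDnorm \<Omega> HD (vsub M' P) \<le> max 0 (C1 * \<rho> + Q * (K * \<rho>)\<^sup>2)"
      unfolding Q_def k_def
      by (rule S.fixed_point_map_bound[OF T P M' CD \<Gamma> bh TP cons]) (use infsup eqn in auto)
    also have "\<dots> \<le> bh / 2 * (K * \<rho>)"
      by (rule max.boundedI[OF _ small[OF \<rho>]]) (use bh K0 \<rho> in simp)
    finally show "vDnorm \<Omega> HD (vsub M' P) \<le> K * \<rho>" using bh by simp
  qed
qed

end
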